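(* Let $n\ge 1$ and let $\mathsf Q$ be the star-shaped quiver of length one with vertex set $I=\{0,1,\dots,n\}$ and exactly $n$ arrows, one arrow $i\to 0$ for each $i=1,\dots,n$. Let $\mathbf d=(d_i)_{i\in I}\in\mathbb Z_{>0}^I$ with $d_0=1$, let $\mathbf v\in\mathbb Z_{\ge0}^I$ be given by $v_0=2$ and $v_i=1$ $(i=1,\dots,n)$, and let $\lambda=(\lambda_i(z))_{i\in I}\in R^{\mathbf d}$ with $\lambda_{i,d_i}\neq0$ for $i=1,\dots,n$. Let $t_1,\dots,t_n\in\mathbb C$ be mutually distinct, and let $\xi_i(z),\eta_i(z)\in R^{d_i}$ $(i=1,\dots,n)$ be such that $\xi_i-\eta_i=\lambda_i$ for $i=1,\dots,n$ and $\sum_{i=1}^n\operatorname{res}_{z=0}\eta_i(z)=\operatorname{res}_{z=0}\lambda_0(z)$. Then the quiver variety with multiplicities $\mathscr N^{\mathrm s}_{\mathsf Q,\mathbf d}(\lambda,\mathbf v)$ is isomorphic to the moduli space of stable meromorphic connections $d-A(z)\,dz$ on the rank two trivial bundle over $\mathbb P^1$ whose poles are exactly $t_1,\dots,t_n$, the pole at $t_i$ having order $d_i$ and formal type (in the truncated sense) $\Xi_i(z)=\begin{pmatrix}\xi_i(z)&0\\0&\eta_i(z)\end{pmatrix}$; that is, to the space $\mathcal M^{\mathrm{irr}}(\Xi_1,\dots,\Xi_n)$.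
   Context: Quivers and quiver varieties with multiplicities. A quiver $\mathsf Q=(I,\Omega,\mathsf s,\mathsf t)$ consists of finite sets $I$ (vertices), $\Omega$ (arrows) and source/target maps $\mathsf s,\mathsf t:\Omega\to I$; no arrow has equal source and target. Let $\overline\Omega=\{\overline h\mid h\in\Omega\}$ be a copy of $\Omega$ with $\mathsf s(\overline h)=\mathsf t(h)$, $\mathsf t(\overline h)=\mathsf s(h)$; $H=\Omega\sqcup\overline\Omega$, with involution $h\mapsto\overline h$; $\epsilon(h)=1$ for $h\in\Omega$, $\epsilon(h)=-1$ for $h\in\overline\Omega$. For $d\in\mathbb Z_{>0}$ put $R_d=\mathbb C[[z]]/z^d\mathbb C[[z]]$, $R^d=z^{-d}\mathbb C[[z]]/\mathbb C[[z]]$; for multiplicities $\mathbf d=(d_i)\in\mathbb Z_{>0}^I$ put $R^{\mathbf d}=\bigoplus_iR^{d_i}$ and write $\lambda=(\lambda_i(z))\in R^{\mathbf d}$, $\lambda_i(z)=\sum_{k=1}^{d_i}\lambda_{i,k}z^{-k}$. For a finite-dimensional complex vector space $V$: $G_d(V)=\operatorname{Aut}_{R_d}(V\otimes_{\mathbb C}R_d)$, with Lie algebra $\mathfrak g_d(V)=\mathfrak{gl}(V)[[z]]/z^d\mathfrak{gl}(V)[[z]]$; its dual $\mathfrak g_d^*(V)$ is identified with $z^{-d}\mathfrak{gl}(V)[[z]]/\mathfrak{gl}(V)[[z]]$ via $(\xi,\eta)\mapsto\operatorname{res}_{z=0}\operatorname{tr}(\xi\eta)$, and the coadjoint action is $\eta\mapsto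 g\eta g^{-1}$ mod $\mathfrak{gl}(V)[[z]]$. For an $I$-graded finite-dimensional space $\mathbf V=\bigoplus V_i\ne0$ with $\dim\mathbf V=\mathbf v$: $\mathbf V_{\mathbf d}=\bigoplus_iV_i\otimes R_{d_i}$; $\mathbf M_{\mathsf Q,\mathbf d}(\mathbf V)=\bigoplus_{h\in H}\operatorname{Hom}_{\mathbb C}(V_{\mathsf s(h)}\otimes R_{d_{\mathsf s(h)}},V_{\mathsf t(h)}\otimes R_{d_{\mathsf t(h)}})$ with symplectic form $\omega=\tfrac12\sum_{h\in H}\epsilon(h)\operatorname{tr}dB_h\wedge dB_{\overline h}$; $G_{\mathbf d}(\mathbf V)=\prod_iG_{d_i}(V_i)$ acts by conjugation with moment map $\mu_{\mathbf d}=(\mu_{\mathbf d,i})$, $\mu_{\mathbf d,i}(B)=\sum_{k=1}^{d_i}\sum_{\mathsf t(h)=i}\epsilon(h)\operatorname{tr}_{R_{d_i}}[B_hB_{\overline h}N_i^{k-1}]z^{-k}\in\mathfrak g_{d_i}^*(V_i)$, where $N_i$ is multiplication by $z$ on $V_i\otimes R_{d_i}$ and $\operatorname{tr}_{R_d}:\operatorname{End}(V)\otimes\operatorname{End}(R_d)\to\operatorname{End}(V)$ is the partial trace. $B$ is stable if $\mathbf V_{\mathbf d}$ has no nonzero proper graded subspace $\mathbf S=\bigoplus S_i$ with each $S_i$ an $R_{d_i}$-submodule and $B_h(S_{\mathsf s(h)})\subset S_{\mathsf t(h)}$ for all $h\in H$. $\mathscr N^{\mathrm s}_{\mathsf Q,\mathbf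 d}(\lambda,\mathbf v)=\{B\text{ stable}\mid\mu_{\mathbf d,i}(B)=-\lambda_i(z)\mathrm{Id}_{V_i}\ \forall i\}/G_{\mathbf d}(\mathbf V)$, a holomorphic symplectic manifold with form induced from $\omega$ when nonempty. Moduli of connections. Let $V=\mathbb C^2$. An element $(A_i)\in\bigoplus_{i=1}^n\mathfrak g_{d_i}^*(V)$, $A_i(z)=\sum_jA_{i,j}z^{-j}$, is identified with the system $A(z)=\sum_i\sum_jA_{i,j}(z-t_i)^{-j}$, i.e. with the meromorphic connection $d-A(z)dz$ on $\mathbb P^1\times V$; it has no pole at $\infty$ iff $\sum_iA_{i,1}=0$. The truncated formal type of $A(z)$ at $t_i$ is the $G_{d_i}(V)$-coadjoint orbit through $A_i$; having truncated formal type $\Xi_i$ means that this orbit is the one, $\mathcal O_i$, through $\Xi_i$. (The connection on the trivial bundle is stable iff the system is irreducible, i.e. no nonzero proper subspace of $V$ is preserved by all $A_{i,j}$.) $\mathcal M^{\mathrm{irr}}(\Xi_1,\dots,\Xi_n)=\{A\in\prod_i\mathcal O_i\mid A\text{ irreducible},\ \sum_i\operatorname{res}_{z=t_i}A(z)=0\}/\operatorname{GL}(V)$, with the holomorphic symplectic structure obtained by reduction from the product of the Kirillov–Kostant–Souriau forms. *)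

theory Defs
  imports
    "HOL-Complex_Analysis.Complex_Analysis"
    "Jordan_Normal_Form.Matrix"
    "Graph_Theory.Digraph"
begin

no_notation fls_nth (infixl "$$" 75)

section \<open>Holomorphic symplectic quotients\<close>

text \<open>
  Both spaces are of the form \<open>Z / G\<close> with \<open>Z\<close> a locally closed complex submanifold of \<open>\<complex>\<^sup>J\<close>
  (\<open>J\<close> finite), with \<open>G\<close> acting on \<open>Z\<close>, and with a two-form on \<open>Z\<close> which descends to \<open>Z / G\<close>.
  The record keeps \<open>J\<close>, \<open>Z\<close>, the orbit relation on \<open>Z\<close> and the two-form; points and tangent
  vectors are extensional functions on \<open>J\<close>. The complex structure of \<open>Z / G\<close> is encoded by the
  quotient topology together with the sheaf of holomorphic functions.
\<close>

record 'j symplectic_quotient =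
  coords :: "'j set"
  level :: "('j \<Rightarrow> complex) set"
  orbit_rel :: "(('j \<Rightarrow> complex) \<times> ('j \<Rightarrow> complex)) set"
  two_form :: "('j \<Rightarrow> complex) \<Rightarrow> ('j \<Rightarrow> complex) \<Rightarrow> ('j \<Rightarrow> complex) \<Rightarrow> complex"

definition affine_top :: "'j set \<Rightarrow> ('j \<Rightarrow> complex) topology" where
  "affine_top J = product_topology (\<lambda>_. euclidean) J"

text \<open>Complex Frechet differentiability of a function of the finitely many variables in \<open>J\<close>.\<close>

definition complex_differentiable_at ::
  "'j set \<Rightarrow> (('j \<Rightarrow> complex) \<Rightarrow> complex) \<Rightarrow> ('j \<Rightarrow> complex) \<Rightarrow> bool" where
  "complex_differentiable_at J f x \<longleftrightarrow>
     (\<exists>c. \<forall>e>0. \<exists>\<delta>>0. \<forall>y\<in>topspace (affine_top J). (\<forall>j\<in>J. cmod (y j - x j) < \<delta>) \<longrightarrow>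
        cmod (f y - f x - (\<Sum>j\<in>J. c j * (y j - x j))) \<le> e * (\<Sum>j\<in>J. cmod (y j - x j)))"

definition orbit :: "'j symplectic_quotient \<Rightarrow> ('j \<Rightarrow> complex) \<Rightarrow> ('j \<Rightarrow> complex) set" where
  "orbit X x = orbit_rel X `` {x}"

definition quotient_space :: "'j symplectic_quotient \<Rightarrow> ('j \<Rightarrow> complex) set set" where
  "quotient_space X = level X // orbit_rel X"

definition quotient_open :: "'j symplectic_quotient \<Rightarrow> ('j \<Rightarrow> complex) set set \<Rightarrow> bool" where
  "quotient_open X U \<longleftrightarrow> U \<subseteq> quotient_space X \<and>
     openin (subtopology (affine_top (coords X)) (level X)) {x \<in> level X. orbit X x \<in> U}"

definition quotient_top :: "'j symplectic_quotient \<Rightarrow> ('j \<Rightarrow> complex) set topology" where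
  "quotient_top X = topology (quotient_open X)"

lemma openin_quotient_top: "openin (quotient_top X) U \<longleftrightarrow> quotient_open X U"
proof -
  have "istopology (quotient_open X)"
    unfolding istopology_def
  proof (intro conjI allI impI)
    fix S T assume "quotient_open X S" "quotient_open X T"
    moreover have "{x \<in> level X. orbit X x \<in> S \<inter> T} =
      {x \<in> level X. orbit X x \<in> S} \<inter> {x \<in> level X. orbit X x \<in> T}" by auto
    ultimately show "quotient_open X (S \<inter> T)"
      by (auto simp: quotient_open_def intro: openin_Int)
  next
    fix K assume K: "\<forall>S\<in>K. quotient_open X S"
    have "{x \<in> level X. orbit X x \<in> \<Union>K} = (\<Union>S\<in>K. {x \<in> level X. orbit X x \<in> S})" by auto
    moreover have "openin (subtopology (affine_top (coords X)) (level X))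
        (\<Union>S\<in>K. {x \<in> level X. orbit X x \<in> S})"
      using K by (intro openin_Union) (auto simp: quotient_open_def)
    ultimately show "quotient_open X (\<Union>K)"
      using K by (auto simp: quotient_open_def)
  qed
  then show ?thesis by (simp add: quotient_top_def)
qed

text \<open>
  A function on an open subset \<open>U\<close> of \<open>Z / G\<close> is holomorphic iff its pullback to \<open>Z\<close> is locally
  the restriction of a holomorphic function on an open subset of \<open>\<complex>\<^sup>J\<close>.
\<close>

definition quotient_holomorphic ::
  "'j symplectic_quotient \<Rightarrow> ('j \<Rightarrow> complex) set set \<Rightarrow> (('j \<Rightarrow> complex) set \<Rightarrow> complex) \<Rightarrow> bool" where
  "quotient_holomorphic X U f \<longleftrightarrow>
     (\<forall>x\<in>level X. orbit X x \<in> U \<longrightarrow>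
        (\<exists>W F. openin (affine_top (coords X)) W \<and> x \<in> W \<and>
           (\<forall>y\<in>W. complex_differentiable_at (coords X) F y) \<and>
           (\<forall>y\<in>W \<inter> level X. orbit X y \<in> U \<longrightarrow> f (orbit X y) = F y)))"

definition biholomorphic_map ::
  "'j symplectic_quotient \<Rightarrow> 'k symplectic_quotient \<Rightarrow>
     (('j \<Rightarrow> complex) set \<Rightarrow> ('k \<Rightarrow> complex) set) \<Rightarrow> bool" where
  "biholomorphic_map X Y \<Phi> \<longleftrightarrow>
     homeomorphic_map (quotient_top X) (quotient_top Y) \<Phi> \<and>
     (\<forall>U f. openin (quotient_top Y) U \<longrightarrow>
        (quotient_holomorphic Y U f \<longleftrightarrow>
         quotient_holomorphic X {p \<in> quotient_space X. \<Phi> p \<in> U} (f \<circ> \<Phi>)))"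

definition holomorphic_curve :: "'j symplectic_quotient \<Rightarrow> real \<Rightarrow> (complex \<Rightarrow> 'j \<Rightarrow> complex) \<Rightarrow> bool"
  where
  "holomorphic_curve X r \<gamma> \<longleftrightarrow>
     (\<forall>s\<in>ball 0 r. \<gamma> s \<in> level X) \<and> (\<forall>j\<in>coords X. (\<lambda>s. \<gamma> s j) holomorphic_on ball 0 r)"

definition velocity :: "'j symplectic_quotient \<Rightarrow> (complex \<Rightarrow> 'j \<Rightarrow> complex) \<Rightarrow> 'j \<Rightarrow> complex" where
  "velocity X \<gamma> = restrict (\<lambda>j. deriv (\<lambda>s. \<gamma> s j) 0) (coords X)"

text \<open>
  The condition \<open>\<Phi>\<^sup>*\<omega>\<^sub>Y = \<omega>\<^sub>X\<close> on the reduced forms. A tangent vector of a quotient is represented by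
  the velocity of a holomorphic curve in the level set; \<open>\<delta>\<close> represents the image under \<open>d\<Phi>\<close> of the
  tangent vector represented by \<open>\<gamma>\<close> when \<open>\<Phi>\<close> maps the class of \<open>\<gamma> s\<close> to the class of \<open>\<delta> s\<close>.
\<close>

definition preserves_form ::
  "'j symplectic_quotient \<Rightarrow> 'k symplectic_quotient \<Rightarrow>
     (('j \<Rightarrow> complex) set \<Rightarrow> ('k \<Rightarrow> complex) set) \<Rightarrow> bool" where
  "preserves_form X Y \<Phi> \<longleftrightarrow>
     (\<forall>r>0. \<forall>\<gamma>\<^sub>1 \<gamma>\<^sub>2 \<delta>\<^sub>1 \<delta>\<^sub>2.
        holomorphic_curve X r \<gamma>\<^sub>1 \<and> holomorphic_curve X r \<gamma>\<^sub>2 \<and> \<gamma>\<^sub>1 0 = \<gamma>\<^sub>2 0 \<and>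
        holomorphic_curve Y r \<delta>\<^sub>1 \<and> holomorphic_curve Y r \<delta>\<^sub>2 \<and> \<delta>\<^sub>1 0 = \<delta>\<^sub>2 0 \<and>
        (\<forall>s\<in>ball 0 r. \<Phi> (orbit X (\<gamma>\<^sub>1 s)) = orbit Y (\<delta>\<^sub>1 s) \<and>
                      \<Phi> (orbit X (\<gamma>\<^sub>2 s)) = orbit Y (\<delta>\<^sub>2 s)) \<longrightarrow>
        two_form Y (\<delta>\<^sub>1 0) (velocity Y \<delta>\<^sub>1) (velocity Y \<delta>\<^sub>2) =
        two_form X (\<gamma>\<^sub>1 0) (velocity X \<gamma>\<^sub>1) (velocity X \<gamma>\<^sub>2))"

definition symplectically_isomorphic ::
  "'j symplectic_quotient \<Rightarrow> 'k symplectic_quotient \<Rightarrow> bool" where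
  "symplectically_isomorphic X Y \<longleftrightarrow> (\<exists>\<Phi>. biholomorphic_map X Y \<Phi> \<and> preserves_form X Y \<Phi>)"

section \<open>Linear algebra over truncated power series\<close>

definition mat_trace :: "'a :: comm_monoid_add mat \<Rightarrow> 'a" where
  "mat_trace A = (\<Sum>a<dim_row A. A $$ (a, a))"

definition general_linear :: "nat \<Rightarrow> 'a :: comm_ring_1 mat set" where
  "general_linear r = {g \<in> carrier_mat r r. invertible_mat g}"

definition mat_inv :: "'a :: comm_ring_1 mat \<Rightarrow> 'a mat" where
  "mat_inv g = (THE h. h \<in> carrier_mat (dim_row g) (dim_row g) \<and> inverts_mat g h \<and> inverts_mat h g)"

definition is_subspace :: "nat \<Rightarrow> complex vec set \<Rightarrow> bool" where
  "is_subspace m S \<longleftrightarrow> S \<subseteq> carrier_vec m \<and> 0\<^sub>v m \<in> S \<and>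
     (\<forall>u\<in>S. \<forall>w\<in>S. u + w \<in> S) \<and> (\<forall>c. \<forall>u\<in>S. c \<cdot>\<^sub>v u \<in> S)"

text \<open>
  For \<open>V = \<complex>\<^sup>r\<close>, the space \<open>V \<otimes> R\<^sub>d\<close> is \<open>\<complex>\<^bsup>rd\<^esup>\<close>: the basis vector \<open>e\<^sub>a \<otimes> z\<^sup>k\<close>
  (\<open>a < r\<close>, \<open>k < d\<close>) has index \<open>a * d + k\<close>.
\<close>

definition mult_z :: "nat \<Rightarrow> nat \<Rightarrow> complex mat" where
  "mult_z d r = Matrix.mat (r * d) (r * d)
     (\<lambda>(p, q). if p div d = q div d \<and> p mod d = Suc (q mod d) then 1 else 0)"

text \<open>\<open>G\<^sub>d(V) = Aut\<^bsub>R\<^sub>d\<^esub>(V \<otimes> R\<^sub>d)\<close>: an \<open>R\<^sub>d\<close>-linear map is a \<open>\<complex>\<close>-linear map commuting with \<open>z\<close>.\<close>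

definition aut_group :: "nat \<Rightarrow> nat \<Rightarrow> complex mat set" where
  "aut_group d r = {g \<in> general_linear (r * d). g * mult_z d r = mult_z d r * g}"

definition partial_trace :: "nat \<Rightarrow> nat \<Rightarrow> complex mat \<Rightarrow> complex mat" where
  "partial_trace d r M = Matrix.mat r r (\<lambda>(a, b). \<Sum>k<d. M $$ (a * d + k, b * d + k))"

text \<open>
  Elements of \<open>z\<^bsup>-d\<^esup>\<complex>[[z]] / \<complex>[[z]]\<close> are represented by their Laurent tails, and similarly for
  \<open>z\<^bsup>-d\<^esup>gl(V)[[z]] / gl(V)[[z]]\<close>, the dual of the Lie algebra of \<open>G\<^sub>d(V)\<close>.
\<close>

definition laurent_tails :: "nat \<Rightarrow> complex fls set" where
  "laurent_tails d = {f. \<forall>k. fls_nth f k \<noteq> 0 \<longrightarrow> - int d \<le> k \<and> k < 0}"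

definition tail_of :: "complex fls \<Rightarrow> complex fls" where
  "tail_of f = f - fps_to_fls (fls_regpart f)"

definition monomial :: "complex \<Rightarrow> int \<Rightarrow> complex fls" where
  "monomial c k = fls_const c * fls_X_intpow k"

text \<open>
  In the next three definitions elements of \<open>G\<^sub>d(V)\<close> and of its Lie algebra are represented by lifts
  to \<open>GL(V)(\<complex>[[z]])\<close> and \<open>gl(V)[[z]]\<close>. On tails of order at most \<open>d\<close> the results depend only on
  the lifts modulo \<open>z\<^sup>d\<close>, and every element has a lift.
\<close>

definition coadjoint :: "complex fps mat \<Rightarrow> complex fls mat \<Rightarrow> complex fls mat" where
  "coadjoint g \<eta> = map_mat tail_of (map_mat fps_to_fls g * \<eta> * map_mat fps_to_fls (mat_inv g))"

definition coadjoint_lie :: "complex fps mat \<Rightarrow> complex fls mat \<Rightarrow> complex fls mat" where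
  "coadjoint_lie \<xi> \<eta> = map_mat tail_of (map_mat fps_to_fls \<xi> * \<eta> - \<eta> * map_mat fps_to_fls \<xi>)"

definition residue_pairing :: "complex fps mat \<Rightarrow> complex fls mat \<Rightarrow> complex" where
  "residue_pairing \<xi> \<eta> = fls_residue (mat_trace (map_mat fps_to_fls \<xi> * \<eta>))"

definition coadjoint_orbit :: "nat \<Rightarrow> complex fls mat \<Rightarrow> complex fls mat set" where
  "coadjoint_orbit r \<eta> = {coadjoint g \<eta> |g. g \<in> general_linear r}"

text \<open>
  The Kirillov-Kostant-Souriau form \<open>\<omega>\<^sub>\<eta>(ad\<^sup>*\<^sub>\<xi> \<eta>, ad\<^sup>*\<^sub>\<zeta> \<eta>) = \<langle>\<eta>, [\<xi>, \<zeta>]\<rangle>\<close>, for which the inclusion of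
  the orbit is a moment map in the convention \<open>\<omega>(\<xi>\<^sup>*, -) = d\<langle>\<mu>, \<xi>\<rangle>\<close>; this is also the convention in
  which \<open>moment\<close> below is a moment map for \<open>quiver_form\<close>.
\<close>

definition kks_form :: "nat \<Rightarrow> complex fls mat \<Rightarrow> complex fls mat \<Rightarrow> complex fls mat \<Rightarrow> complex" where
  "kks_form r \<eta> u w = (THE c. \<exists>\<xi>\<in>carrier_mat r r. \<exists>\<zeta>\<in>carrier_mat r r.
     u = coadjoint_lie \<xi> \<eta> \<and> w = coadjoint_lie \<zeta> \<eta> \<and> c = residue_pairing (\<xi> * \<zeta> - \<zeta> * \<xi>) \<eta>)"

section \<open>Quiver varieties with multiplicities\<close>

text \<open>For an arrow set \<open>\<Omega>\<close>, the doubled set \<open>H\<close> is \<open>\<Omega> <+> \<Omega>\<close>, with \<open>Inr h\<close> the reverse of \<open>Inl h\<close>.\<close>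

type_synonym 'h darrow = "'h + 'h"

definition double_arcs :: "('i, 'h) pre_digraph \<Rightarrow> 'h darrow set" where
  "double_arcs Q = arcs Q <+> arcs Q"

definition src :: "('i, 'h) pre_digraph \<Rightarrow> 'h darrow \<Rightarrow> 'i" where
  "src Q = case_sum (tail Q) (head Q)"

definition tgt :: "('i, 'h) pre_digraph \<Rightarrow> 'h darrow \<Rightarrow> 'i" where
  "tgt Q = case_sum (head Q) (tail Q)"

definition rev_arc :: "'h darrow \<Rightarrow> 'h darrow" where
  "rev_arc = case_sum Inr Inl"

definition arc_sign :: "'h darrow \<Rightarrow> complex" where
  "arc_sign = case_sum (\<lambda>_. 1) (\<lambda>_. -1)"

type_synonym 'h quiver_index = "'h darrow \<times> nat \<times> nat"

definition quiver_coords ::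
  "('i, 'h) pre_digraph \<Rightarrow> ('i \<Rightarrow> nat) \<Rightarrow> ('i \<Rightarrow> nat) \<Rightarrow> 'h quiver_index set" where
  "quiver_coords Q d v =
     (SIGMA h : double_arcs Q. {..<v (tgt Q h) * d (tgt Q h)} \<times> {..<v (src Q h) * d (src Q h)})"

definition arrow_map ::
  "('i, 'h) pre_digraph \<Rightarrow> ('i \<Rightarrow> nat) \<Rightarrow> ('i \<Rightarrow> nat) \<Rightarrow> ('h quiver_index \<Rightarrow> complex) \<Rightarrow> 'h darrow \<Rightarrow> complex mat"
  where
  "arrow_map Q d v B h = Matrix.mat (v (tgt Q h) * d (tgt Q h)) (v (src Q h) * d (src Q h))
     (\<lambda>(p, q). B (h, p, q))"

definition quiver_form ::
  "('i, 'h) pre_digraph \<Rightarrow> ('i \<Rightarrow> nat) \<Rightarrow> ('i \<Rightarrow> nat) \<Rightarrow> ('h quiver_index \<Rightarrow> complex) \<Rightarrow>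
     ('h quiver_index \<Rightarrow> complex) \<Rightarrow> complex" where
  "quiver_form Q d v u w = 1 / 2 * (\<Sum>h\<in>double_arcs Q. arc_sign h *
     (mat_trace (arrow_map Q d v u h * arrow_map Q d v w (rev_arc h)) -
      mat_trace (arrow_map Q d v w h * arrow_map Q d v u (rev_arc h))))"

definition moment ::
  "('i, 'h) pre_digraph \<Rightarrow> ('i \<Rightarrow> nat) \<Rightarrow> ('i \<Rightarrow> nat) \<Rightarrow> ('h quiver_index \<Rightarrow> complex) \<Rightarrow> 'i \<Rightarrow> complex fls mat"
  where
  "moment Q d v B i = Matrix.mat (v i) (v i) (\<lambda>(a, b). \<Sum>k = 1..d i.
     monomial (\<Sum>h\<in>{h \<in> double_arcs Q. tgt Q h = i}. arc_sign h *
        partial_trace (d i) (v i)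
          (arrow_map Q d v B h * arrow_map Q d v B (rev_arc h) * (mult_z (d i) (v i) ^\<^sub>m (k - 1)))
        $$ (a, b)) (- int k))"

definition stable ::
  "('i, 'h) pre_digraph \<Rightarrow> ('i \<Rightarrow> nat) \<Rightarrow> ('i \<Rightarrow> nat) \<Rightarrow> ('h quiver_index \<Rightarrow> complex) \<Rightarrow> bool" where
  "stable Q d v B \<longleftrightarrow> \<not> (\<exists>S.
     (\<forall>i\<in>verts Q. is_subspace (v i * d i) (S i) \<and> (\<forall>x\<in>S i. mult_z (d i) (v i) *\<^sub>v x \<in> S i)) \<and>
     (\<forall>h\<in>double_arcs Q. \<forall>x\<in>S (src Q h). arrow_map Q d v B h *\<^sub>v x \<in> S (tgt Q h)) \<and>
     (\<exists>i\<in>verts Q. S i \<noteq> {0\<^sub>v (v i * d i)}) \<and>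
     (\<exists>i\<in>verts Q. S i \<noteq> carrier_vec (v i * d i)))"

definition quiver_level ::
  "('i, 'h) pre_digraph \<Rightarrow> ('i \<Rightarrow> nat) \<Rightarrow> ('i \<Rightarrow> nat) \<Rightarrow> ('i \<Rightarrow> complex fls) \<Rightarrow>
     ('h quiver_index \<Rightarrow> complex) set" where
  "quiver_level Q d v lam = {B \<in> topspace (affine_top (quiver_coords Q d v)).
     stable Q d v B \<and> (\<forall>i\<in>verts Q. moment Q d v B i = (- lam i) \<cdot>\<^sub>m 1\<^sub>m (v i))}"

definition quiver_variety ::
  "('i, 'h) pre_digraph \<Rightarrow> ('i \<Rightarrow> nat) \<Rightarrow> ('i \<Rightarrow> complex fls) \<Rightarrow> ('i \<Rightarrow> nat) \<Rightarrow>
     'h quiver_index symplectic_quotient" where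
  "quiver_variety Q d lam v =
     \<lparr> coords = quiver_coords Q d v,
       level = quiver_level Q d v lam,
       orbit_rel = {(B, C). B \<in> quiver_level Q d v lam \<and> C \<in> quiver_level Q d v lam \<and>
         (\<exists>g. (\<forall>i\<in>verts Q. g i \<in> aut_group (d i) (v i)) \<and>
            (\<forall>h\<in>double_arcs Q. arrow_map Q d v C h =
               g (tgt Q h) * arrow_map Q d v B h * mat_inv (g (src Q h))))},
       two_form = (\<lambda>B. quiver_form Q d v) \<rparr>"

definition star_quiver :: "nat \<Rightarrow> (nat, nat) pre_digraph" where
  "star_quiver n = \<lparr> verts = {0..n}, arcs = {1..n}, tail = (\<lambda>i. i), head = (\<lambda>i. 0) \<rparr>"

section \<open>Moduli of connections on the rank two trivial bundle\<close>

text \<open>The coordinate \<open>(i, j, a, b)\<close> is the \<open>(a, b)\<close> entry of the coefficient \<open>A\<^bsub>i,j\<^esub>\<close>.\<close>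

type_synonym conn_index = "nat \<times> nat \<times> nat \<times> nat"

definition conn_coords :: "nat \<Rightarrow> (nat \<Rightarrow> nat) \<Rightarrow> conn_index set" where
  "conn_coords n d = (SIGMA i : {1..n}. {1..d i} \<times> {..<2} \<times> {..<2})"

definition coeff_mat :: "(conn_index \<Rightarrow> complex) \<Rightarrow> nat \<Rightarrow> nat \<Rightarrow> complex mat" where
  "coeff_mat A i j = Matrix.mat 2 2 (\<lambda>(a, b). A (i, j, a, b))"

definition local_part :: "(nat \<Rightarrow> nat) \<Rightarrow> (conn_index \<Rightarrow> complex) \<Rightarrow> nat \<Rightarrow> complex fls mat" where
  "local_part d A i = Matrix.mat 2 2 (\<lambda>(a, b). \<Sum>j = 1..d i. monomial (coeff_mat A i j $$ (a, b)) (- int j))"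

text \<open>The \<open>(a, b)\<close> entry of the system \<open>A(z)\<close>.\<close>

definition system_entry ::
  "nat \<Rightarrow> (nat \<Rightarrow> nat) \<Rightarrow> (nat \<Rightarrow> complex) \<Rightarrow> (conn_index \<Rightarrow> complex) \<Rightarrow> nat \<Rightarrow> nat \<Rightarrow> complex \<Rightarrow> complex" where
  "system_entry n d t A a b z =
     (\<Sum>i = 1..n. \<Sum>j = 1..d i. coeff_mat A i j $$ (a, b) / (z - t i) ^ j)"

definition irreducible_system :: "nat \<Rightarrow> (nat \<Rightarrow> nat) \<Rightarrow> (conn_index \<Rightarrow> complex) \<Rightarrow> bool" where
  "irreducible_system n d A \<longleftrightarrow> \<not> (\<exists>S. is_subspace 2 S \<and> S \<noteq> {0\<^sub>v 2} \<and> S \<noteq> carrier_vec 2 \<and>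
     (\<forall>i\<in>{1..n}. \<forall>j\<in>{1..d i}. \<forall>x\<in>S. coeff_mat A i j *\<^sub>v x \<in> S))"

definition has_pole_order ::
  "nat \<Rightarrow> (nat \<Rightarrow> nat) \<Rightarrow> (nat \<Rightarrow> complex) \<Rightarrow> (conn_index \<Rightarrow> complex) \<Rightarrow> nat \<Rightarrow> nat \<Rightarrow> bool" where
  "has_pole_order n d t A i m \<longleftrightarrow> (\<exists>L.
     (\<forall>a<2. \<forall>b<2. ((\<lambda>z. (z - t i) ^ m * system_entry n d t A a b z) \<longlongrightarrow> L a b) (at (t i))) \<and>
     (\<exists>a<2. \<exists>b<2. L a b \<noteq> 0))"

text \<open>With \<open>w = 1/z\<close> one has \<open>A(z) dz = - A(1/w) w\<^bsup>-2\<^esup> dw\<close>.\<close>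

definition no_pole_at_infinity ::
  "nat \<Rightarrow> (nat \<Rightarrow> nat) \<Rightarrow> (nat \<Rightarrow> complex) \<Rightarrow> (conn_index \<Rightarrow> complex) \<Rightarrow> bool" where
  "no_pole_at_infinity n d t A \<longleftrightarrow>
     (\<forall>a<2. \<forall>b<2. \<exists>l. ((\<lambda>w. - system_entry n d t A a b (1 / w) / w\<^sup>2) \<longlongrightarrow> l) (at 0))"

text \<open>The base set of the moduli space of stable meromorphic connections on the trivial bundle.\<close>

definition stable_connections ::
  "nat \<Rightarrow> (nat \<Rightarrow> nat) \<Rightarrow> (nat \<Rightarrow> complex) \<Rightarrow> (nat \<Rightarrow> complex fls mat) \<Rightarrow> (conn_index \<Rightarrow> complex) set" where
  "stable_connections n d t Xi = {A \<in> topspace (affine_top (conn_coords n d)).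
     (\<forall>i\<in>{1..n}. has_pole_order n d t A i (d i)) \<and>
     no_pole_at_infinity n d t A \<and>
     (\<forall>i\<in>{1..n}. local_part d A i \<in> coadjoint_orbit 2 (Xi i)) \<and>
     irreducible_system n d A}"

definition irr_level ::
  "nat \<Rightarrow> (nat \<Rightarrow> nat) \<Rightarrow> (nat \<Rightarrow> complex) \<Rightarrow> (nat \<Rightarrow> complex fls mat) \<Rightarrow> (conn_index \<Rightarrow> complex) set" where
  "irr_level n d t Xi = {A \<in> topspace (affine_top (conn_coords n d)).
     (\<forall>i\<in>{1..n}. local_part d A i \<in> coadjoint_orbit 2 (Xi i)) \<and>
     irreducible_system n d A \<and>
     (\<forall>a<2. \<forall>b<2. (\<Sum>i = 1..n. residue (system_entry n d t A a b) (t i)) = 0)}"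

text \<open>The quotient of a set of systems by \<open>GL(V)\<close>, with the sum of the Kirillov-Kostant-Souriau forms.\<close>

definition connection_quotient ::
  "nat \<Rightarrow> (nat \<Rightarrow> nat) \<Rightarrow> (conn_index \<Rightarrow> complex) set \<Rightarrow> conn_index symplectic_quotient" where
  "connection_quotient n d Z =
     \<lparr> coords = conn_coords n d,
       level = Z,
       orbit_rel = {(A, C). A \<in> Z \<and> C \<in> Z \<and>
         (\<exists>g\<in>general_linear 2. \<forall>i\<in>{1..n}. \<forall>j\<in>{1..d i}.
            coeff_mat C i j = g * coeff_mat A i j * mat_inv g)},
       two_form = (\<lambda>A u w. \<Sum>i = 1..n.
         kks_form 2 (local_part d A i) (local_part d u i) (local_part d w i)) \<rparr>"

definition connection_moduli ::
  "nat \<Rightarrow> (nat \<Rightarrow> nat) \<Rightarrow> (nat \<Rightarrow> complex) \<Rightarrow> (nat \<Rightarrow> complex fls mat) \<Rightarrow> conn_index symplectic_quotient" where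
  "connection_moduli n d t Xi = connection_quotient n d (stable_connections n d t Xi)"

definition M_irr ::
  "nat \<Rightarrow> (nat \<Rightarrow> nat) \<Rightarrow> (nat \<Rightarrow> complex) \<Rightarrow> (nat \<Rightarrow> complex fls mat) \<Rightarrow> conn_index symplectic_quotient" where
  "M_irr n d t Xi = connection_quotient n d (irr_level n d t Xi)"

definition diag2 :: "complex fls \<Rightarrow> complex fls \<Rightarrow> complex fls mat" where
  "diag2 p q = mat_of_rows_list 2 [[p, 0], [0, q]]"

end

theory Submission
  imports Defs
begin

text \<open>
  Writing the two maps at the arm \<open>i\<close> as power series \<open>p\<^sub>i, q\<^sub>i\<close> with values in \<open>\<complex>\<^sup>2\<close> and its dual, the moment
  map equation at \<open>i\<close> says \<open>q\<^sub>i p\<^sub>i = \<lambda>\<^sub>i\<close> up to \<open>z\<^bsup>d\<^esup>\<close>, so that \<open>A\<^sub>i = \<eta>\<^sub>i + p\<^sub>i q\<^sub>i\<close> runs through the orbit of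
  \<open>diag (\<xi>\<^sub>i, \<eta>\<^sub>i)\<close>, and the equation at the centre says that the residues sum to zero. Since \<open>\<lambda>\<^sub>i\<close> is a unit up to
  a power of \<open>z\<close>, the fibres of \<open>(p, q) \<mapsto> A\<close> are orbits of \<open>R\<^sub>d\<^sup>\<times>\<close>, invariant subspaces of the representation
  and of the system determine each other, and a diagonal entry of \<open>A\<^sub>i - \<eta>\<^sub>i\<close> with non-zero leading coefficient
  gives a local section: \<open>p\<close> is its column, and \<open>q\<close> is its row divided by it.
  Both symplectic forms evaluate to \<open>\<Sum>\<^sub>i res (dq\<^sub>i \<and> dp\<^sub>i)\<close>.
\<close>

section \<open>Holomorphic maps between coordinate spaces\<close>

text \<open>Neither quotient is given charts: a class of systems has no canonical factorization, and
  which diagonal entry is a unit varies from point to point and from arm to arm. Only local sections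
  exist, and holomorphy in the quotient is tested by transporting local extensions along
  \<open>conn\<close> and along such sections; this suffices because \<open>conn\<close> is
  polynomial in the coordinates and both preserves and reflects the orbit relations. The harder
  obstacle is the symplectic form. A lift of a curve in the target is arbitrary: at each parameter
  it is merely conjugate to the image of the given curve, by a matrix about whose dependence on the
  parameter nothing is known. Irreducibility provides a frame of the plane built from the system
  itself, and quotients of such frames are conjugating matrices that are differentiable in the
  parameter. The unit gauge on the arms never has to be differentiated, because the
  Kirillov-Kostant-Souriau form sees only the product \<open>p q\<close>. The points
  \<open>t i\<close> enter only through residues and pole orders, which turn out to be read off
  single coefficients.\<close>

lemma topspace_affine_top [simp]: "topspace (affine_top J) = extensional J"
  by (auto simp: affine_top_def PiE_def)

lemma openin_affine_box:
  assumes "finite J"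
  shows "openin (affine_top J) {y \<in> extensional J. \<forall>j\<in>J. cmod (y j - x j) < \<delta>}"
proof -
  have "{y \<in> extensional J. \<forall>j\<in>J. cmod (y j - x j) < \<delta>} = (\<Pi>\<^sub>E j\<in>J. ball (x j) \<delta>)"
    by (auto simp: PiE_iff extensional_def dist_norm norm_minus_commute)
  then show ?thesis
    using assms by (simp add: affine_top_def openin_PiE)
qed

text \<open>Finiteness of \<open>J\<close> lets one radius serve all coordinates. This passes
  between the box estimates in the definition of differentiability and limits along the
  neighbourhood filter.\<close>

lemma eventually_nhdsin_affine_top:
  assumes J: "finite J" and x: "x \<in> extensional J"
  shows "eventually P (nhdsin (affine_top J) x) \<longleftrightarrow>
    (\<exists>\<delta>>0. \<forall>y\<in>extensional J. (\<forall>j\<in>J. cmod (y j - x j) < \<delta>) \<longrightarrow> P y)" (is "?L \<longleftrightarrow> ?R")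
proof
  assume ?L
  then obtain S where S: "openin (affine_top J) S" "x \<in> S" "\<forall>y\<in>S. P y"
    using x by (auto simp: eventually_nhdsin)
  have "\<exists>U. finite {i \<in> J. U i \<noteq> topspace euclidean} \<and> (\<forall>i\<in>J. openin euclidean (U i)) \<and>
      x \<in> Pi\<^sub>E J U \<and> Pi\<^sub>E J U \<subseteq> S"
    using S(1,2) unfolding affine_top_def openin_product_topology_alt by (rule bspec)
  then obtain U where U: "\<forall>i\<in>J. open (U i)" "x \<in> Pi\<^sub>E J U" "Pi\<^sub>E J U \<subseteq> S"
    by auto
  have "\<forall>j\<in>J. \<exists>e>0. ball (x j) e \<subseteq> U j"
    using U by (auto simp: PiE_iff open_contains_ball)
  then obtain e where e: "\<And>j. j \<in> J \<Longrightarrow> e j > 0" "\<And>j. j \<in> J \<Longrightarrow> ball (x j) (e j) \<subseteq> U j"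
    by metis
  \<comment> \<open>The extra element 1 keeps the minimum defined, and positive, when
    \<open>J\<close> is empty.\<close>
  define \<delta> where "\<delta> = Min (insert 1 (e ` J))"
  have "\<delta> > 0" "\<And>j. j \<in> J \<Longrightarrow> \<delta> \<le> e j"
    using J e by (auto simp: \<delta>_def)
  moreover have "P y" if "y \<in> extensional J" "\<forall>j\<in>J. cmod (y j - x j) < \<delta>" for y
  proof -
    have "y j \<in> U j" if "j \<in> J" for j
      using e(2)[OF that] that \<open>\<forall>j\<in>J. cmod (y j - x j) < \<delta>\<close> calculation(2)[OF that]
      by (fastforce simp: dist_norm norm_minus_commute)
    then have "y \<in> Pi\<^sub>E J U" using that(1) by (simp add: PiE_iff)
    with U(3) S(3) show ?thesis by blast
  qed
  ultimately show ?R by blast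
next
  assume ?R
  then obtain \<delta> where \<delta>: "\<delta> > 0" "\<forall>y\<in>extensional J. (\<forall>j\<in>J. cmod (y j - x j) < \<delta>) \<longrightarrow> P y"
    by blast
  show ?L
    unfolding eventually_nhdsin
    using openin_affine_box[OF J, of x \<delta>] \<delta> x
    by (intro disjI2 exI[of _ "{y \<in> extensional J. \<forall>j\<in>J. cmod (y j - x j) < \<delta>}"]) auto
qed

lemma tendsto_coordinate:
  assumes "finite J" "x \<in> extensional J" "j \<in> J"
  shows "((\<lambda>y. y j) \<longlongrightarrow> x j) (nhdsin (affine_top J) x)"
  unfolding tendsto_iff eventually_nhdsin_affine_top[OF assms(1,2)]
  using assms(3) by (auto simp: dist_norm)

text \<open>Caratheodory's form of differentiability: the increment is an exact combination of the
  coordinate increments, with coefficients that have limits at \<open>x\<close>. The product,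
  quotient and chain rules then become algebra plus limits, without error terms.\<close>

lemma complex_differentiable_at_iff:
  fixes x :: "'j \<Rightarrow> complex"
  assumes J: "finite J" and x: "x \<in> extensional J"
  shows "complex_differentiable_at J f x \<longleftrightarrow>
    (\<exists>\<phi> c. (\<forall>y\<in>extensional J. f y - f x = (\<Sum>j\<in>J. \<phi> j y * (y j - x j))) \<and>
      (\<forall>j\<in>J. (\<phi> j \<longlongrightarrow> c j) (nhdsin (affine_top J) x)))" (is "?L \<longleftrightarrow> ?R")
proof
  assume ?L
  then obtain c where c: "\<And>e. e > 0 \<Longrightarrow> \<exists>\<delta>>0. \<forall>y\<in>extensional J. (\<forall>j\<in>J. cmod (y j - x j) < \<delta>) \<longrightarrow>
        cmod (f y - f x - (\<Sum>j\<in>J. c j * (y j - x j))) \<le> e * (\<Sum>j\<in>J. cmod (y j - x j))"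
    unfolding complex_differentiable_at_def by auto
  define r where "r y = f y - f x - (\<Sum>j\<in>J. c j * (y j - x j))" for y
  define N where "N y = (\<Sum>j\<in>J. cmod (y j - x j))" for y
  \<comment> \<open>The remainder is distributed over the coordinates:
    \<open>cnj (sgn w) * w\<close> is the modulus of \<open>w\<close>, so the corrections sum to
    \<open>r y\<close>. At \<open>y = x\<close> the division by \<open>N y = 0\<close> gives 0,
    hence \<open>\<phi> j x = c j\<close>, as is required for a limit along neighbourhoods that
    include \<open>x\<close>.\<close>
  define \<phi> where "\<phi> j y = c j + r y * cnj (sgn (y j - x j)) / of_real (N y)" for j y
  have sgn_cnj: "cnj (sgn w) * w = of_real (cmod w)" for w :: complex
  proof (cases "w = 0")
    case False
    have "cnj (sgn w) * w = (w * cnj w) / of_real (cmod w)"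
      by (simp add: sgn_eq)
    also have "\<dots> = of_real (cmod w)"
      using False by (simp add: power2_eq_square flip: complex_norm_square)
    finally show ?thesis .
  qed simp
  have "f y - f x = (\<Sum>j\<in>J. \<phi> j y * (y j - x j))" if y: "y \<in> extensional J" for y
  proof (cases "N y = 0")
    case True
    then have "\<forall>j\<in>J. y j = x j" using J by (auto simp: N_def sum_nonneg_eq_0_iff)
    then have "y = x" using x y by (metis extensionalityI)
    then show ?thesis by simp
  next
    case False
    have "(\<Sum>j\<in>J. \<phi> j y * (y j - x j)) =
        (\<Sum>j\<in>J. c j * (y j - x j)) + (\<Sum>j\<in>J. r y / of_real (N y) * (cnj (sgn (y j - x j)) * (y j - x j)))"
      unfolding \<phi>_def by (subst sum.distrib[symmetric], rule sum.cong) (auto simp: algebra_simps diff_divide_distrib)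
    also have "(\<Sum>j\<in>J. r y / of_real (N y) * (cnj (sgn (y j - x j)) * (y j - x j))) = r y"
    proof -
      have "(\<Sum>j\<in>J. r y / of_real (N y) * (cnj (sgn (y j - x j)) * (y j - x j))) =
          r y / of_real (N y) * (\<Sum>j\<in>J. of_real (cmod (y j - x j)))"
        by (simp only: sgn_cnj sum_distrib_left)
      also have "(\<Sum>j\<in>J. of_real (cmod (y j - x j))) = complex_of_real (N y)"
        by (simp add: N_def)
      finally show ?thesis using False by simp
    qed
    finally show ?thesis by (simp add: r_def)
  qed
  moreover have "(\<phi> j \<longlongrightarrow> c j) (nhdsin (affine_top J) x)" for j
    unfolding tendsto_iff
  proof (intro allI impI)
    fix e :: real assume "e > 0"
    then obtain \<delta> where \<delta>: "\<delta> > 0" "\<forall>y\<in>extensional J. (\<forall>j\<in>J. cmod (y j - x j) < \<delta>) \<longrightarrow>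
        cmod (r y) \<le> e / 2 * N y"
      using c[of "e/2"] by (auto simp: r_def N_def)
    show "\<forall>\<^sub>F y in nhdsin (affine_top J) x. dist (\<phi> j y) (c j) < e"
      unfolding eventually_nhdsin_affine_top[OF J x]
    proof (intro exI[of _ \<delta>] conjI \<delta>(1) ballI impI)
      fix y :: "'j \<Rightarrow> complex" assume y: "y \<in> extensional J" "\<forall>j\<in>J. cmod (y j - x j) < \<delta>"
      have N0: "N y \<ge> 0" by (simp add: N_def sum_nonneg)
      have "dist (\<phi> j y) (c j) = cmod (r y) * cmod (sgn (y j - x j)) / N y"
        using N0 by (simp add: dist_norm \<phi>_def norm_mult norm_divide)
      also have "\<dots> \<le> cmod (r y) * 1 / N y"
        using N0 by (intro divide_right_mono mult_left_mono) (auto simp: norm_sgn)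
      also have "\<dots> \<le> e / 2"
        using \<delta>(2) y N0 \<open>e > 0\<close> by (cases "N y = 0") (auto simp: field_simps)
      finally show "dist (\<phi> j y) (c j) < e" using \<open>e > 0\<close> by simp
    qed
  qed
  ultimately show ?R by blast
next
  assume ?R
  then obtain \<phi> c where f: "\<And>y. y \<in> extensional J \<Longrightarrow> f y - f x = (\<Sum>j\<in>J. \<phi> j y * (y j - x j))"
    and lim: "\<And>j. j \<in> J \<Longrightarrow> (\<phi> j \<longlongrightarrow> c j) (nhdsin (affine_top J) x)" by blast
  show ?L
    unfolding complex_differentiable_at_def
  proof (intro exI[of _ c] allI impI)
    fix e :: real assume "e > 0"
    then have "\<forall>\<^sub>F y in nhdsin (affine_top J) x. \<forall>j\<in>J. dist (\<phi> j y) (c j) < e"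
      using J lim by (auto simp: eventually_ball_finite_distrib tendsto_iff)
    then obtain \<delta> where \<delta>: "\<delta> > 0" "\<forall>y\<in>extensional J. (\<forall>j\<in>J. cmod (y j - x j) < \<delta>) \<longrightarrow>
        (\<forall>j\<in>J. dist (\<phi> j y) (c j) < e)"
      by (auto simp: eventually_nhdsin_affine_top[OF J x])
    show "\<exists>\<delta>>0. \<forall>y\<in>topspace (affine_top J). (\<forall>j\<in>J. cmod (y j - x j) < \<delta>) \<longrightarrow>
        cmod (f y - f x - (\<Sum>j\<in>J. c j * (y j - x j))) \<le> e * (\<Sum>j\<in>J. cmod (y j - x j))"
    proof (intro exI[of _ \<delta>] conjI \<delta>(1) ballI impI)
      fix y assume y: "y \<in> topspace (affine_top J)" "\<forall>j\<in>J. cmod (y j - x j) < \<delta>"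
      have "f y - f x - (\<Sum>j\<in>J. c j * (y j - x j)) = (\<Sum>j\<in>J. (\<phi> j y - c j) * (y j - x j))"
        using y by (simp add: f left_diff_distrib sum_subtractf)
      also have "cmod \<dots> \<le> (\<Sum>j\<in>J. e * cmod (y j - x j))"
        using \<delta>(2) y by (intro sum_norm_le) (auto simp: norm_mult dist_norm less_imp_le intro!: mult_right_mono)
      finally show "cmod (f y - f x - (\<Sum>j\<in>J. c j * (y j - x j))) \<le> e * (\<Sum>j\<in>J. cmod (y j - x j))"
        by (simp add: sum_distrib_left)
    qed
  qed
qed

lemma complex_differentiable_at_tendsto:
  fixes x :: "'j \<Rightarrow> complex"
  assumes J: "finite J" and x: "x \<in> extensional J" and f: "complex_differentiable_at J f x"
  shows "(f \<longlongrightarrow> f x) (nhdsin (affine_top J) x)"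
proof -
  obtain \<phi> c where \<phi>: "\<And>y. y \<in> extensional J \<Longrightarrow> f y - f x = (\<Sum>j\<in>J. \<phi> j y * (y j - x j))"
    and lim: "\<And>j. j \<in> J \<Longrightarrow> (\<phi> j \<longlongrightarrow> c j) (nhdsin (affine_top J) x)"
    using f unfolding complex_differentiable_at_iff[OF J x] by blast
  have "((\<lambda>y. f x + (\<Sum>j\<in>J. \<phi> j y * (y j - x j))) \<longlongrightarrow> f x + (\<Sum>j\<in>J. c j * (x j - x j)))
      (nhdsin (affine_top J) x)"
    by (intro tendsto_intros lim tendsto_coordinate J x)
  moreover have "\<forall>\<^sub>F y in nhdsin (affine_top J) x. f x + (\<Sum>j\<in>J. \<phi> j y * (y j - x j)) = f y"
    unfolding eventually_nhdsin_affine_top[OF J x] by (auto intro!: exI[of _ 1] simp flip: \<phi>)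
  ultimately show ?thesis
    by (auto simp: filterlim_cong elim: Lim_transform_eventually)
qed

section \<open>Closure of holomorphic functions under algebraic operations\<close>

lemma complex_differentiable_at_const: "complex_differentiable_at J (\<lambda>_. c) x"
  unfolding complex_differentiable_at_def
  by (intro exI[of _ "\<lambda>_. 0"] allI impI exI[of _ 1]) (auto intro!: mult_nonneg_nonneg sum_nonneg)

lemma complex_differentiable_at_coordinate:
  assumes "finite J" "j \<in> J"
  shows "complex_differentiable_at J (\<lambda>y. y j) x"
  unfolding complex_differentiable_at_def
proof (intro exI[of _ "\<lambda>i. if i = j then 1 else 0"] allI impI exI[of _ "1::real"] conjI ballI)
  fix e :: real and y :: "'a \<Rightarrow> complex" assume "e > 0"
  have "(\<Sum>i\<in>J. (if i = j then 1 else 0) * (y i - x i)) = y j - x j"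
    using assms by (simp add: if_distrib[of "\<lambda>u. u * _"] cong: if_cong)
  then show "cmod (y j - x j - (\<Sum>i\<in>J. (if i = j then 1 else 0) * (y i - x i))) \<le> e * (\<Sum>j\<in>J. cmod (y j - x j))"
    using \<open>e > 0\<close> by (simp add: sum_nonneg)
qed simp

lemma complex_differentiable_at_add:
  fixes x :: "'j \<Rightarrow> complex"
  assumes J: "finite J" and x: "x \<in> extensional J"
    and "complex_differentiable_at J f x" "complex_differentiable_at J g x"
  shows "complex_differentiable_at J (\<lambda>y. f y + g y) x"
proof -
  obtain \<phi> c \<psi> b where *: "\<And>y. y \<in> extensional J \<Longrightarrow> f y - f x = (\<Sum>j\<in>J. \<phi> j y * (y j - x j))"
    "\<And>j. j \<in> J \<Longrightarrow> (\<phi> j \<longlongrightarrow> c j) (nhdsin (affine_top J) x)"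
    "\<And>y. y \<in> extensional J \<Longrightarrow> g y - g x = (\<Sum>j\<in>J. \<psi> j y * (y j - x j))"
    "\<And>j. j \<in> J \<Longrightarrow> (\<psi> j \<longlongrightarrow> b j) (nhdsin (affine_top J) x)"
    using assms(3,4) unfolding complex_differentiable_at_iff[OF J x] by blast
  show ?thesis
    unfolding complex_differentiable_at_iff[OF J x]
  proof (intro exI[of _ "\<lambda>j y. \<phi> j y + \<psi> j y"] exI[of _ "\<lambda>j. c j + b j"] conjI ballI)
    fix y :: "'j \<Rightarrow> complex" assume "y \<in> extensional J"
    have "f y + g y - (f x + g x) = (f y - f x) + (g y - g x)" by simp
    also have "\<dots> = (\<Sum>j\<in>J. (\<phi> j y + \<psi> j y) * (y j - x j))"
      using \<open>y \<in> extensional J\<close> by (simp add: * sum.distrib distrib_right)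
    finally show "f y + g y - (f x + g x) = (\<Sum>j\<in>J. (\<phi> j y + \<psi> j y) * (y j - x j))" .
  qed (intro tendsto_intros *)
qed

lemma complex_differentiable_at_mult:
  fixes x :: "'j \<Rightarrow> complex"
  assumes J: "finite J" and x: "x \<in> extensional J"
    and "complex_differentiable_at J f x" "complex_differentiable_at J g x"
  shows "complex_differentiable_at J (\<lambda>y. f y * g y) x"
proof -
  obtain \<phi> c \<psi> b where *: "\<And>y. y \<in> extensional J \<Longrightarrow> f y - f x = (\<Sum>j\<in>J. \<phi> j y * (y j - x j))"
    "\<And>j. j \<in> J \<Longrightarrow> (\<phi> j \<longlongrightarrow> c j) (nhdsin (affine_top J) x)"
    "\<And>y. y \<in> extensional J \<Longrightarrow> g y - g x = (\<Sum>j\<in>J. \<psi> j y * (y j - x j))"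
    "\<And>j. j \<in> J \<Longrightarrow> (\<psi> j \<longlongrightarrow> b j) (nhdsin (affine_top J) x)"
    using assms(3,4) unfolding complex_differentiable_at_iff[OF J x] by blast
  show ?thesis
    unfolding complex_differentiable_at_iff[OF J x]
  proof (intro exI[of _ "\<lambda>j y. \<phi> j y * g y + f x * \<psi> j y"] exI[of _ "\<lambda>j. c j * g x + f x * b j"] conjI ballI)
    fix y :: "'j \<Rightarrow> complex" assume y: "y \<in> extensional J"
    have "f y * g y - f x * g x = (f y - f x) * g y + f x * (g y - g x)" by (simp add: algebra_simps)
    also have "\<dots> = (\<Sum>j\<in>J. (\<phi> j y * g y + f x * \<psi> j y) * (y j - x j))"
      unfolding *(1)[OF y] *(3)[OF y] by (simp add: sum_distrib_left sum_distrib_right distrib_right distrib_left mult_ac flip: sum.distrib)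
    finally show "f y * g y - f x * g x = (\<Sum>j\<in>J. (\<phi> j y * g y + f x * \<psi> j y) * (y j - x j))" .
  qed (intro tendsto_intros * complex_differentiable_at_tendsto[OF J x] assms)
qed

lemma complex_differentiable_at_inverse:
  fixes x :: "'j \<Rightarrow> complex"
  assumes J: "finite J" and x: "x \<in> extensional J" and f: "complex_differentiable_at J f x" and fx: "f x \<noteq> 0"
  shows "complex_differentiable_at J (\<lambda>y. inverse (f y)) x"
proof -
  obtain \<phi> c where *: "\<And>y. y \<in> extensional J \<Longrightarrow> f y - f x = (\<Sum>j\<in>J. \<phi> j y * (y j - x j))"
    "\<And>j. j \<in> J \<Longrightarrow> (\<phi> j \<longlongrightarrow> c j) (nhdsin (affine_top J) x)"
    using f unfolding complex_differentiable_at_iff[OF J x] by blast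
  have lim: "(f \<longlongrightarrow> f x) (nhdsin (affine_top J) x)" by (rule complex_differentiable_at_tendsto[OF J x f])
  \<comment> \<open>The identity must hold at every point of \<open>extensional J\<close>, including
    zeros of \<open>f\<close>. There \<open>inverse (f y)\<close> is 0 and the increment is
    \<open>- inverse (f x)\<close>, which is the square of \<open>inverse (f x)\<close> times
    \<open>f y - f x\<close>.\<close>
  define \<psi> where "\<psi> j y = (if f y = 0 then inverse (f x) * inverse (f x) else - (inverse (f y) * inverse (f x))) * \<phi> j y" for j y
  have ev: "\<forall>\<^sub>F y in nhdsin (affine_top J) x. f y \<noteq> 0"
    using tendsto_imp_eventually_ne[OF lim fx] .
  show ?thesis
    unfolding complex_differentiable_at_iff[OF J x]
  proof (intro exI[of _ \<psi>] exI[of _ "\<lambda>j. - (inverse (f x) * inverse (f x)) * c j"] conjI ballI)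
    fix y :: "'j \<Rightarrow> complex" assume y: "y \<in> extensional J"
    define u where "u = (if f y = 0 then inverse (f x) * inverse (f x) else - (inverse (f y) * inverse (f x)))"
    have "inverse (f y) - inverse (f x) = u * (f y - f x)"
      using fx by (auto simp: field_simps u_def)
    also have "\<dots> = (\<Sum>j\<in>J. \<psi> j y * (y j - x j))"
      unfolding *(1)[OF y] by (simp add: sum_distrib_left \<psi>_def u_def algebra_simps)
    finally show "inverse (f y) - inverse (f x) = (\<Sum>j\<in>J. \<psi> j y * (y j - x j))" .
  next
    fix j assume j: "j \<in> J"
    have "((\<lambda>y. - (inverse (f y) * inverse (f x)) * \<phi> j y) \<longlongrightarrow> - (inverse (f x) * inverse (f x)) * c j)
        (nhdsin (affine_top J) x)"
      by (intro tendsto_intros * j lim fx)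
    then show "(\<psi> j \<longlongrightarrow> - (inverse (f x) * inverse (f x)) * c j) (nhdsin (affine_top J) x)"
      by (rule Lim_transform_eventually) (use ev in \<open>auto simp: \<psi>_def elim!: eventually_mono\<close>)
  qed
qed

lemma complex_differentiable_at_sum:
  fixes x :: "'j \<Rightarrow> complex"
  assumes "finite J" "x \<in> extensional J" "\<And>i. i \<in> I \<Longrightarrow> complex_differentiable_at J (f i) x"
  shows "complex_differentiable_at J (\<lambda>y. \<Sum>i\<in>I. f i y) x"
  using assms(3)
  by (induction I rule: infinite_finite_induct)
    (auto intro!: complex_differentiable_at_const complex_differentiable_at_add[OF assms(1,2)])

lemma complex_differentiable_at_diff:
  fixes x :: "'j \<Rightarrow> complex"
  assumes J: "finite J" and x: "x \<in> extensional J"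
    and "complex_differentiable_at J f x" "complex_differentiable_at J g x"
  shows "complex_differentiable_at J (\<lambda>y. f y - g y) x"
proof -
  have "complex_differentiable_at J (\<lambda>y. f y + (-1) * g y) x"
    by (intro complex_differentiable_at_add complex_differentiable_at_mult complex_differentiable_at_const assms)
  then show ?thesis by simp
qed

section \<open>Continuity of holomorphic maps and the chain rule\<close>

lemma filterlim_nhdsin_affine_top:
  assumes J: "finite J" and K: "finite K" and x: "x \<in> extensional J" and G: "\<And>y. G y \<in> extensional K"
    and "\<And>k. k \<in> K \<Longrightarrow> complex_differentiable_at J (\<lambda>y. G y k) x"
  shows "filterlim G (nhdsin (affine_top K) (G x)) (nhdsin (affine_top J) x)"
  unfolding filterlim_iff
proof (intro allI impI)
  fix P assume "eventually P (nhdsin (affine_top K) (G x))"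
  then obtain \<delta> where \<delta>: "\<delta> > 0" "\<forall>y\<in>extensional K. (\<forall>j\<in>K. cmod (y j - G x j) < \<delta>) \<longrightarrow> P y"
    unfolding eventually_nhdsin_affine_top[OF K G] by blast
  have "\<forall>\<^sub>F y in nhdsin (affine_top J) x. \<forall>k\<in>K. dist (G y k) (G x k) < \<delta>"
    using K complex_differentiable_at_tendsto[OF J x assms(5)] \<delta>(1)
    by (auto simp: eventually_ball_finite_distrib tendsto_iff)
  then show "\<forall>\<^sub>F y in nhdsin (affine_top J) x. P (G y)"
  proof (rule eventually_mono)
    fix y assume "\<forall>k\<in>K. dist (G y k) (G x k) < \<delta>"
    then show "P (G y)" by (intro \<delta>(2)[rule_format] G) (simp add: dist_norm)
  qed
qed

text \<open>One Caratheodory identity is substituted into the other and the sums are exchanged; the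
  outer coefficients, evaluated along \<open>G\<close>, converge because \<open>G\<close> is
  continuous at \<open>x\<close>.\<close>

lemma complex_differentiable_at_compose:
  fixes x :: "'j \<Rightarrow> complex"
  assumes J: "finite J" and K: "finite K" and x: "x \<in> extensional J" and G: "\<And>y. G y \<in> extensional K"
    and dG: "\<And>k. k \<in> K \<Longrightarrow> complex_differentiable_at J (\<lambda>y. G y k) x"
    and F: "complex_differentiable_at K F (G x)"
  shows "complex_differentiable_at J (\<lambda>y. F (G y)) x"
proof -
  obtain \<phi> c where \<phi>: "\<And>y. y \<in> extensional K \<Longrightarrow> F y - F (G x) = (\<Sum>j\<in>K. \<phi> j y * (y j - G x j))"
    "\<And>j. j \<in> K \<Longrightarrow> (\<phi> j \<longlongrightarrow> c j) (nhdsin (affine_top K) (G x))"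
    using F unfolding complex_differentiable_at_iff[OF K G] by blast
  have "\<forall>k\<in>K. \<exists>\<psi> b. (\<forall>y\<in>extensional J. G y k - G x k = (\<Sum>j\<in>J. \<psi> j y * (y j - x j))) \<and>
      (\<forall>j\<in>J. (\<psi> j \<longlongrightarrow> b j) (nhdsin (affine_top J) x))"
    using dG unfolding complex_differentiable_at_iff[OF J x] by blast
  from bchoice[OF this] obtain \<psi> where "\<forall>k\<in>K. \<exists>b.
      (\<forall>y\<in>extensional J. G y k - G x k = (\<Sum>j\<in>J. \<psi> k j y * (y j - x j))) \<and>
      (\<forall>j\<in>J. (\<psi> k j \<longlongrightarrow> b j) (nhdsin (affine_top J) x))" by blast
  from bchoice[OF this] obtain b where
    \<psi>: "\<And>k y. k \<in> K \<Longrightarrow> y \<in> extensional J \<Longrightarrow> G y k - G x k = (\<Sum>j\<in>J. \<psi> k j y * (y j - x j))"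
    "\<And>k j. k \<in> K \<Longrightarrow> j \<in> J \<Longrightarrow> (\<psi> k j \<longlongrightarrow> b k j) (nhdsin (affine_top J) x)"
    by blast
  note lim = filterlim_nhdsin_affine_top[OF J K x G dG]
  show ?thesis
    unfolding complex_differentiable_at_iff[OF J x]
  proof (intro exI[of _ "\<lambda>j y. \<Sum>k\<in>K. \<phi> k (G y) * \<psi> k j y"] exI[of _ "\<lambda>j. \<Sum>k\<in>K. c k * b k j"] conjI ballI)
    fix y :: "'j \<Rightarrow> complex" assume y: "y \<in> extensional J"
    have "F (G y) - F (G x) = (\<Sum>k\<in>K. \<phi> k (G y) * (\<Sum>j\<in>J. \<psi> k j y * (y j - x j)))"
      using y by (simp add: \<phi>(1)[OF G] \<psi>(1))
    also have "\<dots> = (\<Sum>j\<in>J. (\<Sum>k\<in>K. \<phi> k (G y) * \<psi> k j y) * (y j - x j))"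
      unfolding sum_distrib_left sum_distrib_right mult.assoc by (rule sum.swap)
    finally show "F (G y) - F (G x) = (\<Sum>j\<in>J. (\<Sum>k\<in>K. \<phi> k (G y) * \<psi> k j y) * (y j - x j))" .
  next
    fix j assume j: "j \<in> J"
    show "((\<lambda>y. \<Sum>k\<in>K. \<phi> k (G y) * \<psi> k j y) \<longlongrightarrow> (\<Sum>k\<in>K. c k * b k j)) (nhdsin (affine_top J) x)"
    proof (rule tendsto_sum)
      fix k assume k: "k \<in> K"
      show "((\<lambda>y. \<phi> k (G y) * \<psi> k j y) \<longlongrightarrow> c k * b k j) (nhdsin (affine_top J) x)"
        by (rule tendsto_mult[OF filterlim_compose[OF \<phi>(2)[OF k] lim] \<psi>(2)[OF k j]])
    qed
  qed
qed

lemma continuous_map_affine_top: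
  assumes J: "finite J" and K: "finite K" and G: "\<And>y. G y \<in> extensional K" and W: "openin (affine_top J) W"
    and dG: "\<And>k y. k \<in> K \<Longrightarrow> y \<in> W \<Longrightarrow> complex_differentiable_at J (\<lambda>y. G y k) y"
  shows "continuous_map (subtopology (affine_top J) W) (affine_top K) G"
proof -
  have WJ: "W \<subseteq> extensional J" using W openin_subset by fastforce
  have "\<exists>S. openin (subtopology (affine_top J) W) S \<and> x \<in> S \<and> (\<forall>y\<in>S. G y \<in> V)"
    if x: "x \<in> W" "openin (affine_top K) V" "G x \<in> V" for x V
  proof -
    have "eventually (\<lambda>y. y \<in> V) (nhdsin (affine_top K) (G x))"
      using that by (auto simp: eventually_nhdsin)
    then have "\<forall>\<^sub>F y in nhdsin (affine_top J) x. G y \<in> V"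
      using filterlim_nhdsin_affine_top[OF J K _ G dG, of x] x WJ by (auto simp: filterlim_iff)
    then obtain S where S: "openin (affine_top J) S" "x \<in> S" "\<forall>y\<in>S. G y \<in> V"
      using x WJ by (auto simp: eventually_nhdsin)
    with x show ?thesis
      by (intro exI[of _ "S \<inter> W"]) (auto simp: openin_subtopology)
  qed
  then show ?thesis
    using G WJ
    by (auto simp: continuous_map_eq_topcontinuous_at topcontinuous_at_def Int_absorb1)
qed

section \<open>A criterion for biholomorphic quotients\<close>

lemma orbit_in_quotient_space: "x \<in> level X \<Longrightarrow> orbit X x \<in> quotient_space X"
  by (auto simp: quotient_space_def orbit_def quotientI)

lemma topspace_quotient_top:
  assumes "equiv (level X) (orbit_rel X)" "level X \<subseteq> extensional (coords X)"
  shows "topspace (quotient_top X) = quotient_space X"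
proof -
  have "{x \<in> level X. orbit X x \<in> quotient_space X} = level X"
    by (auto simp: orbit_def quotient_space_def quotientI)
  then have "openin (quotient_top X) (quotient_space X)"
    using openin_topspace[of "subtopology (affine_top (coords X)) (level X)"] assms(2)
    by (auto simp: openin_quotient_top quotient_open_def Int_absorb1)
  then show ?thesis
    by (meson openin_quotient_top openin_subset openin_topspace quotient_open_def subset_antisym)
qed

text \<open>Sufficient data for \<open>F\<close> to induce an isomorphism of the quotients as ringed
  spaces. Holomorphy of \<open>F\<close> carries functions back, the two directions of
  \<open>F_rel\<close> make the induced map well defined and injective, and \<open>F_section\<close>
  supplies surjectivity and carries functions forward. Sections need not respect orbits:
  \<open>F (G z) = z\<close> already fixes the class of \<open>G z\<close>. They live on open sets
  of the ambient space, since holomorphy on a level set means local extension.\<close>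

locale quotient_morphism =
  fixes X :: "'j symplectic_quotient" and Y :: "'k symplectic_quotient"
    and F :: "('j \<Rightarrow> complex) \<Rightarrow> ('k \<Rightarrow> complex)"
  assumes finite_coords: "finite (coords X)" "finite (coords Y)"
    and level_X: "level X \<subseteq> extensional (coords X)" and level_Y: "level Y \<subseteq> extensional (coords Y)"
    and equiv_X: "equiv (level X) (orbit_rel X)" and equiv_Y: "equiv (level Y) (orbit_rel Y)"
    and F_ext: "F x \<in> extensional (coords Y)"
    and F_level: "x \<in> level X \<Longrightarrow> F x \<in> level Y"
    and F_diff: "\<lbrakk>k \<in> coords Y; x \<in> extensional (coords X)\<rbrakk> \<Longrightarrow> complex_differentiable_at (coords X) (\<lambda>x. F x k) x"
    and F_rel: "\<lbrakk>x \<in> level X; x' \<in> level X\<rbrakk> \<Longrightarrow> (x, x') \<in> orbit_rel X \<longleftrightarrow> (F x, F x') \<in> orbit_rel Y"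
    and F_section: "y \<in> level Y \<Longrightarrow> \<exists>W G. openin (affine_top (coords Y)) W \<and> y \<in> W \<and>
      (\<forall>z. G z \<in> extensional (coords X)) \<and>
      (\<forall>j\<in>coords X. \<forall>z\<in>W. complex_differentiable_at (coords Y) (\<lambda>z. G z j) z) \<and>
      (\<forall>z\<in>W \<inter> level Y. G z \<in> level X \<and> F (G z) = z)"
begin

definition induced :: "('j \<Rightarrow> complex) set \<Rightarrow> ('k \<Rightarrow> complex) set" where
  "induced p = orbit Y (F (SOME x. x \<in> p))"

lemma obtain_section:
  assumes "y \<in> level Y"
  obtains W G where "openin (affine_top (coords Y)) W" "y \<in> W" "\<And>z. G z \<in> extensional (coords X)"
    "\<And>j z. j \<in> coords X \<Longrightarrow> z \<in> W \<Longrightarrow> complex_differentiable_at (coords Y) (\<lambda>z. G z j) z"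
    "\<And>z. z \<in> W \<Longrightarrow> z \<in> level Y \<Longrightarrow> G z \<in> level X" "\<And>z. z \<in> W \<Longrightarrow> z \<in> level Y \<Longrightarrow> F (G z) = z"
  using F_section[OF assms]
proof (elim exE conjE)
  fix W G
  assume "openin (affine_top (coords Y)) W" "y \<in> W" "\<forall>z. G z \<in> extensional (coords X)"
    "\<forall>j\<in>coords X. \<forall>z\<in>W. complex_differentiable_at (coords Y) (\<lambda>z. G z j) z"
    "\<forall>z\<in>W \<inter> level Y. G z \<in> level X \<and> F (G z) = z"
  then show thesis by (intro that[of W G]) simp_all
qed

lemma orbit_eq_iff_X: "x \<in> level X \<Longrightarrow> y \<in> level X \<Longrightarrow> orbit X x = orbit X y \<longleftrightarrow> (x, y) \<in> orbit_rel X"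
  unfolding orbit_def using equiv_X eq_equiv_class_iff by fastforce

lemma orbit_eq_iff_Y: "x \<in> level Y \<Longrightarrow> y \<in> level Y \<Longrightarrow> orbit Y x = orbit Y y \<longleftrightarrow> (x, y) \<in> orbit_rel Y"
  unfolding orbit_def using equiv_Y eq_equiv_class_iff by fastforce

lemma induced_orbit:
  assumes x: "x \<in> level X" shows "induced (orbit X x) = orbit Y (F x)"
proof -
  define x' where "x' = (SOME x'. x' \<in> orbit X x)"
  have "x \<in> orbit X x"
    using x equiv_X by (auto simp: orbit_def equiv_def refl_on_def)
  then have "x' \<in> orbit X x" unfolding x'_def by (rule someI[of "\<lambda>x'. x' \<in> orbit X x"])
  then have "(x, x') \<in> orbit_rel X" by (simp add: orbit_def)
  moreover from this have "x' \<in> level X" using equiv_X by (auto simp: equiv_def refl_on_def)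
  ultimately have "orbit Y (F x) = orbit Y (F x')"
    using x F_rel F_level orbit_eq_iff_Y by blast
  then show ?thesis by (simp add: induced_def x'_def)
qed

text \<open>Injectivity is the reflection of orbits by \<open>F\<close>; surjectivity is the
  existence of a section at each point.\<close>

lemma bij_betw_induced: "bij_betw induced (quotient_space X) (quotient_space Y)"
  unfolding bij_betw_def
proof
  have X: "quotient_space X = orbit X ` level X"
    by (auto simp: quotient_space_def quotient_def orbit_def)
  have Y: "quotient_space Y = orbit Y ` level Y"
    by (auto simp: quotient_space_def quotient_def orbit_def)
  show "inj_on induced (quotient_space X)"
  proof (rule inj_onI)
    fix p q assume "p \<in> quotient_space X" "q \<in> quotient_space X" "induced p = induced q"
    then obtain x y where "x \<in> level X" "y \<in> level X" "p = orbit X x" "q = orbit X y"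
      "induced (orbit X x) = induced (orbit X y)" unfolding X by blast
    then show "p = q"
      by (metis induced_orbit orbit_eq_iff_X orbit_eq_iff_Y F_level F_rel)
  qed
  have "orbit Y y \<in> induced ` quotient_space X" if yY: "y \<in> level Y" for y
  proof -
    obtain x where "x \<in> level X" "F x = y"
    proof (rule obtain_section[OF yY])
      fix W G assume "y \<in> W" "\<And>z. z \<in> W \<Longrightarrow> z \<in> level Y \<Longrightarrow> G z \<in> level X"
        "\<And>z. z \<in> W \<Longrightarrow> z \<in> level Y \<Longrightarrow> F (G z) = z"
      then show thesis using yY by (intro that) blast+
    qed
    then have "x \<in> level X" "induced (orbit X x) = orbit Y y"
      using that by (simp_all add: induced_orbit)
    then show ?thesis by (metis imageI orbit_in_quotient_space)
  qed
  moreover have "induced ` quotient_space X \<subseteq> quotient_space Y"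
    unfolding X Y by (auto simp: induced_orbit F_level)
  ultimately show "induced ` quotient_space X = quotient_space Y"
    unfolding Y by blast
qed

lemma continuous_F: "continuous_map (subtopology (affine_top (coords X)) (level X)) (subtopology (affine_top (coords Y)) (level Y)) F"
proof -
  have "continuous_map (subtopology (affine_top (coords X)) (extensional (coords X))) (affine_top (coords Y)) F"
    by (intro continuous_map_affine_top finite_coords F_ext F_diff)
      (auto simp flip: topspace_affine_top)
  then have "continuous_map (subtopology (affine_top (coords X)) (level X)) (affine_top (coords Y)) F"
    by (rule continuous_map_from_subtopology_mono) (rule level_X)
  then show ?thesis
    by (auto simp: continuous_map_in_subtopology F_level)
qed

text \<open>On level sets \<open>F\<close> is a quotient map. If the preimage of \<open>V\<close> is
  the trace of an open \<open>T\<close>, then near a point of \<open>V\<close> the set of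
  \<open>z\<close> with \<open>G z \<in> T\<close> is open, and \<open>F (G z) = z\<close> puts its
  level points into \<open>V\<close>.\<close>

lemma openin_preimage_iff:
  assumes V: "V \<subseteq> level Y"
  shows "openin (subtopology (affine_top (coords X)) (level X)) {x \<in> level X. F x \<in> V} \<longleftrightarrow>
    openin (subtopology (affine_top (coords Y)) (level Y)) V" (is "?L \<longleftrightarrow> ?R")
proof
  assume ?R
  then show ?L
    using openin_continuous_map_preimage[OF continuous_F] level_X by (simp add: Int_absorb1)
next
  assume ?L
  then obtain T where T: "openin (affine_top (coords X)) T" "{x \<in> level X. F x \<in> V} = T \<inter> level X"
    by (auto simp: openin_subtopology)
  show ?R
    unfolding openin_subopen[of _ V]
  proof
    fix y assume y: "y \<in> V"
    then have yY: "y \<in> level Y" using V by auto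
    obtain W G where W: "openin (affine_top (coords Y)) W" "y \<in> W"
      and G: "\<And>z. G z \<in> extensional (coords X)"
        "\<And>j z. j \<in> coords X \<Longrightarrow> z \<in> W \<Longrightarrow> complex_differentiable_at (coords Y) (\<lambda>z. G z j) z"
        "\<And>z. z \<in> W \<Longrightarrow> z \<in> level Y \<Longrightarrow> G z \<in> level X"
        "\<And>z. z \<in> W \<Longrightarrow> z \<in> level Y \<Longrightarrow> F (G z) = z"
      by (rule obtain_section[OF yY], rule that)
    have "continuous_map (subtopology (affine_top (coords Y)) W) (affine_top (coords X)) G"
      by (intro continuous_map_affine_top finite_coords W G)
    note * = openin_continuous_map_preimage[OF this T(1)]
    have "openin (affine_top (coords Y)) {z \<in> W. G z \<in> T}"
    proof -
      have "topspace (subtopology (affine_top (coords Y)) W) = W"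
        using openin_subset[OF W(1)] by (auto simp: topspace_subtopology)
      then show ?thesis using * W(1) by (simp add: openin_open_subtopology)
    qed
    then have "openin (subtopology (affine_top (coords Y)) (level Y)) ({z \<in> W. G z \<in> T} \<inter> level Y)"
      by (auto simp: openin_subtopology)
    moreover have "{z \<in> W. G z \<in> T} \<inter> level Y \<subseteq> V"
    proof
      fix z assume z: "z \<in> {z \<in> W. G z \<in> T} \<inter> level Y"
      then have "G z \<in> {x \<in> level X. F x \<in> V}" unfolding T(2) using G(3) by blast
      with z G(4)[of z] show "z \<in> V" by auto
    qed
    moreover have "y \<in> {z \<in> W. G z \<in> T} \<inter> level Y"
    proof -
      have "G y \<in> {x \<in> level X. F x \<in> V}" using G(3,4)[OF W(2) yY] y by simp
      then show ?thesis unfolding T(2) using W(2) yY by blast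
    qed
    ultimately show "\<exists>S. openin (subtopology (affine_top (coords Y)) (level Y)) S \<and> y \<in> S \<and> S \<subseteq> V"
      by blast
  qed
qed

text \<open>A homeomorphism is an injective quotient map, and a set of classes is open iff its
  saturated preimage in the level set is, which \<open>openin_preimage_iff\<close> compares on the
  two sides.\<close>

lemma homeomorphic_induced: "homeomorphic_map (quotient_top X) (quotient_top Y) induced"
  unfolding homeomorphic_map_def quotient_map_def topspace_quotient_top[OF equiv_X level_X]
    topspace_quotient_top[OF equiv_Y level_Y]
proof (intro conjI allI impI)
  show "inj_on induced (quotient_space X)" "induced ` quotient_space X = quotient_space Y"
    using bij_betw_induced by (auto simp: bij_betw_def)
  fix U assume U: "U \<subseteq> quotient_space Y"
  have "{x \<in> level X. orbit X x \<in> {p \<in> quotient_space X. induced p \<in> U}} =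
      {x \<in> level X. F x \<in> {y \<in> level Y. orbit Y y \<in> U}}"
    using orbit_in_quotient_space[of _ X] by (auto simp: induced_orbit F_level)
  then show "openin (quotient_top X) {x \<in> quotient_space X. induced x \<in> U} = openin (quotient_top Y) U"
    using U openin_preimage_iff[of "{y \<in> level Y. orbit Y y \<in> U}"]
    by (auto simp: openin_quotient_top quotient_open_def)
qed

text \<open>A local extension is composed with \<open>F\<close> in one direction and with a local
  section in the other; the latter composite extends \<open>f\<close> itself because the class of
  \<open>G z\<close> is mapped to the class of \<open>z\<close>.\<close>

lemma quotient_holomorphic_pullback:
  "quotient_holomorphic Y U f \<longleftrightarrow>
    quotient_holomorphic X {p \<in> quotient_space X. induced p \<in> U} (f \<circ> induced)" (is "?L \<longleftrightarrow> ?R")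
proof
  note [simp] = orbit_in_quotient_space
  show ?R if L: ?L
    unfolding quotient_holomorphic_def
  proof (intro ballI impI)
    fix x assume x: "x \<in> level X" "orbit X x \<in> {p \<in> quotient_space X. induced p \<in> U}"
    then have "F x \<in> level Y" "orbit Y (F x) \<in> U" by (auto simp: induced_orbit F_level)
    then obtain W H where W: "openin (affine_top (coords Y)) W" "F x \<in> W"
      "\<forall>y\<in>W. complex_differentiable_at (coords Y) H y"
      "\<forall>y\<in>W \<inter> level Y. orbit Y y \<in> U \<longrightarrow> f (orbit Y y) = H y"
      using L unfolding quotient_holomorphic_def by blast
    have "continuous_map (subtopology (affine_top (coords X)) (extensional (coords X))) (affine_top (coords Y)) F"
      by (intro continuous_map_affine_top finite_coords F_ext F_diff)
        (auto simp flip: topspace_affine_top)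
    from openin_continuous_map_preimage[OF this W(1)]
    have W': "openin (affine_top (coords X)) {z \<in> extensional (coords X). F z \<in> W}"
      using subtopology_topspace[of "affine_top (coords X)"] by simp
    show "\<exists>W Fa. openin (affine_top (coords X)) W \<and> x \<in> W \<and> (\<forall>y\<in>W. complex_differentiable_at (coords X) Fa y) \<and>
        (\<forall>y\<in>W \<inter> level X. orbit X y \<in> {p \<in> quotient_space X. induced p \<in> U} \<longrightarrow> (f \<circ> induced) (orbit X y) = Fa y)"
    proof (intro exI[of _ "{z \<in> extensional (coords X). F z \<in> W}"] exI[of _ "\<lambda>z. H (F z)"] conjI W' ballI impI)
      show "x \<in> {z \<in> extensional (coords X). F z \<in> W}" using x W level_X by auto
    next
      fix z assume z: "z \<in> {z \<in> extensional (coords X). F z \<in> W}"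
      then show "complex_differentiable_at (coords X) (\<lambda>z. H (F z)) z"
        using W(3) by (intro complex_differentiable_at_compose[OF finite_coords _ F_ext F_diff]) simp_all
    next
      fix z assume z: "z \<in> {z \<in> extensional (coords X). F z \<in> W} \<inter> level X"
        "orbit X z \<in> {p \<in> quotient_space X. induced p \<in> U}"
      then show "(f \<circ> induced) (orbit X z) = H (F z)"
        using W(4) by (auto simp: induced_orbit F_level)
    qed
  qed
  show ?L if R: ?R
    unfolding quotient_holomorphic_def
  proof (intro ballI impI)
    fix y assume y: "y \<in> level Y" "orbit Y y \<in> U"
    obtain W G where W: "openin (affine_top (coords Y)) W" "y \<in> W"
      and G: "\<And>z. G z \<in> extensional (coords X)"
        "\<And>j z. j \<in> coords X \<Longrightarrow> z \<in> W \<Longrightarrow> complex_differentiable_at (coords Y) (\<lambda>z. G z j) z"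
        "\<And>z. z \<in> W \<Longrightarrow> z \<in> level Y \<Longrightarrow> G z \<in> level X"
        "\<And>z. z \<in> W \<Longrightarrow> z \<in> level Y \<Longrightarrow> F (G z) = z"
      by (rule obtain_section[OF y(1)], rule that)
    have "G y \<in> level X" "orbit X (G y) \<in> {p \<in> quotient_space X. induced p \<in> U}"
      using G(3,4)[OF W(2) y(1)] y by (auto simp: induced_orbit)
    then obtain W2 H where W2: "openin (affine_top (coords X)) W2" "G y \<in> W2"
      "\<forall>z\<in>W2. complex_differentiable_at (coords X) H z"
      "\<forall>z\<in>W2 \<inter> level X. orbit X z \<in> {p \<in> quotient_space X. induced p \<in> U} \<longrightarrow> (f \<circ> induced) (orbit X z) = H z"
      using R unfolding quotient_holomorphic_def by blast
    have "continuous_map (subtopology (affine_top (coords Y)) W) (affine_top (coords X)) G"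
      by (intro continuous_map_affine_top finite_coords W G)
    note * = openin_continuous_map_preimage[OF this W2(1)]
    have W': "openin (affine_top (coords Y)) {z \<in> W. G z \<in> W2}"
    proof -
      have "topspace (subtopology (affine_top (coords Y)) W) = W"
        using openin_subset[OF W(1)] by (auto simp: topspace_subtopology)
      then show ?thesis using * W(1) by (simp add: openin_open_subtopology)
    qed
    show "\<exists>W H. openin (affine_top (coords Y)) W \<and> y \<in> W \<and> (\<forall>y\<in>W. complex_differentiable_at (coords Y) H y) \<and>
        (\<forall>y\<in>W \<inter> level Y. orbit Y y \<in> U \<longrightarrow> f (orbit Y y) = H y)"
    proof (intro exI[of _ "{z \<in> W. G z \<in> W2}"] exI[of _ "\<lambda>z. H (G z)"] conjI W' ballI impI)
      show "y \<in> {z \<in> W. G z \<in> W2}" using W W2 by auto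
    next
      fix z assume z: "z \<in> {z \<in> W. G z \<in> W2}"
      then have "z \<in> extensional (coords Y)" using openin_subset[OF W(1)] by auto
      with z show "complex_differentiable_at (coords Y) (\<lambda>z. H (G z)) z"
        using W2(3) by (intro complex_differentiable_at_compose[OF finite_coords(2,1) _ G(1,2)]) simp_all
    next
      fix z assume z: "z \<in> {z \<in> W. G z \<in> W2} \<inter> level Y" "orbit Y z \<in> U"
      then have "G z \<in> level X" "F (G z) = z" using G(3,4) by auto
      with z W2(4)[rule_format, of "G z"] show "f (orbit Y z) = H (G z)" by (auto simp: induced_orbit)
    qed
  qed
qed

theorem biholomorphic_induced: "biholomorphic_map X Y induced"
  unfolding biholomorphic_map_def using homeomorphic_induced quotient_holomorphic_pullback by blast

end

section \<open>Truncated power series and Laurent tails\<close>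

text \<open>Equality in \<open>R_d\<close>, imposed on lifts instead of by passing to a quotient
  ring: computations stay among power series, where a unit has a genuine
  \<open>inverse\<close>.\<close>

definition tcong :: "nat \<Rightarrow> complex fps \<Rightarrow> complex fps \<Rightarrow> bool" where
  "tcong d f g \<longleftrightarrow> (\<forall>m<d. fps_nth f m = fps_nth g m)"

lemma tcong_refl [simp]: "tcong d f f"
  and tcong_sym: "tcong d f g \<Longrightarrow> tcong d g f"
  and tcong_trans [trans]: "tcong d f g \<Longrightarrow> tcong d g h \<Longrightarrow> tcong d f h"
  and tcong_add: "tcong d f g \<Longrightarrow> tcong d f' g' \<Longrightarrow> tcong d (f + f') (g + g')"
  and tcong_diff: "tcong d f g \<Longrightarrow> tcong d f' g' \<Longrightarrow> tcong d (f - f') (g - g')"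
  by (auto simp: tcong_def)

lemma tcong_mult: "tcong d f g \<Longrightarrow> tcong d f' g' \<Longrightarrow> tcong d (f * f') (g * g')"
  by (auto simp: tcong_def fps_mult_nth intro!: sum.cong)

lemma tcong_eq_trans [trans]: "f = g \<Longrightarrow> tcong d g h \<Longrightarrow> tcong d f h" "tcong d f g \<Longrightarrow> g = h \<Longrightarrow> tcong d f h"
  by auto

lemma tcong_nth_0: "tcong d f g \<Longrightarrow> d > 0 \<Longrightarrow> fps_nth f 0 = fps_nth g 0"
  by (simp add: tcong_def)

lemma tcong_cancel:
  assumes "tcong d (u * f) (u * g)" "fps_nth u 0 \<noteq> 0"
  shows "tcong d f g"
proof -
  have "tcong d (inverse u * (u * f)) (inverse u * (u * g))"
    by (intro tcong_mult assms tcong_refl)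
  then show ?thesis
    using assms(2) by (simp add: inverse_mult_eq_1 flip: mult.assoc)
qed

lemma fls_nth_tail_of: "fls_nth (tail_of f) k = (if k < 0 then fls_nth f k else 0)"
  by (simp add: tail_of_def)

lemma tail_of_add: "tail_of (f + g) = tail_of f + tail_of g"
  and tail_of_diff: "tail_of (f - g) = tail_of f - tail_of g"
  by (auto intro!: fls_eqI simp: fls_nth_tail_of)

lemma tail_of_0 [simp]: "tail_of 0 = 0"
  by (auto intro!: fls_eqI simp: fls_nth_tail_of)

lemma tail_of_fps_to_fls [simp]: "tail_of (fps_to_fls f) = 0"
  by (auto intro!: fls_eqI simp: fls_nth_tail_of)

lemma tail_of_laurent_tail: "f \<in> laurent_tails d \<Longrightarrow> tail_of f = f"
  by (intro fls_eqI) (force simp: laurent_tails_def fls_nth_tail_of)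

lemma tail_of_mult_tail_of: "tail_of (fps_to_fls r * tail_of f) = tail_of (fps_to_fls r * f)"
proof -
  have "fps_to_fls r * f = fps_to_fls r * tail_of f + fps_to_fls (r * fls_regpart f)"
    by (simp add: tail_of_def algebra_simps fls_times_fps_to_fls)
  then show ?thesis by (simp add: tail_of_add)
qed

lemma residue_tail_of: "fls_residue (tail_of f) = fls_residue f"
  by (simp add: fls_nth_tail_of)

lemma residue_mult_tail_of: "fls_residue (fps_to_fls r * tail_of f) = fls_residue (fps_to_fls r * f)"
  by (metis residue_tail_of tail_of_mult_tail_of)

text \<open>Multiplication by \<open>z^-d\<close> carries classes modulo \<open>z^d\<close> to
  Laurent tails of pole order at most \<open>d\<close>, so the dual of the Lie algebra can be
  treated with power series as well; the residue becomes the coefficient at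
  \<open>d - 1\<close>.\<close>

definition polar :: "nat \<Rightarrow> complex fps \<Rightarrow> complex fls" where
  "polar d f = fls_shift (int d) (fps_to_fls f)"

lemma polar_add: "polar d (f + g) = polar d f + polar d g"
  and polar_diff: "polar d (f - g) = polar d f - polar d g"
  and polar_0 [simp]: "polar d 0 = 0"
  by (auto intro!: fls_eqI simp: polar_def)

lemma polar_mult: "fps_to_fls r * polar d f = polar d (r * f)"
  by (simp add: polar_def fls_shifted_times_simps fls_times_fps_to_fls)

lemma fls_nth_polar: "fls_nth (polar d f) k = (if k + int d < 0 then 0 else fps_nth f (nat (k + int d)))"
  by (simp add: polar_def fps_to_fls_nth)

lemma tail_of_polar_eq_iff: "tail_of (polar d f) = tail_of (polar d g) \<longleftrightarrow> tcong d f g"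
proof
  assume *: "tail_of (polar d f) = tail_of (polar d g)"
  show "tcong d f g" unfolding tcong_def
  proof (intro allI impI)
    fix m assume "m < d"
    then show "fps_nth f m = fps_nth g m"
      using arg_cong[OF *, of "\<lambda>F. fls_nth F (int m - int d)"] by (simp add: fls_nth_tail_of fls_nth_polar)
  qed
next
  assume "tcong d f g"
  then show "tail_of (polar d f) = tail_of (polar d g)"
    by (intro fls_eqI) (simp add: fls_nth_tail_of fls_nth_polar tcong_def)
qed

lemma residue_polar: "d > 0 \<Longrightarrow> fls_residue (polar d f) = fps_nth f (d - 1)"
  by (simp add: fls_nth_polar nat_diff_distrib)

lemma residue_polar_cong: "d > 0 \<Longrightarrow> tcong d f g \<Longrightarrow> fls_residue (polar d f) = fls_residue (polar d g)"
  by (simp only: residue_polar) (simp add: tcong_def)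

section \<open>Two by two matrices\<close>

abbreviation pairing :: "(nat \<Rightarrow> 'a) \<Rightarrow> (nat \<Rightarrow> 'a) \<Rightarrow> 'a :: semiring_0" where
  "pairing q p \<equiv> q 0 * p 0 + q 1 * p 1"

text \<open>A gauge at the centre has constant entries because \<open>d 0 = 1\<close>;
  \<open>lact\<close> and \<open>ract\<close> are its actions on columns and on rows of
  series.\<close>

abbreviation lact :: "(nat \<Rightarrow> nat \<Rightarrow> complex) \<Rightarrow> (nat \<Rightarrow> complex fps) \<Rightarrow> nat \<Rightarrow> complex fps" where
  "lact G p a \<equiv> fps_const (G a 0) * p 0 + fps_const (G a 1) * p 1"

abbreviation ract :: "(nat \<Rightarrow> complex fps) \<Rightarrow> (nat \<Rightarrow> nat \<Rightarrow> complex) \<Rightarrow> nat \<Rightarrow> complex fps" where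
  "ract q G b \<equiv> q 0 * fps_const (G 0 b) + q 1 * fps_const (G 1 b)"

definition mat2 :: "(nat \<Rightarrow> nat \<Rightarrow> 'a) \<Rightarrow> 'a mat" where
  "mat2 f = Matrix.mat 2 2 (\<lambda>(a, b). f a b)"

lemma mat2_carrier [simp]: "mat2 f \<in> carrier_mat 2 2"
  and dim_mat2 [simp]: "dim_row (mat2 f) = 2" "dim_col (mat2 f) = 2"
  by (simp_all add: mat2_def)

lemma mat2_index [simp]: "a < 2 \<Longrightarrow> b < 2 \<Longrightarrow> mat2 f $$ (a, b) = f a b"
  by (simp add: mat2_def)

lemma mat2_eqI: "M \<in> carrier_mat 2 2 \<Longrightarrow> (\<And>a b. a < 2 \<Longrightarrow> b < 2 \<Longrightarrow> M $$ (a, b) = f a b) \<Longrightarrow> M = mat2 f"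
  by (intro eq_matI) auto

lemma mat2_eta: "M \<in> carrier_mat 2 2 \<Longrightarrow> M = mat2 (\<lambda>a b. M $$ (a, b))"
  by (rule mat2_eqI) auto

lemma mat2_eq_iff: "mat2 f = mat2 g \<longleftrightarrow> (\<forall>a<2. \<forall>b<2. f a b = g a b)"
  by (metis mat2_index mat2_eqI mat2_carrier)

lemma mat2_mult: "mat2 f * mat2 g = mat2 (\<lambda>a b. f a 0 * g 0 b + f a 1 * (g 1 b :: 'a :: comm_ring_1))"
  by (intro mat2_eqI) (auto simp: scalar_prod_def eval_nat_numeral)

lemma mat2_minus: "mat2 f - mat2 g = mat2 (\<lambda>a b. f a b - (g a b :: 'a :: comm_ring_1))"
  by (intro mat2_eqI) auto

lemma mat2_one: "1\<^sub>m 2 = mat2 (\<lambda>a b. if a = b then 1 else (0 :: 'a :: comm_ring_1))"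
  by (intro mat2_eqI) auto

lemma map_mat2: "map_mat h (mat2 f) = mat2 (\<lambda>a b. h (f a b))"
  by (intro mat2_eqI) auto

lemma mat_trace_mat2: "mat_trace (mat2 f) = f 0 0 + (f 1 1 :: 'a :: comm_ring_1)"
  by (simp add: mat_trace_def eval_nat_numeral)

lemma all_less_2: "(\<forall>a<(2::nat). P a) \<longleftrightarrow> P 0 \<and> P 1"
  by (auto simp: less_2_cases_iff)

lemma mat_inv_eqI:
  assumes "g \<in> carrier_mat r r" "h \<in> carrier_mat r r" "g * h = 1\<^sub>m r" "h * g = 1\<^sub>m r"
  shows "mat_inv g = h"
  unfolding mat_inv_def
proof (rule the_equality)
  fix h' assume "h' \<in> carrier_mat (dim_row g) (dim_row g) \<and> inverts_mat g h' \<and> inverts_mat h' g"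
  then have h': "h' \<in> carrier_mat r r" "h' * g = 1\<^sub>m r"
    using assms(1) by (auto simp: inverts_mat_def)
  have "h' = h' * (g * h)" using h' assms by simp
  also have "\<dots> = h" using h' assms assoc_mult_mat[of h' r r g r h r] by simp
  finally show "h' = h" .
qed (use assms in \<open>auto simp: inverts_mat_def\<close>)

lemma general_linearE:
  assumes "g \<in> general_linear r"
  obtains h where "g \<in> carrier_mat r r" "h \<in> carrier_mat r r" "g * h = 1\<^sub>m r" "h * g = 1\<^sub>m r" "mat_inv g = h"
proof -
  from assms obtain h where g: "g \<in> carrier_mat r r" and h: "g * h = 1\<^sub>m r" "h * g = 1\<^sub>m (dim_row h)"
    by (auto simp: general_linear_def invertible_mat_def inverts_mat_def)
  have "dim_col h = r" "dim_row h = r"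
    using arg_cong[OF h(1), of dim_col] arg_cong[OF h(2), of dim_col] g by auto
  then have "h \<in> carrier_mat r r" by auto
  with g h \<open>dim_row h = r\<close> show thesis by (intro that[of h] mat_inv_eqI) auto
qed

lemma general_linearI:
  assumes "g \<in> carrier_mat r r" "h \<in> carrier_mat r r" "g * h = 1\<^sub>m r" "h * g = 1\<^sub>m r"
  shows "g \<in> general_linear r"
  using assms by (auto simp: general_linear_def invertible_mat_def inverts_mat_def)

section \<open>The coadjoint orbit of a diagonal formal type\<close>

text \<open>
  Modulo \<open>z\<^sup>d\<close>, the matrices with zero determinant and unit trace \<open>L\<close> are exactly the conjugates of
  \<open>diag (L, 0)\<close>; subtracting the central element \<open>\<eta>\<close> reduces the orbit of \<open>diag (\<xi>, \<eta>)\<close> to these.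
\<close>

definition shifted_tail :: "nat \<Rightarrow> complex fls \<Rightarrow> (nat \<Rightarrow> nat \<Rightarrow> complex fps) \<Rightarrow> complex fls mat" where
  "shifted_tail d \<eta> X = mat2 (\<lambda>a b. tail_of (polar d (X a b)) + (if a = b then \<eta> else 0))"

lemma diag2_eq: "diag2 p q = mat2 (\<lambda>a b. if a = b then (if a = 0 then p else q) else 0)"
  unfolding diag2_def mat_of_rows_list_def
  by (intro mat2_eqI) (auto simp: less_2_cases_iff)

lemma tail_of_conj: "tail_of (fps_to_fls g * tail_of (polar d L) * fps_to_fls h) = tail_of (polar d (g * L * h))"
proof -
  have "tail_of (fps_to_fls g * tail_of (polar d L) * fps_to_fls h) = tail_of (fps_to_fls (g * h) * tail_of (polar d L))"
    by (simp add: fls_times_fps_to_fls mult_ac)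
  also have "\<dots> = tail_of (polar d (g * L * h))"
    using tail_of_mult_tail_of[of "g * h" "polar d L"] polar_mult[of "g * h" d L] by (simp add: mult_ac)
  finally show ?thesis .
qed

text \<open>\<open>diag2 \<xi> \<eta>\<close> is the scalar \<open>\<eta>\<close> plus
  \<open>\<xi> - \<eta>\<close> in the first diagonal place. Conjugation fixes the scalar and turns
  the rest into the first column of \<open>g\<close> times the first row of its inverse.\<close>

lemma coadjoint_diag2:
  assumes gh: "mat2 g * mat2 h = 1\<^sub>m 2" "mat2 h * mat2 g = 1\<^sub>m 2"
    and \<xi>: "\<xi> - \<eta> = tail_of (polar d L)" and \<eta>: "tail_of \<eta> = \<eta>"
  shows "coadjoint (mat2 g) (diag2 \<xi> \<eta>) = shifted_tail d \<eta> (\<lambda>a b. g a 0 * L * h 0 b)"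
proof -
  have inv: "mat_inv (mat2 g) = mat2 h" by (rule mat_inv_eqI[OF _ _ gh]) auto
  have entry: "tail_of (fps_to_fls (g a 0) * \<xi> * fps_to_fls (h 0 b) + fps_to_fls (g a 1) * \<eta> * fps_to_fls (h 1 b)) =
      tail_of (polar d (g a 0 * L * h 0 b)) + (if a = b then \<eta> else 0)" if "a < 2" "b < 2" for a b
  proof -
    have "g a 0 * h 0 b + g a 1 * h 1 b = (if a = b then 1 else 0)"
      using gh(1) that unfolding mat2_mult mat2_one mat2_eq_iff by blast
    then have "fps_to_fls (g a 0) * fps_to_fls (h 0 b) + fps_to_fls (g a 1) * fps_to_fls (h 1 b) =
        (if a = b then 1 else 0)"
      by (metis fps_to_fls_plus fls_times_fps_to_fls fps_one_to_fls fps_zero_to_fls)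
    then have "\<eta> * (fps_to_fls (g a 0) * fps_to_fls (h 0 b) + fps_to_fls (g a 1) * fps_to_fls (h 1 b)) =
        (if a = b then \<eta> else 0)" by simp
    then have "fps_to_fls (g a 0) * \<xi> * fps_to_fls (h 0 b) + fps_to_fls (g a 1) * \<eta> * fps_to_fls (h 1 b) =
        fps_to_fls (g a 0) * (\<xi> - \<eta>) * fps_to_fls (h 0 b) + (if a = b then \<eta> else 0)"
      by (simp add: algebra_simps)
    then show ?thesis
      by (simp add: \<xi> tail_of_add tail_of_conj \<eta> split: if_splits)
  qed
  then show ?thesis
    unfolding coadjoint_def inv diag2_eq map_mat2 mat2_mult shifted_tail_def mat2_eq_iff
    by (auto simp: less_2_cases_iff)
qed

lemma shifted_tail_eq_iff:
  "shifted_tail d \<eta> X = shifted_tail d \<eta> Y \<longleftrightarrow> (\<forall>a<2. \<forall>b<2. tcong d (X a b) (Y a b))"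
  unfolding shifted_tail_def mat2_eq_iff by (simp add: tail_of_polar_eq_iff)

lemma shifted_tail_in_coadjoint_orbit:
  assumes X: "\<And>a b. a < 2 \<Longrightarrow> b < 2 \<Longrightarrow> tcong d (X a b) (p a * q b)"
    and L: "tcong d (pairing q p) L" "fps_nth L 0 \<noteq> 0" "d > 0"
    and \<xi>: "\<xi> - \<eta> = tail_of (polar d L)" and \<eta>: "tail_of \<eta> = \<eta>"
  shows "shifted_tail d \<eta> X \<in> coadjoint_orbit 2 (diag2 \<xi> \<eta>)"
proof -
  define l where "l = q 0 * p 0 + q 1 * p (1::nat)"
  have l0: "fps_nth l 0 \<noteq> 0" using tcong_nth_0[OF L(1)] L by (simp add: l_def)
  define m where "m = inverse l"
  have lm: "l * m = 1" "m * l = 1" using l0 by (simp_all add: m_def inverse_mult_eq_1 inverse_mult_eq_1')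
  \<comment> \<open>The second column of \<open>g\<close> spans the kernel of the row
    \<open>q\<close>; the determinant of \<open>g\<close> is \<open>l\<close>, and \<open>h\<close>
    is the adjugate divided by \<open>l\<close>. Inverting \<open>l\<close> rather than
    \<open>L\<close> makes \<open>g h = 1\<close> an identity and not merely a congruence.\<close>
  define g where "g a b = (if b = 0 then p a else if a = 0 then - q 1 else q 0)" for a b :: nat
  define h where "h a b = m * (if a = 0 then q b else if b = 0 then - p 1 else p 0)" for a b :: nat
  have gh: "mat2 g * mat2 h = 1\<^sub>m 2" "mat2 h * mat2 g = 1\<^sub>m 2"
    unfolding mat2_mult mat2_one mat2_eq_iff all_less_2 g_def h_def
    using lm unfolding l_def by (simp_all add: algebra_simps)
  have "tcong d (X a b) (g a 0 * L * h 0 b)" if "a < 2" "b < 2" for a b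
  proof -
    have "tcong d (p a * q b) (p a * q b * (l * m))" using lm by simp
    also have "tcong d (p a * q b * (l * m)) (p a * q b * (L * m))"
      by (intro tcong_mult tcong_refl) (use L in \<open>simp add: l_def\<close>)
    also have "p a * q b * (L * m) = g a 0 * L * h 0 b" by (simp add: g_def h_def)
    finally show ?thesis using X[OF that] tcong_trans by blast
  qed
  then have "shifted_tail d \<eta> X = coadjoint (mat2 g) (diag2 \<xi> \<eta>)"
    unfolding coadjoint_diag2[OF gh \<xi> \<eta>] shifted_tail_eq_iff by blast
  moreover have "mat2 g \<in> general_linear 2"
    by (rule general_linearI[OF _ _ gh]) auto
  ultimately show ?thesis unfolding coadjoint_orbit_def by blast
qed

text \<open>\<open>X c c * X a b = X a c * X c b\<close> is trivial if \<open>a = c\<close> or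
  \<open>b = c\<close> and is the vanishing of the determinant otherwise; the unit
  \<open>X c c\<close> is then cancelled.\<close>

lemma rank_one_factorization:
  fixes X :: "nat \<Rightarrow> nat \<Rightarrow> complex fps"
  assumes "c < 2" "fps_nth (X c c) 0 \<noteq> 0" "tcong d (X 0 0 * X 1 1) (X 0 1 * X 1 0)" "a < 2" "b < 2"
  shows "tcong d (X a b) (X a c * (X c b * inverse (X c c)))"
proof -
  have inv: "X c c * inverse (X c c) = 1" using assms(2) by (simp add: inverse_mult_eq_1')
  have "tcong d (X c c * X a b) (X a c * X c b)"
    using assms(1,4,5) assms(3) tcong_sym[OF assms(3)] by (auto simp: less_2_cases_iff mult_ac)
  moreover have "X c c * (X a c * (X c b * inverse (X c c))) = X a c * X c b"
  proof -
    have "X c c * (X a c * (X c b * inverse (X c c))) = X a c * X c b * (X c c * inverse (X c c))"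
      by (simp only: mult_ac)
    then show ?thesis by (simp add: inv)
  qed
  ultimately have "tcong d (X c c * X a b) (X c c * (X a c * (X c b * inverse (X c c))))"
    by (simp only:)
  then show ?thesis by (rule tcong_cancel[OF _ assms(2)])
qed

text \<open>A conjugate of \<open>diag (L, 0)\<close> is a column times a row, which gives trace and
  determinant. Conversely, a sum of two non-units of a local ring is a non-unit, so the unit trace
  makes a diagonal entry invertible and the matrix factors.\<close>

lemma shifted_tail_coadjoint_orbit_iff:
  assumes L: "fps_nth L 0 \<noteq> 0" "d > 0"
    and \<xi>: "\<xi> - \<eta> = tail_of (polar d L)" and \<eta>: "tail_of \<eta> = \<eta>"
  shows "shifted_tail d \<eta> X \<in> coadjoint_orbit 2 (diag2 \<xi> \<eta>) \<longleftrightarrow>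
    tcong d (X 0 0 + X 1 1) L \<and> tcong d (X 0 0 * X 1 1) (X 0 1 * X 1 0)" (is "?L \<longleftrightarrow> ?R")
proof
  assume ?L
  then obtain g0 where g0: "g0 \<in> general_linear 2" "shifted_tail d \<eta> X = coadjoint g0 (diag2 \<xi> \<eta>)"
    unfolding coadjoint_orbit_def by blast
  from g0(1) obtain h0 where "g0 \<in> carrier_mat 2 2" "h0 \<in> carrier_mat 2 2" "g0 * h0 = 1\<^sub>m 2" "h0 * g0 = 1\<^sub>m 2"
    by (rule general_linearE)
  then obtain g h where gh: "g0 = mat2 g" "mat2 g * mat2 h = 1\<^sub>m 2" "mat2 h * mat2 g = 1\<^sub>m 2"
    by (metis mat2_eta)
  have X: "tcong d (X a b) (g a 0 * L * h 0 b)" if "a < 2" "b < 2" for a b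
    using g0(2) that unfolding gh(1) coadjoint_diag2[OF gh(2,3) \<xi> \<eta>] shifted_tail_eq_iff by blast
  have hg: "h 0 0 * g 0 0 + h 0 1 * g 1 0 = 1"
    using gh(3) unfolding mat2_mult mat2_one mat2_eq_iff all_less_2 by simp
  have "tcong d (X 0 0 + X 1 1) (g 0 0 * L * h 0 0 + g 1 0 * L * h 0 1)"
    by (intro tcong_add X) auto
  also have "g 0 0 * L * h 0 0 + g 1 0 * L * h 0 1 = (h 0 0 * g 0 0 + h 0 1 * g 1 0) * L"
    by (simp add: algebra_simps)
  finally have 1: "tcong d (X 0 0 + X 1 1) L" using hg by simp
  have "tcong d (X 0 0 * X 1 1) ((g 0 0 * L * h 0 0) * (g 1 0 * L * h 0 1))"
    by (intro tcong_mult X) auto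
  also have "(g 0 0 * L * h 0 0) * (g 1 0 * L * h 0 1) = (g 0 0 * L * h 0 1) * (g 1 0 * L * h 0 0)"
    by (simp add: algebra_simps)
  also have "tcong d \<dots> (X 0 1 * X 1 0)"
    by (rule tcong_sym) (intro tcong_mult X; simp)
  finally show ?R using 1 by blast
next
  assume R: ?R
  then have "fps_nth (X 0 0) 0 + fps_nth (X 1 1) 0 \<noteq> 0"
    using tcong_nth_0[of d "X 0 0 + X 1 1" L] L by simp
  then obtain c where c: "c < 2" "fps_nth (X c c) 0 \<noteq> 0"
    by (metis add_0 one_less_numeral_iff pos2 semiring_norm(76))
  note fact = rank_one_factorization[OF c conjunct2[OF R]]
  have "tcong d (X c 0 * inverse (X c c) * X 0 c + X c 1 * inverse (X c c) * X 1 c) (X 0 0 + X 1 1)"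
    by (rule tcong_sym, intro tcong_add) (use fact[of 0 0] fact[of 1 1] in \<open>simp_all add: mult_ac\<close>)
  with R have "tcong d (X c 0 * inverse (X c c) * X 0 c + X c 1 * inverse (X c c) * X 1 c) L"
    using tcong_trans by blast
  then show ?L
    by (intro shifted_tail_in_coadjoint_orbit[where p = "\<lambda>a. X a c" and q = "\<lambda>b. X c b * inverse (X c c)", OF fact _ L \<xi> \<eta>])
qed

section \<open>The Kirillov-Kostant-Souriau form on rank one systems\<close>

lemma fls_residue_uminus: "fls_residue (- f) = - fls_residue f"
  by simp

lemma residue_mult_tail_of_sum:
  "fls_residue (fps_to_fls a * tail_of f + fps_to_fls b * tail_of g + (fps_to_fls a' * tail_of f' + fps_to_fls b' * tail_of g')) =
   fls_residue (fps_to_fls a * f + fps_to_fls b * g + (fps_to_fls a' * f' + fps_to_fls b' * g'))"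
  by (simp only: fls_residue_add residue_mult_tail_of)

text \<open>Cyclicity of the trace. The truncation inside \<open>coadjoint_lie\<close> does not
  affect the residue, since a power series times the discarded regular part has none.\<close>

lemma residue_pairing_commutator:
  assumes "\<xi> \<in> carrier_mat 2 2" "\<zeta> \<in> carrier_mat 2 2" "M \<in> carrier_mat 2 2"
  shows "residue_pairing (\<xi> * \<zeta> - \<zeta> * \<xi>) M = residue_pairing \<xi> (coadjoint_lie \<zeta> M)"
    and "residue_pairing (\<xi> * \<zeta> - \<zeta> * \<xi>) M = - residue_pairing \<zeta> (coadjoint_lie \<xi> M)"
proof -
  define x z m where "x a b = \<xi> $$ (a, b)" and "z a b = \<zeta> $$ (a, b)" and "m a b = M $$ (a, b)" for a b
  have *: "\<xi> = mat2 x" "\<zeta> = mat2 z" "M = mat2 m"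
    unfolding x_def z_def m_def by (rule mat2_eta; fact)+
  show "residue_pairing (\<xi> * \<zeta> - \<zeta> * \<xi>) M = residue_pairing \<xi> (coadjoint_lie \<zeta> M)"
    unfolding residue_pairing_def coadjoint_lie_def * map_mat2 mat2_mult mat2_minus mat_trace_mat2
      residue_mult_tail_of_sum
    by (rule arg_cong[where f = fls_residue]) (simp add: fls_times_fps_to_fls algebra_simps)
  show "residue_pairing (\<xi> * \<zeta> - \<zeta> * \<xi>) M = - residue_pairing \<zeta> (coadjoint_lie \<xi> M)"
    unfolding residue_pairing_def coadjoint_lie_def * map_mat2 mat2_mult mat2_minus mat_trace_mat2
      residue_mult_tail_of_sum fls_residue_uminus[symmetric]
    by (rule arg_cong[where f = fls_residue]) (simp add: fls_times_fps_to_fls algebra_simps)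
qed

text \<open>The two formulas for the pairing with a commutator show that the value depends on
  \<open>\<xi>\<close> only through \<open>u\<close> and on \<open>\<zeta>\<close> only through
  \<open>w\<close>; so the definite description in \<open>kks_form\<close> has a unique
  value.\<close>

lemma kks_form_eqI:
  assumes M: "M \<in> carrier_mat 2 2" and \<xi>: "\<xi> \<in> carrier_mat 2 2" "u = coadjoint_lie \<xi> M"
    and \<zeta>: "\<zeta> \<in> carrier_mat 2 2" "w = coadjoint_lie \<zeta> M"
  shows "kks_form 2 M u w = residue_pairing \<xi> w"
  unfolding kks_form_def
proof (rule the_equality)
  show "\<exists>\<xi>'\<in>carrier_mat 2 2. \<exists>\<zeta>\<in>carrier_mat 2 2. u = coadjoint_lie \<xi>' M \<and> w = coadjoint_lie \<zeta> M \<and>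
      residue_pairing \<xi> w = residue_pairing (\<xi>' * \<zeta> - \<zeta> * \<xi>') M"
    using \<xi> \<zeta> residue_pairing_commutator(1)[OF \<xi>(1) \<zeta>(1) M]
    by (intro bexI[of _ \<xi>] bexI[of _ \<zeta>]) auto
next
  fix c assume "\<exists>\<xi>\<in>carrier_mat 2 2. \<exists>\<zeta>\<in>carrier_mat 2 2. u = coadjoint_lie \<xi> M \<and> w = coadjoint_lie \<zeta> M \<and>
      c = residue_pairing (\<xi> * \<zeta> - \<zeta> * \<xi>) M"
  then obtain \<xi>' \<zeta>' where *: "\<xi>' \<in> carrier_mat 2 2" "\<zeta>' \<in> carrier_mat 2 2" "u = coadjoint_lie \<xi>' M"
    "w = coadjoint_lie \<zeta>' M" "c = residue_pairing (\<xi>' * \<zeta>' - \<zeta>' * \<xi>') M" by blast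
  have "c = - residue_pairing \<zeta>' u"
    using residue_pairing_commutator(2)[OF *(1,2) M] * by simp
  also have "\<dots> = residue_pairing \<xi> w"
    using residue_pairing_commutator[OF \<xi>(1) *(2) M] * \<xi> by simp
  finally show "c = residue_pairing \<xi> w" .
qed

text \<open>\<open>e1\<close> and \<open>e2\<close> say that the tangent vectors
  \<open>p1 q + p q1\<close> and \<open>p2 q + p q2\<close> are traceless modulo \<open>z^d\<close>,
  that is, \<open>q p\<close> is stationary. Every error term in the computation carries one of
  these two factors.\<close>

lemma kks_form_rank_one:
  fixes p q p1 q1 p2 q2 :: "nat \<Rightarrow> complex fps"
  assumes d: "d > 0" and l0: "fps_nth (pairing q p) 0 \<noteq> 0"
    and e1: "tcong d (pairing q p1 + (pairing q1 p)) 0"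
    and e2: "tcong d (pairing q p2 + (pairing q2 p)) 0"
  shows "kks_form 2 (shifted_tail d \<eta> (\<lambda>a b. p a * q b))
      (shifted_tail d 0 (\<lambda>a b. p1 a * q b + p a * q1 b)) (shifted_tail d 0 (\<lambda>a b. p2 a * q b + p a * q2 b)) =
    fps_nth (pairing q2 p1 - (pairing q1 p2)) (d - 1)"
proof -
  define l where "l = pairing q p"
  define m where "m = inverse l"
  have lm: "l * m = 1" using l0 by (simp add: m_def l_def inverse_mult_eq_1')
  define X where "X a b = p a * q b" for a b :: nat
  define U where "U p1 q1 a b = p1 a * q b + p a * q1 b" for p1 q1 :: "nat \<Rightarrow> complex fps" and a b :: nat
  define e where "e p1 q1 = pairing q p1 + (pairing q1 p)" for p1 q1 :: "nat \<Rightarrow> complex fps"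
  text \<open>If \<open>X = l E\<close> with \<open>E\<close> idempotent and \<open>U = l E'\<close>, then \<open>[[E', E], E] = E'\<close>.\<close>
  define \<xi> where "\<xi> p1 q1 a b = m * m * (U p1 q1 a 0 * X 0 b + U p1 q1 a 1 * X 1 b - (X a 0 * U p1 q1 0 b + X a 1 * U p1 q1 1 b))"
    for p1 q1 and a b :: nat
  have lie: "coadjoint_lie (mat2 (\<xi> p1 q1)) (shifted_tail d \<eta> X) = shifted_tail d 0 (U p1 q1)"
    if e: "tcong d (e p1 q1) 0" for p1 q1
  proof -
    have comm: "tcong d (\<xi> p1 q1 a 0 * X 0 b + \<xi> p1 q1 a 1 * X 1 b - (X a 0 * \<xi> p1 q1 0 b + X a 1 * \<xi> p1 q1 1 b)) (U p1 q1 a b)"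
      (is "tcong d ?c _") for a b
    proof -
      \<comment> \<open>\<open>?c\<close> is \<open>m * m\<close> times the double commutator of
        \<open>U\<close> with \<open>X\<close>; here \<open>X X = l X\<close>,
        \<open>X U X = l e X\<close> and \<open>U X + X U = l U + e X\<close>.\<close>
      have "?c = m * m * (l * l * U p1 q1 a b - l * e p1 q1 * X a b)"
        unfolding \<xi>_def U_def X_def l_def e_def by (simp add: algebra_simps)
      also have "\<dots> = (l * m) * (l * m) * U p1 q1 a b - e p1 q1 * ((l * m) * m * X a b)"
        by (simp add: algebra_simps)
      also have "\<dots> = U p1 q1 a b - e p1 q1 * (m * X a b)" by (simp add: lm)
      also have "tcong d \<dots> (U p1 q1 a b - 0 * (m * X a b))"
        by (intro tcong_diff tcong_mult tcong_refl e)
      finally show ?thesis by simp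
    qed
    \<comment> \<open>The scalar \<open>\<eta>\<close> on the diagonal enters through the terms
      \<open>s0\<close> to \<open>s3\<close>, which cancel in the commutator because scalars are
      central.\<close>
    have "tail_of (fps_to_fls x0 * (tail_of (polar d y0) + s0) + fps_to_fls x1 * (tail_of (polar d y1) + s1) -
        ((tail_of (polar d y2) + s2) * fps_to_fls x2 + (tail_of (polar d y3) + s3) * fps_to_fls x3)) =
        tail_of (polar d (x0 * y0 + x1 * y1 - (y2 * x2 + y3 * x3)))"
      if "fps_to_fls x0 * s0 + fps_to_fls x1 * s1 = s2 * fps_to_fls x2 + s3 * fps_to_fls x3"
      for x0 x1 x2 x3 y0 y1 y2 y3 s0 s1 s2 s3
    proof -
      have "fps_to_fls x0 * (tail_of (polar d y0) + s0) + fps_to_fls x1 * (tail_of (polar d y1) + s1) -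
        ((tail_of (polar d y2) + s2) * fps_to_fls x2 + (tail_of (polar d y3) + s3) * fps_to_fls x3) =
        fps_to_fls x0 * tail_of (polar d y0) + fps_to_fls x1 * tail_of (polar d y1) -
        (fps_to_fls x2 * tail_of (polar d y2) + fps_to_fls x3 * tail_of (polar d y3))"
        using that by (simp add: algebra_simps)
      then show ?thesis
        by (simp add: tail_of_add tail_of_diff tail_of_mult_tail_of polar_mult polar_add polar_diff mult.commute)
    qed
    note aux = this
    show ?thesis
      unfolding coadjoint_lie_def shifted_tail_def map_mat2 mat2_mult mat2_minus mat2_eq_iff
    proof (intro allI impI, goal_cases)
      case (1 a b)
      show ?case
        apply (subst aux)
        using 1 comm[of a b] by (auto simp: less_2_cases_iff tail_of_polar_eq_iff)
    qed
  qed
  have "kks_form 2 (shifted_tail d \<eta> X) (shifted_tail d 0 (U p1 q1)) (shifted_tail d 0 (U p2 q2)) =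
      residue_pairing (mat2 (\<xi> p1 q1)) (shifted_tail d 0 (U p2 q2))"
    using e1 e2 by (intro kks_form_eqI[OF _ _ lie[symmetric] _ lie[symmetric]]) (auto simp: shifted_tail_def e_def)
  also have "\<dots> = fls_residue (polar d (\<xi> p1 q1 0 0 * U p2 q2 0 0 + \<xi> p1 q1 0 1 * U p2 q2 1 0 +
      (\<xi> p1 q1 1 0 * U p2 q2 0 1 + \<xi> p1 q1 1 1 * U p2 q2 1 1)))"
    unfolding residue_pairing_def shifted_tail_def map_mat2 mat2_mult mat_trace_mat2
    by (simp only: if_cancel add_0_right residue_mult_tail_of_sum polar_mult polar_add)
  also have "\<dots> = fls_residue (polar d (pairing q2 p1 - (pairing q1 p2)))"
  proof (rule residue_polar_cong[OF d])
    define a1 a2 where "a1 = pairing q p1" and "a2 = pairing q p2"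
    define D where "D = pairing q2 p1 - (pairing q1 p2)"
    have "\<xi> p1 q1 0 0 * U p2 q2 0 0 + \<xi> p1 q1 0 1 * U p2 q2 1 0 +
      (\<xi> p1 q1 1 0 * U p2 q2 0 1 + \<xi> p1 q1 1 1 * U p2 q2 1 1) =
      m * m * (l * l * D + l * (e p1 q1 * a2 - e p2 q2 * a1))"
      unfolding \<xi>_def U_def X_def l_def e_def D_def a1_def a2_def by (simp add: algebra_simps)
    also have "\<dots> = (l * m) * (l * m) * D + (l * m) * m * (e p1 q1 * a2 - e p2 q2 * a1)"
      by (simp add: algebra_simps)
    also have "\<dots> = D + m * (e p1 q1 * a2 - e p2 q2 * a1)" by (simp add: lm)
    also have "tcong d \<dots> (D + m * (0 * a2 - 0 * a1))"
      using e1 e2 by (intro tcong_diff tcong_mult tcong_add tcong_refl) (simp_all add: e_def)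
    finally show "tcong d (\<xi> p1 q1 0 0 * U p2 q2 0 0 + \<xi> p1 q1 0 1 * U p2 q2 1 0 +
      (\<xi> p1 q1 1 0 * U p2 q2 0 1 + \<xi> p1 q1 1 1 * U p2 q2 1 1)) (pairing q2 p1 - (pairing q1 p2))"
      by (simp add: D_def)
  qed
  finally show ?thesis
    unfolding residue_polar[OF d] by (simp only: X_def[abs_def] U_def[abs_def])
qed

section \<open>Toeplitz matrices\<close>

text \<open>The matrix of multiplication by \<open>f\<close> on \<open>R_d\<close> in the basis
  \<open>1, z, ..., z^(d-1)\<close>.\<close>

definition toeplitz :: "nat \<Rightarrow> complex fps \<Rightarrow> complex mat" where
  "toeplitz d f = Matrix.mat d d (\<lambda>(p, q). if q \<le> p then fps_nth f (p - q) else 0)"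

lemma toeplitz_carrier [simp]: "toeplitz d f \<in> carrier_mat d d"
  and dim_toeplitz [simp]: "dim_row (toeplitz d f) = d" "dim_col (toeplitz d f) = d"
  by (simp_all add: toeplitz_def)

lemma toeplitz_index [simp]:
  "p < d \<Longrightarrow> q < d \<Longrightarrow> toeplitz d f $$ (p, q) = (if q \<le> p then fps_nth f (p - q) else 0)"
  by (simp add: toeplitz_def)

lemma mat_mult_index:
  assumes "A \<in> carrier_mat r s" "B \<in> carrier_mat s t" "i < r" "j < t"
  shows "(A * B) $$ (i, j) = (\<Sum>k<s. A $$ (i, k) * B $$ (k, j))"
  using assms by (auto simp: scalar_prod_def atLeast0LessThan intro!: sum.cong)

lemma sum_lessThan_if_le:
  fixes F :: "nat \<Rightarrow> 'a :: comm_monoid_add"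
  assumes "p < d" shows "(\<Sum>l<d. if q \<le> l \<and> l \<le> p then F l else 0) = (if q \<le> p then (\<Sum>j=0..p - q. F (q + j)) else 0)"
proof -
  have "(\<Sum>l<d. if q \<le> l \<and> l \<le> p then F l else 0) = (\<Sum>l\<in>{q..p}. F l)"
    using assms by (intro sum.mono_neutral_cong_right) auto
  also have "\<dots> = (if q \<le> p then (\<Sum>j=0..p - q. F (q + j)) else 0)"
    by (auto intro!: sum.reindex_bij_witness[of _ "\<lambda>j. q + j" "\<lambda>l. l - q"])
  finally show ?thesis .
qed

lemma toeplitz_mult: "toeplitz d f * toeplitz d g = toeplitz d (f * g)"
proof (rule eq_matI)
  fix p q assume "p < dim_row (toeplitz d (f * g))" "q < dim_col (toeplitz d (f * g))"
  then have pq: "p < d" "q < d" by auto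
  have "(toeplitz d f * toeplitz d g) $$ (p, q) = (\<Sum>l<d. toeplitz d f $$ (p, l) * toeplitz d g $$ (l, q))"
    by (rule mat_mult_index) (use pq in auto)
  also have "\<dots> = (\<Sum>l<d. if q \<le> l \<and> l \<le> p then fps_nth f (p - l) * fps_nth g (l - q) else 0)"
    by (rule sum.cong) (use pq in auto)
  also have "\<dots> = (if q \<le> p then (\<Sum>j=0..p - q. fps_nth f (p - (q + j)) * fps_nth g (q + j - q)) else 0)"
    by (rule sum_lessThan_if_le[OF pq(1)])
  also have "\<dots> = (if q \<le> p then fps_nth (g * f) (p - q) else 0)"
    unfolding fps_mult_nth by (auto simp: mult.commute intro!: sum.cong)
  finally show "(toeplitz d f * toeplitz d g) $$ (p, q) = toeplitz d (f * g) $$ (p, q)"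
    using pq by (simp add: mult.commute)
qed auto

lemma toeplitz_one: "toeplitz d 1 = 1\<^sub>m d"
  by (rule eq_matI) auto

lemma mult_z_eq_toeplitz: "mult_z d 1 = toeplitz d fps_X"
  by (rule eq_matI) (auto simp: mult_z_def)

lemma mult_z_pow: "mult_z d 1 ^\<^sub>m k = toeplitz d (fps_X ^ k)"
proof (induction k)
  case 0
  have "dim_row (mult_z d 1) = d" by (simp add: mult_z_def)
  then show ?case by (simp add: toeplitz_one)
next
  case (Suc k)
  then show ?case by (simp add: mult_z_eq_toeplitz[simplified] toeplitz_mult power_commutes)
qed

text \<open>\<open>R_d\<close> is generated by 1 as a module over itself, so an endomorphism
  commuting with \<open>z\<close> is multiplication by the image of 1, which is the first
  column.\<close>

lemma commutes_mult_z_imp_toeplitz: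
  assumes g: "g \<in> carrier_mat d d" and comm: "g * mult_z d 1 = mult_z d 1 * g"
  shows "g = toeplitz d (Abs_fps (\<lambda>m. g $$ (m, 0)))"
proof -
  \<comment> \<open>Entry \<open>(p, q)\<close> of the two products compares column
    \<open>q + 1\<close> of \<open>g\<close> with column \<open>q\<close> shifted down by one
    place.\<close>
  have step: "g $$ (p, Suc q) = (if p = 0 then 0 else g $$ (p - 1, q))" if "p < d" "Suc q < d" for p q
  proof -
    have "(g * mult_z d 1) $$ (p, q) = (\<Sum>k<d. g $$ (p, k) * mult_z d 1 $$ (k, q))"
      unfolding mult_z_eq_toeplitz by (rule mat_mult_index[OF g toeplitz_carrier]) (use that in auto)
    also have "\<dots> = (\<Sum>k<d. if k = Suc q then g $$ (p, k) else 0)"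
      by (rule sum.cong) (use that in \<open>auto simp: mult_z_eq_toeplitz[simplified]\<close>)
    also have "\<dots> = g $$ (p, Suc q)" using that by simp
    finally have 1: "(g * mult_z d 1) $$ (p, q) = g $$ (p, Suc q)" .
    have "(mult_z d 1 * g) $$ (p, q) = (\<Sum>k<d. mult_z d 1 $$ (p, k) * g $$ (k, q))"
      unfolding mult_z_eq_toeplitz by (rule mat_mult_index[OF toeplitz_carrier g]) (use that in auto)
    also have "\<dots> = (\<Sum>k<d. if p = Suc k then g $$ (k, q) else 0)"
      by (rule sum.cong) (use that in \<open>auto simp: mult_z_eq_toeplitz[simplified]\<close>)
    also have "\<dots> = (if p = 0 then 0 else g $$ (p - 1, q))"
      using that by (cases p) auto
    finally show ?thesis using 1 comm by simp
  qed
  have *: "g $$ (p, q) = (if q \<le> p then g $$ (p - q, 0) else 0)" if "p < d" "q < d" for p q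
    using that
  proof (induction q arbitrary: p)
    case (Suc q)
    then show ?case by (auto simp: step)
  qed auto
  show ?thesis
  proof (rule eq_matI)
    fix p q assume "p < dim_row (toeplitz d (Abs_fps (\<lambda>m. g $$ (m, 0))))" "q < dim_col (toeplitz d (Abs_fps (\<lambda>m. g $$ (m, 0))))"
    then show "g $$ (p, q) = toeplitz d (Abs_fps (\<lambda>m. g $$ (m, 0))) $$ (p, q)"
      by (subst *) simp_all
  qed (use g in auto)
qed

lemma toeplitz_inverse:
  assumes "fps_nth u 0 \<noteq> 0"
  shows "toeplitz d u * toeplitz d (inverse u) = 1\<^sub>m d" "toeplitz d (inverse u) * toeplitz d u = 1\<^sub>m d"
  using assms by (simp_all add: toeplitz_mult inverse_mult_eq_1 inverse_mult_eq_1' toeplitz_one)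

text \<open>The module automorphisms of \<open>R_d\<close> are its units. The constant coefficient
  of an automorphism is non-zero because the first row of a lower triangular matrix has only its
  first entry.\<close>

lemma aut_group_rank_one:
  assumes d: "d > 0"
  shows "aut_group d 1 = {toeplitz d u |u. fps_nth u 0 \<noteq> 0}"
proof (intro equalityI subsetI)
  fix g assume "g \<in> aut_group d 1"
  then have g: "g \<in> general_linear d" "g * mult_z d 1 = mult_z d 1 * g"
    by (simp_all add: aut_group_def)
  from g(1) obtain h where h: "g \<in> carrier_mat d d" "h \<in> carrier_mat d d" "g * h = 1\<^sub>m d"
    by (rule general_linearE)
  define u where "u = Abs_fps (\<lambda>m. g $$ (m, 0))"
  have gu: "g = toeplitz d u"
    unfolding u_def by (rule commutes_mult_z_imp_toeplitz[OF h(1) g(2)])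
  have "1 = (g * h) $$ (0, 0)" using h(3) d by simp
  also have "\<dots> = (\<Sum>k<d. g $$ (0, k) * h $$ (k, 0))"
    by (rule mat_mult_index[OF h(1,2)]) (use d in auto)
  also have "\<dots> = (\<Sum>k<d. if k = 0 then fps_nth u 0 * h $$ (0, 0) else 0)"
    by (rule sum.cong) (use d in \<open>auto simp: gu\<close>)
  finally have "fps_nth u 0 \<noteq> 0" using d by auto
  with gu show "g \<in> {toeplitz d u |u. fps_nth u 0 \<noteq> 0}" by blast
next
  fix g assume "g \<in> {toeplitz d u |u. fps_nth u 0 \<noteq> 0}"
  then obtain u where u: "g = toeplitz d u" "fps_nth u 0 \<noteq> 0" by blast
  have "g \<in> general_linear d"
    unfolding u(1) by (rule general_linearI[OF _ _ toeplitz_inverse[OF u(2)]]) auto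
  then show "g \<in> aut_group d 1"
    by (simp add: aut_group_def mult_z_eq_toeplitz[simplified] u toeplitz_mult mult.commute)
qed

lemma aut_group_1: "aut_group 1 r = general_linear r"
proof -
  have "mult_z 1 r = 0\<^sub>m r r" by (rule eq_matI) (auto simp: mult_z_def)
  then show ?thesis
    by (auto simp: aut_group_def general_linear_def)
qed

lemma eq_mult_inverse_iff:
  fixes C X S T :: "'a :: comm_ring_1 mat"
  assumes "C \<in> carrier_mat r s" "X \<in> carrier_mat r s" "S \<in> carrier_mat s s" "T \<in> carrier_mat s s"
    and TS: "T * S = 1\<^sub>m s" "S * T = 1\<^sub>m s"
  shows "C = X * S \<longleftrightarrow> C * T = X"
proof
  show "C * T = X" if "C = X * S"
    unfolding that using assms assoc_mult_mat[of X r s S s T s] by simp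
  show "C = X * S" if "C * T = X"
    unfolding that[symmetric] using assms assoc_mult_mat[of C r s T s S s] by simp
qed

section \<open>The star-shaped quiver in coordinates\<close>

lemma star_simps [simp]:
  "verts (star_quiver n) = {0..n}" "src (star_quiver n) (Inl i) = i" "src (star_quiver n) (Inr i) = 0"
  "tgt (star_quiver n) (Inl i) = 0" "tgt (star_quiver n) (Inr i) = i"
  "double_arcs (star_quiver n) = Inl ` {1..n} \<union> Inr ` {1..n}"
  by (auto simp: star_quiver_def src_def tgt_def double_arcs_def)

lemma rev_arc_simps [simp]: "rev_arc (Inl i) = Inr i" "rev_arc (Inr i) = Inl i"
  and arc_sign_simps [simp]: "arc_sign (Inl i) = 1" "arc_sign (Inr i) = -1"
  by (simp_all add: rev_arc_def arc_sign_def)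

lemma sum_double_arcs_star:
  "(\<Sum>h\<in>double_arcs (star_quiver n). F h) = (\<Sum>i=1..n. F (Inl i)) + (\<Sum>i=1..n. F (Inr i))"
  unfolding star_simps by (subst sum.union_disjoint) (auto simp: sum.reindex)

lemma fls_nth_sum_monomial:
  "fls_nth (\<Sum>k=1..d. monomial (c k) (- int k)) m = (if - int d \<le> m \<and> m < 0 then c (nat (- m)) else 0)"
proof -
  have "fls_nth (\<Sum>k=1..d. monomial (c k) (- int k)) m = (\<Sum>k=1..d. if k = nat (- m) \<and> m < 0 then c k else 0)"
    unfolding fls_nth_sum by (rule sum.cong) (auto simp: monomial_def)
  also have "\<dots> = (if - int d \<le> m \<and> m < 0 then c (nat (- m)) else 0)"
    by (cases "m < 0") (auto simp: sum.delta)
  finally show ?thesis .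
qed

text \<open>
  The components of \<open>P\<^sub>i : R\<^sub>d \<rightarrow> \<complex>\<^sup>2\<close> are functionals on \<open>R\<^sub>d\<close>, hence elements of \<open>z\<^bsup>-d\<^esup>\<complex>[[z]]/\<complex>[[z]]\<close>; \<open>pser\<close> is
  \<open>z\<^sup>d\<close> times these.
  Likewise \<open>xser\<close> is \<open>z\<^bsup>d\<^esup>(A\<^sub>i(z) - \<eta>\<^sub>i(z))\<close>.
\<close>

definition pser :: "(nat \<Rightarrow> nat) \<Rightarrow> (nat quiver_index \<Rightarrow> complex) \<Rightarrow> nat \<Rightarrow> nat \<Rightarrow> complex fps" where
  "pser d B i a = Abs_fps (\<lambda>m. if m < d i then B (Inl i, a, d i - 1 - m) else 0)"

definition qser :: "(nat \<Rightarrow> nat) \<Rightarrow> (nat quiver_index \<Rightarrow> complex) \<Rightarrow> nat \<Rightarrow> nat \<Rightarrow> complex fps" where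
  "qser d B i a = Abs_fps (\<lambda>m. if m < d i then B (Inr i, m, a) else 0)"

definition tail_ser :: "nat \<Rightarrow> complex fls \<Rightarrow> complex fps" where
  "tail_ser d f = Abs_fps (\<lambda>m. if m < d then fls_nth f (int m - int d) else 0)"

lemma tail_of_polar_tail_ser: "f \<in> laurent_tails d \<Longrightarrow> tail_of (polar d (tail_ser d f)) = f"
  by (intro fls_eqI) (auto simp: fls_nth_tail_of fls_nth_polar tail_ser_def laurent_tails_def nat_less_iff)

locale star_data =
  fixes n :: nat and d v :: "nat \<Rightarrow> nat"
  assumes d_pos: "i \<le> n \<Longrightarrow> d i > 0" and d0: "d 0 = 1" and v0: "v 0 = 2" and v1: "i \<in> {1..n} \<Longrightarrow> v i = 1"
begin

abbreviation "Q \<equiv> star_quiver n"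

lemma quiver_coords_star:
  "(h, p, q) \<in> quiver_coords Q d v \<longleftrightarrow>
    (case h of Inl i \<Rightarrow> i \<in> {1..n} \<and> p < 2 \<and> q < d i | Inr i \<Rightarrow> i \<in> {1..n} \<and> p < d i \<and> q < 2)"
  by (auto simp: quiver_coords_def d0 v0 v1 split: sum.split)

lemma finite_quiver_coords: "finite (quiver_coords Q d v)"
  unfolding quiver_coords_def by (intro finite_SigmaI) auto

lemma arrow_map_star:
  assumes "i \<in> {1..n}"
  shows "arrow_map Q d v B (Inl i) = Matrix.mat 2 (d i) (\<lambda>(p, q). B (Inl i, p, q))"
    and "arrow_map Q d v B (Inr i) = Matrix.mat (d i) 2 (\<lambda>(p, q). B (Inr i, p, q))"
  using assms by (simp_all add: arrow_map_def d0 v0 v1)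

lemma arrow_map_carrier [simp]:
  assumes "i \<in> {1..n}"
  shows "arrow_map Q d v B (Inl i) \<in> carrier_mat 2 (d i)" "arrow_map Q d v B (Inr i) \<in> carrier_mat (d i) 2"
  using assms by (simp_all add: arrow_map_star)

lemma arrow_map_index:
  assumes "i \<in> {1..n}" "a < 2" "k < d i"
  shows "arrow_map Q d v B (Inl i) $$ (a, k) = B (Inl i, a, k)"
    and "arrow_map Q d v B (Inr i) $$ (k, a) = B (Inr i, k, a)"
  using assms by (simp_all add: arrow_map_star)

text \<open>The index reversal in \<open>pser\<close> turns the convolution into a pairing:
  coefficient \<open>d i - k\<close> is the effect of inserting \<open>z^(k-1)\<close> between the
  two arrows of the arm.\<close>

lemma qser_pser_nth:
  assumes "1 \<le> k" "k \<le> d i"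
  shows "fps_nth (qser d C i a * pser d B i b) (d i - k) = (\<Sum>m<d i. if m + (k - 1) < d i then C (Inr i, m, a) * B (Inl i, b, m + (k - 1)) else 0)"
proof -
  have "fps_nth (qser d C i a * pser d B i b) (d i - k) = (\<Sum>m=0..d i - k. C (Inr i, m, a) * B (Inl i, b, m + (k - 1)))"
    unfolding fps_mult_nth by (rule sum.cong) (use assms in \<open>auto simp: qser_def pser_def algebra_simps intro!: arg_cong2[of _ _ _ _ "(*)"] arg_cong[of _ _ B]\<close>)
  also have "\<dots> = (\<Sum>m<d i. if m + (k - 1) < d i then C (Inr i, m, a) * B (Inl i, b, m + (k - 1)) else 0)"
    using assms by (intro sum.mono_neutral_cong_left) auto
  finally show ?thesis .
qed

text \<open>Precomposing a functional on \<open>R_d\<close> with multiplication by \<open>u\<close>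
  is the transposed action; the index reversal in \<open>pser\<close> makes it plain multiplication
  of series.\<close>

lemma pser_toeplitz:
  assumes i: "i \<in> {1..n}" and "a < 2" "k < d i"
  shows "(arrow_map Q d v B (Inl i) * toeplitz (d i) u) $$ (a, k) = fps_nth (pser d B i a * u) (d i - 1 - k)"
proof -
  have "(arrow_map Q d v B (Inl i) * toeplitz (d i) u) $$ (a, k) =
      (\<Sum>l<d i. arrow_map Q d v B (Inl i) $$ (a, l) * toeplitz (d i) u $$ (l, k))"
    by (rule mat_mult_index) (use assms in auto)
  also have "\<dots> = (\<Sum>l<d i. if k \<le> l \<and> l \<le> d i - 1 then B (Inl i, a, l) * fps_nth u (l - k) else 0)"
    by (rule sum.cong) (use assms in \<open>auto simp: arrow_map_index\<close>)
  also have "\<dots> = (if k \<le> d i - 1 then (\<Sum>j=0..d i - 1 - k. B (Inl i, a, k + j) * fps_nth u (k + j - k)) else 0)"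
    using assms by (intro sum_lessThan_if_le) auto
  also have "\<dots> = fps_nth (u * pser d B i a) (d i - 1 - k)"
    unfolding fps_mult_nth
    using assms by (auto simp: pser_def algebra_simps intro!: sum.cong arg_cong2[of _ _ _ _ "(*)"] arg_cong[of _ _ B])
  finally show ?thesis by (simp add: mult.commute)
qed

lemma toeplitz_qser:
  assumes i: "i \<in> {1..n}" and "a < 2" "k < d i"
  shows "(toeplitz (d i) u * arrow_map Q d v B (Inr i)) $$ (k, a) = fps_nth (u * qser d B i a) k"
proof -
  have "(toeplitz (d i) u * arrow_map Q d v B (Inr i)) $$ (k, a) =
      (\<Sum>l<d i. toeplitz (d i) u $$ (k, l) * arrow_map Q d v B (Inr i) $$ (l, a))"
    by (rule mat_mult_index) (use assms in auto)
  also have "\<dots> = (\<Sum>l<d i. if 0 \<le> l \<and> l \<le> k then B (Inr i, l, a) * fps_nth u (k - l) else 0)"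
    by (rule sum.cong) (use assms in \<open>auto simp: arrow_map_index\<close>)
  also have "\<dots> = (if 0 \<le> k then (\<Sum>j=0..k - 0. B (Inr i, 0 + j, a) * fps_nth u (k - (0 + j))) else 0)"
    using assms by (intro sum_lessThan_if_le) auto
  also have "\<dots> = fps_nth (qser d B i a * u) k"
    unfolding fps_mult_nth using assms by (auto simp: qser_def intro!: sum.cong)
  finally show ?thesis by (simp add: mult.commute)
qed

lemma arrow_map_shift:
  assumes i: "i \<in> {1..n}" and a: "a < 2" and m: "m < d i"
  shows "(arrow_map Q d v B (Inl i) * toeplitz (d i) (fps_X ^ l)) $$ (a, m) = (if m + l < d i then B (Inl i, a, m + l) else 0)"
proof -
  have "d i - 1 - (d i - 1 - m - l) = m + l" if "m + l < d i" using that m by simp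
  then show ?thesis
    unfolding pser_toeplitz[OF i a m] fps_X_power_mult_right_nth pser_def using m by auto
qed

lemma path_matrix_index:
  assumes i: "i \<in> {1..n}" and "a < 2" "b < 2" "1 \<le> k" "k \<le> d i"
  shows "(arrow_map Q d v B (Inl i) * toeplitz (d i) (fps_X ^ (k - 1)) * arrow_map Q d v B (Inr i)) $$ (a, b) =
    fps_nth (pser d B i a * qser d B i b) (d i - k)"
proof -
  have "(arrow_map Q d v B (Inl i) * toeplitz (d i) (fps_X ^ (k - 1)) * arrow_map Q d v B (Inr i)) $$ (a, b) =
    (\<Sum>m<d i. (arrow_map Q d v B (Inl i) * toeplitz (d i) (fps_X ^ (k - 1))) $$ (a, m) * arrow_map Q d v B (Inr i) $$ (m, b))"
    by (rule mat_mult_index) (use assms in \<open>auto intro!: mult_carrier_mat\<close>)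
  also have "\<dots> = (\<Sum>m<d i. if m + (k - 1) < d i then B (Inr i, m, b) * B (Inl i, a, m + (k - 1)) else 0)"
  proof (rule sum.cong)
    fix m assume "m \<in> {..<d i}"
    then have m: "m < d i" by simp
    show "(arrow_map Q d v B (Inl i) * toeplitz (d i) (fps_X ^ (k - 1))) $$ (a, m) * arrow_map Q d v B (Inr i) $$ (m, b) =
        (if m + (k - 1) < d i then B (Inr i, m, b) * B (Inl i, a, m + (k - 1)) else 0)"
      using m assms by (simp add: arrow_map_index arrow_map_shift)
  qed simp
  also have "\<dots> = fps_nth (qser d B i b * pser d B i a) (d i - k)"
    by (rule qser_pser_nth[symmetric]) fact+
  finally show ?thesis by (simp add: mult.commute)
qed

text \<open>Only \<open>Inr i\<close> ends at the arm \<open>i\<close>, and its sign -1 will cancel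
  the minus sign of the level equation, leaving \<open>q p = lam i\<close>. As
  \<open>v i = 1\<close>, the partial trace is the full trace.\<close>

lemma moment_arm:
  assumes i: "i \<in> {1..n}"
  shows "moment Q d v B i = Matrix.mat 1 1 (\<lambda>_. \<Sum>k=1..d i.
    monomial (- fps_nth (pairing (qser d B i) (pser d B i)) (d i - k)) (- int k))"
proof -
  have arcs: "{h \<in> double_arcs Q. tgt Q h = i} = {Inr i}" using i by auto
  have tr: "partial_trace (d i) 1 (arrow_map Q d v B (Inr i) * arrow_map Q d v B (Inl i) * mult_z (d i) 1 ^\<^sub>m (k - 1)) $$ (0, 0) =
      fps_nth (pairing (qser d B i) (pser d B i)) (d i - k)"
    if k: "1 \<le> k" "k \<le> d i" for k
  proof -
    have "(arrow_map Q d v B (Inr i) * arrow_map Q d v B (Inl i) * toeplitz (d i) (fps_X ^ (k - 1))) $$ (m, m) =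
       (\<Sum>a<2. if m + (k - 1) < d i then B (Inr i, m, a) * B (Inl i, a, m + (k - 1)) else 0)" if m: "m < d i" for m
    proof -
      have assoc: "arrow_map Q d v B (Inr i) * arrow_map Q d v B (Inl i) * toeplitz (d i) (fps_X ^ (k - 1)) =
          arrow_map Q d v B (Inr i) * (arrow_map Q d v B (Inl i) * toeplitz (d i) (fps_X ^ (k - 1)))"
        using i by (intro assoc_mult_mat[of _ "d i" 2 _ "d i" _ "d i"]) auto
      have "(arrow_map Q d v B (Inr i) * arrow_map Q d v B (Inl i) * toeplitz (d i) (fps_X ^ (k - 1))) $$ (m, m) =
          (\<Sum>a<2. arrow_map Q d v B (Inr i) $$ (m, a) *
          (arrow_map Q d v B (Inl i) * toeplitz (d i) (fps_X ^ (k - 1))) $$ (a, m))"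
        unfolding assoc
        by (rule mat_mult_index) (use i m in \<open>auto intro!: mult_carrier_mat\<close>)
      also have "\<dots> = (\<Sum>a<2. if m + (k - 1) < d i then B (Inr i, m, a) * B (Inl i, a, m + (k - 1)) else 0)"
      proof (rule sum.cong)
        fix a :: nat assume a: "a \<in> {..<2}"
        show "arrow_map Q d v B (Inr i) $$ (m, a) * (arrow_map Q d v B (Inl i) * toeplitz (d i) (fps_X ^ (k - 1))) $$ (a, m) =
           (if m + (k - 1) < d i then B (Inr i, m, a) * B (Inl i, a, m + (k - 1)) else 0)"
          using i m a k by (simp add: arrow_map_index arrow_map_shift)
      qed simp
      finally show ?thesis .
    qed
    then have "partial_trace (d i) 1 (arrow_map Q d v B (Inr i) * arrow_map Q d v B (Inl i) * mult_z (d i) 1 ^\<^sub>m (k - 1)) $$ (0, 0) =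
       (\<Sum>m<d i. \<Sum>a<2. if m + (k - 1) < d i then B (Inr i, m, a) * B (Inl i, a, m + (k - 1)) else 0)"
      unfolding mult_z_pow by (simp add: partial_trace_def)
    also have "\<dots> = (\<Sum>a<2. fps_nth (qser d B i a * pser d B i a) (d i - k))"
      by (subst sum.swap) (simp only: qser_pser_nth[OF k])
    finally show ?thesis by (simp add: eval_nat_numeral)
  qed
  have vi: "v i = 1" using i v1 by simp
  show ?thesis
    unfolding moment_def vi arcs
    by (rule eq_matI) (auto simp: tr[simplified] intro!: sum.cong)
qed

text \<open>Since \<open>d 0 = 1\<close>, the sum over \<open>k\<close> has a single term with the
  zeroth power of \<open>z\<close>; the centre therefore sees only the residue of each
  \<open>p q\<close>.\<close>

lemma moment_center:
  assumes "a < 2" "b < 2"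
  shows "moment Q d v B 0 $$ (a, b) =
    monomial (\<Sum>i=1..n. fps_nth (pser d B i a * qser d B i b) (d i - 1)) (- 1)"
proof -
  have arcs: "{h \<in> double_arcs Q. tgt Q h = 0} = Inl ` {1..n}" by auto
  have mz: "mult_z 1 2 ^\<^sub>m 0 = 1\<^sub>m 2" by (simp add: mult_z_def)
  have "partial_trace 1 2 (arrow_map Q d v B (Inl i) * arrow_map Q d v B (Inr i) * mult_z 1 2 ^\<^sub>m 0) $$ (a, b) =
    fps_nth (pser d B i a * qser d B i b) (d i - 1)" if i: "i \<in> {1..n}" for i
  proof -
    have "arrow_map Q d v B (Inl i) * arrow_map Q d v B (Inr i) * mult_z 1 2 ^\<^sub>m 0 =
       arrow_map Q d v B (Inl i) * toeplitz (d i) (fps_X ^ (1 - 1)) * arrow_map Q d v B (Inr i)"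
      unfolding mz using i by (simp add: toeplitz_one right_mult_one_mat[of _ 2 2] mult_carrier_mat[of _ 2 "d i" _ 2]
        right_mult_one_mat[of _ 2 "d i"])
    then show ?thesis
      using assms path_matrix_index[OF i assms, of 1 B] d_pos[of i] i by (simp add: partial_trace_def)
  qed
  then show ?thesis
    unfolding moment_def v0 d0 arcs using assms by (simp add: sum.reindex mult_z_def)
qed

end

section \<open>Submodules and stability\<close>

lemma is_subspaceD:
  assumes "is_subspace m S"
  shows "x \<in> S \<Longrightarrow> x \<in> carrier_vec m" "0\<^sub>v m \<in> S" "x \<in> S \<Longrightarrow> y \<in> S \<Longrightarrow> x + y \<in> S" "x \<in> S \<Longrightarrow> c \<cdot>\<^sub>v x \<in> S"
  using assms by (auto simp: is_subspace_def)

lemma mult_mat_vec_index: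
  assumes "A \<in> carrier_mat r s" "x \<in> carrier_vec s" "i < r"
  shows "(A *\<^sub>v x) $ i = (\<Sum>j<s. A $$ (i, j) * x $ j)"
  using assms by (auto simp: scalar_prod_def atLeast0LessThan intro!: sum.cong)

lemma toeplitz_X_power_mult_vec:
  assumes "x \<in> carrier_vec d" "p < d"
  shows "(toeplitz d (fps_X ^ k) *\<^sub>v x) $ p = (if k \<le> p then x $ (p - k) else 0)"
proof -
  have "(toeplitz d (fps_X ^ k) *\<^sub>v x) $ p = (\<Sum>j<d. toeplitz d (fps_X ^ k) $$ (p, j) * x $ j)"
    by (rule mult_mat_vec_index) (use assms in auto)
  also have "\<dots> = (\<Sum>j<d. if j = p - k \<and> k \<le> p then x $ j else 0)"
    by (rule sum.cong) (use assms in \<open>auto simp: fps_X_power_nth\<close>)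
  also have "\<dots> = (if k \<le> p then x $ (p - k) else 0)"
    using assms by (cases "k \<le> p") (auto simp: sum.delta)
  finally show ?thesis .
qed

lemma mult_z_power_closed:
  assumes S: "is_subspace d S" and N: "\<And>x. x \<in> S \<Longrightarrow> mult_z d 1 *\<^sub>v x \<in> S" and x: "x \<in> S"
  shows "toeplitz d (fps_X ^ k) *\<^sub>v x \<in> S"
proof (induction k)
  case 0
  then show ?case using x is_subspaceD(1)[OF S x] by (simp add: toeplitz_one)
next
  case (Suc k)
  have "toeplitz d (fps_X ^ Suc k) *\<^sub>v x = mult_z d 1 *\<^sub>v (toeplitz d (fps_X ^ k) *\<^sub>v x)"
    using is_subspaceD(1)[OF S x] unfolding mult_z_eq_toeplitz
    by (subst assoc_mult_mat_vec[symmetric, of _ d d _ d]) (auto simp: toeplitz_mult)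
  then show ?case using N[OF Suc] by simp
qed

text \<open>\<open>R_d\<close> is local: an element with non-zero constant coefficient is a unit and
  generates the whole module.\<close>

lemma submodule_full:
  fixes w :: "complex vec"
  assumes S: "is_subspace d S" and N: "\<And>x. x \<in> S \<Longrightarrow> mult_z d 1 *\<^sub>v x \<in> S"
    and w: "w \<in> S" "w $ 0 \<noteq> 0" "d > 0"
  shows "S = carrier_vec d"
proof -
  have wd: "w \<in> carrier_vec d" by (rule is_subspaceD(1)[OF S w(1)])
  \<comment> \<open>Descending induction on \<open>k\<close>: the vectors of order at least
    \<open>k\<close> lie in \<open>S\<close>. Passing from \<open>k + 1\<close> to \<open>k\<close>
    removes the coefficient at \<open>k\<close> by a multiple of \<open>z^k w\<close>.\<close>
  have "\<forall>x\<in>carrier_vec d. (\<forall>j<k. x $ j = 0) \<longrightarrow> x \<in> S" if "k \<le> d" for k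
    using that
  proof (induction k rule: inc_induct)
    case base
    have "x = 0\<^sub>v d" if "x \<in> carrier_vec d" "\<forall>j<d. x $ j = 0" for x :: "complex vec"
      using that by (intro eq_vecI) auto
    then show ?case using is_subspaceD(2)[OF S] by blast
  next
    case (step k)
    show ?case
    proof (intro ballI impI)
      fix x :: "complex vec" assume x: "x \<in> carrier_vec d" "\<forall>j<k. x $ j = 0"
      define u where "u = toeplitz d (fps_X ^ k) *\<^sub>v w"
      have uS: "u \<in> S" unfolding u_def by (rule mult_z_power_closed[OF S N w(1)])
      have u: "u \<in> carrier_vec d" by (rule is_subspaceD(1)[OF S uS])
      have uj: "u $ j = (if k \<le> j then w $ (j - k) else 0)" if "j < d" for j
        unfolding u_def by (rule toeplitz_X_power_mult_vec[OF wd that])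
      define y where "y = x + (- (x $ k / w $ 0)) \<cdot>\<^sub>v u"
      have "y \<in> carrier_vec d" using x u by (simp add: y_def)
      moreover have "\<forall>j<Suc k. y $ j = 0"
        using x u uj step w by (auto simp: y_def less_Suc_eq)
      ultimately have "y \<in> S" using step by blast
      then have "y + (x $ k / w $ 0) \<cdot>\<^sub>v u \<in> S" using S uS by (intro is_subspaceD) auto
      moreover have "y + (x $ k / w $ 0) \<cdot>\<^sub>v u = x"
        using x u by (intro eq_vecI) (auto simp: y_def)
      ultimately show "x \<in> S" by simp
    qed
  qed
  from this[of 0] show ?thesis using is_subspaceD(1)[OF S] by auto
qed

context star_data
begin

abbreviation Pm where "Pm B i \<equiv> arrow_map Q d v B (Inl i)"
abbreviation Qm where "Qm B i \<equiv> arrow_map Q d v B (Inr i)"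

lemma path_matrix_carrier [simp]:
  "i \<in> {1..n} \<Longrightarrow> Pm B i * toeplitz (d i) f * Qm B i \<in> carrier_mat 2 2"
  by (auto intro!: mult_carrier_mat)

lemma path_matrix_vec:
  assumes "i \<in> {1..n}" "x \<in> carrier_vec 2"
  shows "(Pm B i * toeplitz (d i) f * Qm B i) *\<^sub>v x = Pm B i *\<^sub>v (toeplitz (d i) f *\<^sub>v (Qm B i *\<^sub>v x))"
proof -
  have "(Pm B i * toeplitz (d i) f * Qm B i) *\<^sub>v x = (Pm B i * toeplitz (d i) f) *\<^sub>v (Qm B i *\<^sub>v x)"
    using assms by (intro assoc_mult_mat_vec[of _ 2 "d i" _ 2]) (auto intro!: mult_carrier_mat)
  also have "\<dots> = Pm B i *\<^sub>v (toeplitz (d i) f *\<^sub>v (Qm B i *\<^sub>v x))"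
    using assms by (intro assoc_mult_mat_vec[of _ 2 "d i" _ "d i"]) (auto intro!: mult_mat_vec_carrier)
  finally show ?thesis .
qed

lemma Qm_vec_carrier [simp]: "i \<in> {1..n} \<Longrightarrow> x \<in> carrier_vec 2 \<Longrightarrow> Qm B i *\<^sub>v x \<in> carrier_vec (d i)"
  using arrow_map_carrier(2) by (rule mult_mat_vec_carrier)

text \<open>Irreducibility of the system in terms of the representation: the closed paths from the
  centre through arm \<open>i\<close> with \<open>k\<close> factors of \<open>z\<close> are, up to
  scalars, the coefficients of the system.\<close>

definition path_irreducible :: "(nat quiver_index \<Rightarrow> complex) \<Rightarrow> bool" where
  "path_irreducible B \<longleftrightarrow> \<not> (\<exists>S. is_subspace 2 S \<and> S \<noteq> {0\<^sub>v 2} \<and> S \<noteq> carrier_vec 2 \<and>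
     (\<forall>i\<in>{1..n}. \<forall>k<d i. \<forall>x\<in>S. (Pm B i * toeplitz (d i) (fps_X ^ k) * Qm B i) *\<^sub>v x \<in> S))"

lemma mult_z_1_2_vec: "x \<in> carrier_vec 2 \<Longrightarrow> mult_z (Suc 0) 2 *\<^sub>v x = 0\<^sub>v 2"
proof -
  have "mult_z (Suc 0) 2 = 0\<^sub>m 2 2" by (rule eq_matI) (auto simp: mult_z_def)
  then show "x \<in> carrier_vec 2 \<Longrightarrow> mult_z (Suc 0) 2 *\<^sub>v x = 0\<^sub>v 2"
    by (intro eq_vecI) auto
qed

text \<open>An invariant line in the centre extends over the arms to a subrepresentation, which is
  non-zero and proper already at vertex 0.\<close>

lemma stable_imp_path_irreducible:
  assumes "stable Q d v B"
  shows "path_irreducible B"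
  unfolding path_irreducible_def
proof (intro notI, elim exE conjE)
  fix W assume W: "is_subspace 2 W" "W \<noteq> {0\<^sub>v 2}" "W \<noteq> carrier_vec 2"
    and inv: "\<forall>i\<in>{1..n}. \<forall>k<d i. \<forall>x\<in>W. (Pm B i * toeplitz (d i) (fps_X ^ k) * Qm B i) *\<^sub>v x \<in> W"
  \<comment> \<open>On an arm, the largest \<open>z\<close>-stable subspace that \<open>P\<close>
    carries into \<open>W\<close>. All powers \<open>k\<close> are allowed, so that stability under
    \<open>z\<close> is a shift of \<open>k\<close>; those with \<open>k \<ge> d i\<close> give
    zero.\<close>
  define S where "S i = (if i = 0 then W else
    {x \<in> carrier_vec (d i). \<forall>k. Pm B i *\<^sub>v (toeplitz (d i) (fps_X ^ k) *\<^sub>v x) \<in> W})" for i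
  have T [simp]: "toeplitz (d i) f *\<^sub>v x \<in> carrier_vec (d i)" if "x \<in> carrier_vec (d i)" for i f x
    by (rule mult_mat_vec_carrier[OF toeplitz_carrier that])
  have 1: "is_subspace (d i) (S i)" if i: "i \<in> {1..n}" for i
    unfolding is_subspace_def
  proof (intro conjI ballI allI)
    have "Pm B i *\<^sub>v (toeplitz (d i) (fps_X ^ k) *\<^sub>v (0\<^sub>v (d i))) = 0\<^sub>v 2" for k
    proof -
      have "toeplitz (d i) (fps_X ^ k) *\<^sub>v (0\<^sub>v (d i)) = 0\<^sub>v (d i)" by (intro eq_vecI) auto
      moreover have "Pm B i *\<^sub>v 0\<^sub>v (d i) = 0\<^sub>v 2"
        using arrow_map_carrier(1)[OF i, of B] by (intro eq_vecI) auto
      ultimately show ?thesis by simp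
    qed
    then show "0\<^sub>v (d i) \<in> S i" using i is_subspaceD(2)[OF W(1)] by (auto simp: S_def)
    fix x y assume x: "x \<in> S i" and y: "y \<in> S i"
    then have c: "x \<in> carrier_vec (d i)" "y \<in> carrier_vec (d i)" using i by (auto simp: S_def)
    have "Pm B i *\<^sub>v (toeplitz (d i) (fps_X ^ k) *\<^sub>v (x + y)) =
      Pm B i *\<^sub>v (toeplitz (d i) (fps_X ^ k) *\<^sub>v x) + Pm B i *\<^sub>v (toeplitz (d i) (fps_X ^ k) *\<^sub>v y)" for k
      using c by (simp add: mult_add_distrib_mat_vec[OF toeplitz_carrier] mult_add_distrib_mat_vec[OF arrow_map_carrier(1)[OF i]])
    then show "x + y \<in> S i" using x y i c is_subspaceD(3)[OF W(1)] by (auto simp: S_def)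
  next
    fix c :: complex and x assume x: "x \<in> S i"
    then have c: "x \<in> carrier_vec (d i)" using i by (auto simp: S_def)
    have "Pm B i *\<^sub>v (toeplitz (d i) (fps_X ^ k) *\<^sub>v (c \<cdot>\<^sub>v x)) =
      c \<cdot>\<^sub>v (Pm B i *\<^sub>v (toeplitz (d i) (fps_X ^ k) *\<^sub>v x))" for k
      using c by (simp add: mult_mat_vec[OF toeplitz_carrier] mult_mat_vec[OF arrow_map_carrier(1)[OF i]])
    then show "c \<cdot>\<^sub>v x \<in> S i" using x i c is_subspaceD(4)[OF W(1)] by (auto simp: S_def)
  qed (use i in \<open>auto simp: S_def\<close>)
  have 2: "mult_z (d i) 1 *\<^sub>v x \<in> S i" if i: "i \<in> {1..n}" and x: "x \<in> S i" for i x
  proof -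
    have c: "x \<in> carrier_vec (d i)" using i x by (auto simp: S_def)
    have "toeplitz (d i) (fps_X ^ k) *\<^sub>v (toeplitz (d i) fps_X *\<^sub>v x) = toeplitz (d i) (fps_X ^ Suc k) *\<^sub>v x" for k
      using c by (subst assoc_mult_mat_vec[symmetric, of _ "d i" "d i" _ "d i"]) (auto simp: toeplitz_mult power_commutes)
    then show ?thesis using x i c unfolding mult_z_eq_toeplitz by (auto simp: S_def simp del: power_Suc)
  qed
  have 3: "Pm B i *\<^sub>v x \<in> S 0" if i: "i \<in> {1..n}" and x: "x \<in> S i" for i x
  proof -
    have c: "x \<in> carrier_vec (d i)" using i x by (auto simp: S_def)
    have "\<forall>k. Pm B i *\<^sub>v (toeplitz (d i) (fps_X ^ k) *\<^sub>v x) \<in> W" using i x by (auto simp: S_def)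
    from spec[OF this, of 0] show ?thesis using c by (simp add: S_def toeplitz_one)
  qed
  have 4: "Qm B i *\<^sub>v x \<in> S i" if i: "i \<in> {1..n}" and x: "x \<in> S 0" for i x
  proof -
    have c: "x \<in> carrier_vec 2" "x \<in> W" using x is_subspaceD(1)[OF W(1)] by (auto simp: S_def)
    have "Pm B i *\<^sub>v (toeplitz (d i) (fps_X ^ k) *\<^sub>v (Qm B i *\<^sub>v x)) \<in> W" for k
    proof (cases "k < d i")
      case True
      then show ?thesis using inv i c path_matrix_vec[OF i c(1)] by metis
    next
      case False
      have "toeplitz (d i) (fps_X ^ k) *\<^sub>v (Qm B i *\<^sub>v x) = 0\<^sub>v (d i)"
        by (rule eq_vecI) (use False i c toeplitz_X_power_mult_vec[OF Qm_vec_carrier[OF i c(1)]] in auto)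
      moreover have "Pm B i *\<^sub>v 0\<^sub>v (d i) = 0\<^sub>v 2"
        using arrow_map_carrier(1)[OF i, of B] by (intro eq_vecI) auto
      ultimately show ?thesis using is_subspaceD(2)[OF W(1)] by simp
    qed
    then show ?thesis using i c by (simp add: S_def)
  qed
  have "\<not> stable Q d v B"
    unfolding stable_def not_not
  proof (intro exI[of _ S] conjI ballI)
    fix i assume i: "i \<in> verts Q"
    show "is_subspace (v i * d i) (S i)"
      using 1[of i] i v1[of i] W by (cases "i = 0") (auto simp: S_def v0 d0)
    fix x assume "x \<in> S i"
    then show "mult_z (d i) (v i) *\<^sub>v x \<in> S i"
      using 2[of i x] i v1[of i] W is_subspaceD(1,2)[OF W(1)] by (cases "i = 0") (auto simp: S_def v0 d0 mult_z_1_2_vec)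
  next
    fix h x assume "h \<in> double_arcs Q" "x \<in> S (src Q h)"
    then show "arrow_map Q d v B h *\<^sub>v x \<in> S (tgt Q h)" using 3 4 by auto
  next
    show "\<exists>i\<in>verts Q. S i \<noteq> {0\<^sub>v (v i * d i)}" "\<exists>i\<in>verts Q. S i \<noteq> carrier_vec (v i * d i)"
      using W by (auto simp: S_def v0 d0 intro!: bexI[of _ 0])
  qed
  with assms show False by contradiction
qed

text \<open>A subrepresentation is zero or everything at the centre. \<open>unit\<close> makes
  \<open>q\<close> non-zero at \<open>z = 0\<close>, so a full centre generates every arm; it also
  makes \<open>p\<close> non-zero on the socle of \<open>R_d\<close>, so a zero centre leaves
  nothing on the arms.\<close>

lemma path_irreducible_imp_stable:
  assumes irr: "path_irreducible B"
    and unit: "\<And>i. i \<in> {1..n} \<Longrightarrow> fps_nth (pairing (qser d B i) (pser d B i)) 0 \<noteq> 0"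
  shows "stable Q d v B"
  unfolding stable_def
proof (intro notI, elim exE conjE)
  fix S
  assume S: "\<forall>i\<in>verts Q. is_subspace (v i * d i) (S i) \<and> (\<forall>x\<in>S i. mult_z (d i) (v i) *\<^sub>v x \<in> S i)"
    and arr: "\<forall>h\<in>double_arcs Q. \<forall>x\<in>S (src Q h). arrow_map Q d v B h *\<^sub>v x \<in> S (tgt Q h)"
    and ne: "\<exists>i\<in>verts Q. S i \<noteq> {0\<^sub>v (v i * d i)}" "\<exists>i\<in>verts Q. S i \<noteq> carrier_vec (v i * d i)"
  have S0: "is_subspace 2 (S 0)" using S[rule_format, of 0] by (auto simp: v0 d0)
  have Si: "is_subspace (d i) (S i)" "x \<in> S i \<Longrightarrow> mult_z (d i) 1 *\<^sub>v x \<in> S i" if "i \<in> {1..n}" for i x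
    using S[rule_format, of i] v1[OF that] that by auto
  have PS: "Pm B i *\<^sub>v x \<in> S 0" if "i \<in> {1..n}" "x \<in> S i" for i x
    using arr[rule_format, of "Inl i" x] that by auto
  have QS: "Qm B i *\<^sub>v x \<in> S i" if "i \<in> {1..n}" "x \<in> S 0" for i x
    using arr[rule_format, of "Inr i" x] that by auto
  have "(Pm B i * toeplitz (d i) (fps_X ^ k) * Qm B i) *\<^sub>v x \<in> S 0" if i: "i \<in> {1..n}" and x: "x \<in> S 0" for i k x
    unfolding path_matrix_vec[OF i is_subspaceD(1)[OF S0 x]]
    by (intro PS[OF i] mult_z_power_closed[OF Si(1)[OF i] Si(2)[OF i]] QS[OF i x])
  then have "S 0 = {0\<^sub>v 2} \<or> S 0 = carrier_vec 2"
    using irr S0 unfolding path_irreducible_def by blast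
  then show False
  proof
    assume full: "S 0 = carrier_vec 2"
    have "S i = carrier_vec (d i)" if i: "i \<in> {1..n}" for i
    proof -
      have di: "d i > 0" using i d_pos by simp
      \<comment> \<open>\<open>B (Inr i, 0, b)\<close> is the constant coefficient of
        \<open>qser\<close>; both cannot vanish, since \<open>q p\<close> is a unit.\<close>
      have "\<exists>b<2. B (Inr i, 0, b) \<noteq> 0"
      proof (rule ccontr)
        assume "\<not> (\<exists>b<2. B (Inr i, 0, b) \<noteq> 0)"
        then have "B (Inr i, 0, 0) = 0" "B (Inr i, 0, 1) = 0" by auto
        then show False using unit[OF i] di by (simp add: qser_def)
      qed
      then obtain b where b: "b < 2" "B (Inr i, 0, b) \<noteq> 0" by blast
      have w: "Qm B i *\<^sub>v unit_vec 2 b \<in> S i" using full b by (intro QS[OF i]) simp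
      have "(Qm B i *\<^sub>v unit_vec 2 b) $ 0 = (\<Sum>j<2. Qm B i $$ (0, j) * unit_vec 2 b $ j)"
        by (rule mult_mat_vec_index[OF arrow_map_carrier(2)[OF i]]) (use di in auto)
      also have "\<dots> = (\<Sum>j<2. if j = b then B (Inr i, 0, b) else 0)"
        by (rule sum.cong) (use b di arrow_map_index(2)[OF i _ di] in auto)
      also have "\<dots> \<noteq> 0" using b by simp
      finally show ?thesis by (intro submodule_full[OF Si(1)[OF i] Si(2)[OF i] w _ di]) auto
    qed
    then have "S i = carrier_vec (v i * d i)" if "i \<in> verts Q" for i
      using full that v1[of i] by (cases "i = 0") (auto simp: v0 d0)
    then show False using ne(2) by blast
  next
    assume zero: "S 0 = {0\<^sub>v 2}"
    have "S i = {0\<^sub>v (d i)}" if i: "i \<in> {1..n}" for i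
    proof (rule ccontr)
      have di: "d i > 0" using i d_pos by simp
      assume "S i \<noteq> {0\<^sub>v (d i)}"
      then obtain x where x: "x \<in> S i" "x \<noteq> 0\<^sub>v (d i)" using is_subspaceD(2)[OF Si(1)[OF i]] by blast
      have xc: "x \<in> carrier_vec (d i)" by (rule is_subspaceD(1)[OF Si(1)[OF i] x(1)])
      then have ex: "\<exists>k. k < d i \<and> x $ k \<noteq> 0" using x(2) by (auto simp: vec_eq_iff)
      define k where "k = (LEAST k. k < d i \<and> x $ k \<noteq> 0)"
      have k: "k < d i" "x $ k \<noteq> 0" using LeastI_ex[OF ex] by (auto simp: k_def)
      have small: "x $ j = 0" if "j < k" for j
        using not_less_Least[of j "\<lambda>k. k < d i \<and> x $ k \<noteq> 0"] that k(1) by (auto simp: k_def)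
      \<comment> \<open>This power of \<open>z\<close> moves the lowest non-zero coefficient of
        \<open>x\<close> to the socle, spanned by \<open>z^(d-1)\<close>, where the value of
        \<open>P\<close> is the constant coefficient of \<open>pser\<close>.\<close>
      define y where "y = toeplitz (d i) (fps_X ^ (d i - 1 - k)) *\<^sub>v x"
      have yS: "y \<in> S i" unfolding y_def by (rule mult_z_power_closed[OF Si(1)[OF i] Si(2)[OF i] x(1)])
      have yj: "y $ j = (if j = d i - 1 then x $ k else 0)" if "j < d i" for j
        unfolding y_def toeplitz_X_power_mult_vec[OF xc that] using that k small by auto
      have "B (Inl i, a, d i - 1) * x $ k = 0" if a: "a < 2" for a
      proof -
        have "(Pm B i *\<^sub>v y) $ a = (\<Sum>j<d i. Pm B i $$ (a, j) * y $ j)"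
          by (rule mult_mat_vec_index[OF arrow_map_carrier(1)[OF i] is_subspaceD(1)[OF Si(1)[OF i] yS] a])
        also have "\<dots> = (\<Sum>j<d i. if j = d i - 1 then B (Inl i, a, d i - 1) * x $ k else 0)"
          by (rule sum.cong) (use yj arrow_map_index(1)[OF i a] in auto)
        also have "\<dots> = B (Inl i, a, d i - 1) * x $ k" using di by simp
        finally show ?thesis using PS[OF i yS] zero a by auto
      qed
      then show False using unit[OF i] k di by (auto simp: pser_def)
    qed
    then have "S i = {0\<^sub>v (v i * d i)}" if "i \<in> verts Q" for i
      using zero that v1[of i] by (cases "i = 0") (auto simp: v0 d0)
    then show False using ne(1) by blast
  qed
qed

end

section \<open>The level sets in terms of power series\<close>

definition conn_ser :: "(nat \<Rightarrow> nat) \<Rightarrow> (conn_index \<Rightarrow> complex) \<Rightarrow> nat \<Rightarrow> nat \<Rightarrow> nat \<Rightarrow> complex fps" where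
  "conn_ser d A i a b = Abs_fps (\<lambda>m. if m < d i then A (i, d i - m, a, b) else 0)"

lemma finite_conn_coords: "finite (conn_coords n d)"
  unfolding conn_coords_def by (intro finite_SigmaI) auto

lemma conn_coords_iff:
  "(i, j, a, b) \<in> conn_coords n d \<longleftrightarrow> i \<in> {1..n} \<and> j \<in> {1..d i} \<and> a < 2 \<and> b < 2"
  by (auto simp: conn_coords_def)

locale star_connection = star_data +
  fixes lam xi eta :: "nat \<Rightarrow> complex fls" and t :: "nat \<Rightarrow> complex"
  assumes n_pos: "n \<ge> 1"
    and lam_tail: "i \<in> {0..n} \<Longrightarrow> lam i \<in> laurent_tails (d i)"
    and lam_lead: "i \<in> {1..n} \<Longrightarrow> fls_nth (lam i) (- int (d i)) \<noteq> 0"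
    and t_inj: "inj_on t {1..n}"
    and eta_tail: "i \<in> {1..n} \<Longrightarrow> eta i \<in> laurent_tails (d i)"
    and xi_eta: "i \<in> {1..n} \<Longrightarrow> xi i - eta i = lam i"
    and residue_eta: "(\<Sum>i = 1..n. fls_residue (eta i)) = fls_residue (lam 0)"
begin

lemma d_pos': "i \<in> {1..n} \<Longrightarrow> d i > 0"
  using d_pos by simp

definition lser :: "nat \<Rightarrow> complex fps" where
  "lser i = tail_ser (d i) (lam i)"

text \<open>The hypothesis on the top coefficient of \<open>lam i\<close> enters here: it makes
  \<open>lser i\<close> a unit, on which factorization, stability and the form of the fibres
  rest.\<close>

lemma lser_0: "i \<in> {1..n} \<Longrightarrow> fps_nth (lser i) 0 \<noteq> 0"
  using lam_lead[of i] d_pos'[of i] by (simp add: lser_def tail_ser_def)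

lemma tail_of_polar_lser: "i \<in> {1..n} \<Longrightarrow> xi i - eta i = tail_of (polar (d i) (lser i))"
  using lam_tail[of i] xi_eta[of i] by (simp add: lser_def tail_of_polar_tail_ser)

definition xser :: "(conn_index \<Rightarrow> complex) \<Rightarrow> nat \<Rightarrow> nat \<Rightarrow> nat \<Rightarrow> complex fps" where
  "xser A i a b = conn_ser d A i a b - (if a = b then tail_ser (d i) (eta i) else 0)"

lemma local_part_nth:
  assumes "a < 2" "b < 2"
  shows "fls_nth (local_part d A i $$ (a, b)) m = (if - int (d i) \<le> m \<and> m < 0 then A (i, nat (- m), a, b) else 0)"
proof -
  have "local_part d A i $$ (a, b) = (\<Sum>j = 1..d i. monomial (A (i, j, a, b)) (- int j))"
    using assms by (simp add: local_part_def coeff_mat_def)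
  then show ?thesis by (simp only: fls_nth_sum_monomial)
qed

lemma local_part_eq_conn_ser: "local_part d A i = mat2 (\<lambda>a b. tail_of (polar (d i) (conn_ser d A i a b)))"
proof (rule mat2_eqI)
  show "local_part d A i \<in> carrier_mat 2 2" by (simp add: local_part_def)
  fix a b :: nat assume ab: "a < 2" "b < 2"
  show "local_part d A i $$ (a, b) = tail_of (polar (d i) (conn_ser d A i a b))"
    by (rule fls_eqI) (auto simp: local_part_nth[OF ab] fls_nth_tail_of fls_nth_polar conn_ser_def nat_less_iff
        intro!: arg_cong[of _ _ A])
qed

lemma local_part_eq_shifted_tail:
  assumes "i \<in> {1..n}"
  shows "local_part d A i = shifted_tail (d i) (eta i) (xser A i)"
  unfolding local_part_eq_conn_ser shifted_tail_def mat2_eq_iff xser_def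
  using eta_tail[OF assms] by (auto simp: polar_diff tail_of_diff tail_of_polar_tail_ser)

lemma local_part_in_orbit_iff:
  assumes i: "i \<in> {1..n}"
  shows "local_part d A i \<in> coadjoint_orbit 2 (diag2 (xi i) (eta i)) \<longleftrightarrow>
    tcong (d i) (xser A i 0 0 + xser A i 1 1) (lser i) \<and>
    tcong (d i) (xser A i 0 0 * xser A i 1 1) (xser A i 0 1 * xser A i 1 0)"
  unfolding local_part_eq_shifted_tail[OF i]
  by (rule shifted_tail_coadjoint_orbit_iff)
    (use i lser_0 d_pos' tail_of_polar_lser tail_of_laurent_tail[OF eta_tail] in auto)

lemma moment_arm_iff:
  assumes i: "i \<in> {1..n}"
  shows "moment Q d v B i = (- lam i) \<cdot>\<^sub>m 1\<^sub>m (v i) \<longleftrightarrow>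
    tcong (d i) (pairing (qser d B i) (pser d B i)) (lser i)" (is "_ \<longleftrightarrow> tcong _ ?f _")
proof -
  have "moment Q d v B i = (- lam i) \<cdot>\<^sub>m 1\<^sub>m (v i) \<longleftrightarrow>
      (\<Sum>k=1..d i. monomial (- fps_nth ?f (d i - k)) (- int k)) = - lam i" (is "_ \<longleftrightarrow> ?s = _")
    unfolding moment_arm[OF i] v1[OF i] by (auto simp: mat_eq_iff)
  also have "\<dots> \<longleftrightarrow> (\<forall>m<d i. fps_nth ?f m = fps_nth (lser i) m)"
  proof
    assume *: "?s = - lam i"
    show "\<forall>m<d i. fps_nth ?f m = fps_nth (lser i) m"
    proof (intro allI impI)
      fix m assume m: "m < d i"
      have "fls_nth (- lam i) (int m - int (d i)) = - fps_nth ?f m"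
        unfolding *[symmetric] fls_nth_sum_monomial using m by (simp add: nat_diff_distrib')
      then have "fls_nth (lam i) (int m - int (d i)) = fps_nth ?f m"
        by (simp only: fls_uminus_nth neg_equal_iff_equal)
      moreover have "fps_nth (lser i) m = fls_nth (lam i) (int m - int (d i))"
        using m by (simp add: lser_def tail_ser_def)
      ultimately show "fps_nth ?f m = fps_nth (lser i) m" by (simp only:)
    qed
  next
    assume *: "\<forall>m<d i. fps_nth ?f m = fps_nth (lser i) m"
    show "?s = - lam i"
    proof (rule fls_eqI)
      fix k
      show "fls_nth ?s k = fls_nth (- lam i) k"
      proof (cases "- int (d i) \<le> k \<and> k < 0")
        case True
        then have "d i - nat (- k) < d i" "int (d i - nat (- k)) - int (d i) = k" by auto
        then show ?thesis
          unfolding fls_nth_sum_monomial using True * by (simp add: lser_def tail_ser_def)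
      next
        case False
        then have "fls_nth (lam i) k = 0" using lam_tail[of i] i by (auto simp: laurent_tails_def)
        with False show ?thesis unfolding fls_nth_sum_monomial by auto
      qed
    qed
  qed
  finally show ?thesis by (simp add: tcong_def)
qed

lemma moment_center_iff:
  "moment Q d v B 0 = (- lam 0) \<cdot>\<^sub>m 1\<^sub>m (v 0) \<longleftrightarrow>
    (\<forall>a<2. \<forall>b<2. (\<Sum>i=1..n. fps_nth (pser d B i a * qser d B i b) (d i - 1)) =
      (if a = b then - fls_residue (lam 0) else 0))"
proof -
  have lam0: "lam 0 = monomial (fls_residue (lam 0)) (- 1)"
    using lam_tail[of 0] by (intro fls_eqI) (auto simp: monomial_def laurent_tails_def d0 simp flip: eq_neg_iff_add_eq_0)
  have mono: "monomial c (- 1) = monomial c' (- 1) \<longleftrightarrow> c = c'" for c c'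
    by (auto simp: monomial_def fls_eq_iff dest: spec[of _ "-1"])
  have neg: "- monomial c (- 1) = monomial (- c) (- 1)" "0 = monomial 0 (- 1)" for c
    by (auto simp: monomial_def fls_eq_iff)
  have "moment Q d v B 0 = (- lam 0) \<cdot>\<^sub>m 1\<^sub>m (v 0) \<longleftrightarrow>
     (\<forall>a<2. \<forall>b<2. moment Q d v B 0 $$ (a, b) = (if a = b then - lam 0 else 0))"
    unfolding v0 by (auto simp: mat_eq_iff moment_def v0)
  also have "\<dots> \<longleftrightarrow> (\<forall>a<2. \<forall>b<2. monomial (\<Sum>i=1..n. fps_nth (pser d B i a * qser d B i b) (d i - 1)) (- 1) =
     monomial (if a = b then - fls_residue (lam 0) else 0) (- 1))"
    by (subst lam0) (auto simp: moment_center neg simp del: fls_residue_def)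
  finally show ?thesis unfolding mono .
qed

lemma quiver_level_iff:
  "B \<in> quiver_level Q d v lam \<longleftrightarrow> B \<in> extensional (quiver_coords Q d v) \<and> stable Q d v B \<and>
    (\<forall>i\<in>{1..n}. tcong (d i) (pairing (qser d B i) (pser d B i)) (lser i)) \<and>
    (\<forall>a<2. \<forall>b<2. (\<Sum>i=1..n. fps_nth (pser d B i a * qser d B i b) (d i - 1)) =
      (if a = b then - fls_residue (lam 0) else 0))"
proof -
  have "{0..n} = insert 0 {1..n}" by auto
  then show ?thesis
    unfolding quiver_level_def by (simp add: moment_arm_iff moment_center_iff del: fls_residue_def One_nat_def) blast
qed

end

section \<open>Holomorphic families of power series\<close>

text \<open>Only the constant coefficient is inverted, so each coefficient of the inverse is a
  rational function of those of \<open>f\<close>, holomorphic where the constant one is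
  non-zero.\<close>

lemma fps_inverse_nth_rec:
  fixes f :: "'a :: field fps"
  assumes "n > 0"
  shows "fps_nth (inverse f) n = - (inverse (fps_nth f 0) * (\<Sum>i<n. fps_nth (inverse f) i * fps_nth f (n - i)))"
proof (cases "fps_nth f 0 = 0")
  case False
  have "0 = fps_nth (inverse f * f) n"
    using False assms by (simp add: inverse_mult_eq_1)
  also have "\<dots> = (\<Sum>i\<le>n. fps_nth (inverse f) i * fps_nth f (n - i))"
    by (simp add: fps_mult_nth atLeast0AtMost)
  also have "{..n} = insert n {..<n}" by auto
  finally show ?thesis using False by (simp add: field_simps add_eq_0_iff)
qed (simp add: fps_inverse_eq_0)

lemma complex_differentiable_at_fps_mult:
  fixes x :: "'j \<Rightarrow> complex"
  assumes "finite J" "x \<in> extensional J"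
    and "\<And>m. complex_differentiable_at J (\<lambda>y. fps_nth (f y) m) x" "\<And>m. complex_differentiable_at J (\<lambda>y. fps_nth (g y) m) x"
  shows "complex_differentiable_at J (\<lambda>y. fps_nth (f y * g y) m) x"
  unfolding fps_mult_nth by (intro complex_differentiable_at_sum complex_differentiable_at_mult assms)

lemma complex_differentiable_at_fps_inverse:
  fixes x :: "'j \<Rightarrow> complex"
  assumes J: "finite J" "x \<in> extensional J"
    and f: "\<And>m. complex_differentiable_at J (\<lambda>y. fps_nth (f y) m) x" and f0: "fps_nth (f x) 0 \<noteq> 0"
  shows "complex_differentiable_at J (\<lambda>y. fps_nth (inverse (f y)) m) x"
proof (induction m rule: less_induct)
  case (less m)
  show ?case
  proof (cases "m = 0")
    case True
    then show ?thesis
      using complex_differentiable_at_inverse[OF J f[of 0] f0] by simp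
  next
    case False
    have "complex_differentiable_at J (\<lambda>y. (- 1) * (inverse (fps_nth (f y) 0) * (\<Sum>i<m. fps_nth (inverse (f y)) i * fps_nth (f y) (m - i)))) x"
      by (intro complex_differentiable_at_sum complex_differentiable_at_mult complex_differentiable_at_const
          complex_differentiable_at_inverse J f f0 less.IH) auto
    then show ?thesis using False by (subst fps_inverse_nth_rec) auto
  qed
qed

section \<open>From quiver representations to systems\<close>

text \<open>The witness is \<open>u = (q' G p) / \<lambda>\<close>.\<close>

lemma rank_one_fibre:
  fixes p q p' q' :: "nat \<Rightarrow> complex fps" and G H :: "nat \<Rightarrow> nat \<Rightarrow> complex"
  assumes d: "d > 0" and l0: "fps_nth l 0 \<noteq> 0"
    and l: "tcong d (pairing q p) l" and l': "tcong d (pairing q' p') l"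
    and GH: "mat2 G * mat2 H = 1\<^sub>m 2"
    and E: "\<And>a b. a < 2 \<Longrightarrow> b < 2 \<Longrightarrow> tcong d
      (p' a * ract q' G b)
      (lact G p a * q b)"
  obtains u where "fps_nth u 0 \<noteq> 0"
    "\<And>a. a < 2 \<Longrightarrow> tcong d (p' a * u) (lact G p a)"
    "\<And>b. b < 2 \<Longrightarrow> tcong d (ract q' G b) (u * q b)"
proof -
  define A where "A b = ract q' G b" for b
  define C where "C a = lact G p a" for a
  have E: "tcong d (p' a * A b) (C a * q b)" if "a < 2" "b < 2" for a b
    using E[OF that] by (simp add: A_def C_def)
  define s where "s = pairing A p"
  have s': "s = pairing q' C" by (simp add: s_def A_def C_def algebra_simps)
  define u where "u = inverse l * s"
  have inv: "inverse l * l = 1" using l0 by (rule inverse_mult_eq_1)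
  have u2: "tcong d (A b) (u * q b)" if b: "b < 2" for b
  proof (rule tcong_sym)
    \<comment> \<open>\<open>u q = q' (G p q) / l\<close> is congruent to
      \<open>(q' p') A / l = A\<close> by \<open>E\<close>.\<close>
    have "u * q b = inverse l * (q' 0 * (C 0 * q b) + q' 1 * (C 1 * q b))"
      by (simp add: u_def s' algebra_simps)
    also have "tcong d \<dots> (inverse l * (q' 0 * (p' 0 * A b) + q' 1 * (p' 1 * A b)))"
      using b by (intro tcong_mult tcong_add tcong_refl tcong_sym[OF E]) auto
    also have "inverse l * (q' 0 * (p' 0 * A b) + q' 1 * (p' 1 * A b)) = inverse l * ((pairing q' p') * A b)"
      by (simp add: algebra_simps)
    also have "tcong d \<dots> (inverse l * (l * A b))"
      by (intro tcong_mult tcong_refl l')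
    also have "inverse l * (l * A b) = A b" by (simp add: inv flip: mult.assoc)
    finally show "tcong d (u * q b) (A b)" .
  qed
  have u1: "tcong d (p' a * u) (C a)" if a: "a < 2" for a
  proof -
    have "p' a * u = inverse l * ((p' a * A 0) * p 0 + (p' a * A 1) * p 1)"
      by (simp add: u_def s_def algebra_simps)
    also have "tcong d \<dots> (inverse l * ((C a * q 0) * p 0 + (C a * q 1) * p 1))"
      using a by (intro tcong_mult tcong_add tcong_refl E) auto
    also have "inverse l * ((C a * q 0) * p 0 + (C a * q 1) * p 1) = inverse l * ((pairing q p) * C a)"
      by (simp add: algebra_simps)
    also have "tcong d \<dots> (inverse l * (l * C a))"
      by (intro tcong_mult tcong_refl l)
    also have "inverse l * (l * C a) = C a" by (simp add: inv flip: mult.assoc)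
    finally show ?thesis .
  qed
  \<comment> \<open>If \<open>u\<close> vanished at \<open>z = 0\<close>, so would
    \<open>q' G\<close> and, with \<open>G\<close> invertible, also \<open>q'\<close>, against
    \<open>q' p'\<close> being a unit.\<close>
  have "fps_nth u 0 \<noteq> 0"
  proof
    assume u0: "fps_nth u 0 = 0"
    define x0 x1 where "x0 = fps_nth (q' 0) 0" and "x1 = fps_nth (q' 1) 0"
    have z: "x0 * G 0 b + x1 * G 1 b = 0" if "b < 2" for b
      using tcong_nth_0[OF u2[OF that] d] u0 by (simp add: A_def x0_def x1_def)
    have gh: "G 0 0 * H 0 0 + G 0 1 * H 1 0 = 1" "G 0 0 * H 0 1 + G 0 1 * H 1 1 = 0"
      "G 1 0 * H 0 0 + G 1 1 * H 1 0 = 0" "G 1 0 * H 0 1 + G 1 1 * H 1 1 = 1"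
      using GH unfolding mat2_mult mat2_one mat2_eq_iff all_less_2 by auto
    have "x0 * (G 0 0 * H 0 b + G 0 1 * H 1 b) + x1 * (G 1 0 * H 0 b + G 1 1 * H 1 b) = 0" for b
    proof -
      have "x0 * (G 0 0 * H 0 b + G 0 1 * H 1 b) + x1 * (G 1 0 * H 0 b + G 1 1 * H 1 b) =
          (x0 * G 0 0 + x1 * G 1 0) * H 0 b + (x0 * G 0 1 + x1 * G 1 1) * H 1 b"
        by (simp add: algebra_simps)
      then show ?thesis using z[of 0] z[of 1] by simp
    qed
    from this[of 0] this[of 1] have "x0 = 0" "x1 = 0" using gh by auto
    then have "fps_nth (pairing q' p') 0 = 0" by (simp add: x0_def x1_def)
    then show False using tcong_nth_0[OF l' d] l0 by simp
  qed
  with u1 u2 show thesis by (intro that) (auto simp: A_def C_def)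
qed

lemma sum_less_2: "(\<Sum>k<(2::nat). f k) = f 0 + f 1"
  by (simp add: eval_nat_numeral)

section \<open>The map to systems and its image\<close>

context star_connection
begin

definition conn :: "(nat quiver_index \<Rightarrow> complex) \<Rightarrow> conn_index \<Rightarrow> complex" where
  "conn B = restrict (\<lambda>(i, j, a, b). (if a = b then fls_nth (eta i) (- int j) else 0) +
    fps_nth (pser d B i a * qser d B i b) (d i - j)) (conn_coords n d)"

lemma conn_index:
  assumes "i \<in> {1..n}" "j \<in> {1..d i}" "a < 2" "b < 2"
  shows "conn B (i, j, a, b) = (if a = b then fls_nth (eta i) (- int j) else 0) +
    fps_nth (pser d B i a * qser d B i b) (d i - j)"
  using assms by (simp add: conn_def conn_coords_iff)

lemma xser_nth:
  assumes "m < d i"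
  shows "fps_nth (xser A i a b) m = A (i, d i - m, a, b) - (if a = b then fls_nth (eta i) (int m - int (d i)) else 0)"
  using assms by (auto simp: xser_def conn_ser_def tail_ser_def)

lemma xser_eq_iff:
  "tcong (d i) (xser A i a b) f \<longleftrightarrow>
    (\<forall>j\<in>{1..d i}. A (i, j, a, b) = (if a = b then fls_nth (eta i) (- int j) else 0) + fps_nth f (d i - j))"
    (is "?L \<longleftrightarrow> ?R")
proof
  assume L: ?L
  show ?R
  proof
    fix j assume j: "j \<in> {1..d i}"
    then have "fps_nth (xser A i a b) (d i - j) = fps_nth f (d i - j)"
      using L by (simp add: tcong_def)
    then show "A (i, j, a, b) = (if a = b then fls_nth (eta i) (- int j) else 0) + fps_nth f (d i - j)"
      using j by (subst (asm) xser_nth) (auto simp: of_nat_diff algebra_simps split: if_splits)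
  qed
next
  assume R: ?R
  show ?L unfolding tcong_def
  proof (intro allI impI)
    fix m assume m: "m < d i"
    then have "d i - m \<in> {1..d i}" "- int (d i - m) = int m - int (d i)" "d i - (d i - m) = m" by auto
    with R m show "fps_nth (xser A i a b) m = fps_nth f m" by (simp add: xser_nth)
  qed
qed

lemma xser_conn:
  assumes "i \<in> {1..n}" "a < 2" "b < 2"
  shows "tcong (d i) (xser (conn B) i a b) (pser d B i a * qser d B i b)"
  unfolding xser_eq_iff using conn_index assms by blast

lemma conn_eq_iff:
  assumes "A \<in> extensional (conn_coords n d)"
  shows "conn B = A \<longleftrightarrow> (\<forall>i\<in>{1..n}. \<forall>a<2. \<forall>b<2. tcong (d i) (xser A i a b) (pser d B i a * qser d B i b))"
    (is "?L \<longleftrightarrow> ?R")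
proof
  show ?R if ?L using that xser_conn by blast
  assume R: ?R
  show ?L
  proof (rule extensionalityI[of _ "conn_coords n d"])
    show "conn B \<in> extensional (conn_coords n d)" by (simp add: conn_def)
    fix k assume "k \<in> conn_coords n d"
    then obtain i j a b where k: "k = (i, j, a, b)" "i \<in> {1..n}" "j \<in> {1..d i}" "a < 2" "b < 2"
      by (auto simp: conn_coords_def)
    then show "conn B k = A k" using R unfolding xser_eq_iff by (simp add: conn_index)
  qed (rule assms)
qed

lemma carrier_mat_eq_iff:
  assumes "X \<in> carrier_mat r s" "Y \<in> carrier_mat r s"
  shows "X = Y \<longleftrightarrow> (\<forall>i<r. \<forall>j<s. X $$ (i, j) = Y $$ (i, j))"
  using assms by (auto intro!: eq_matI)

lemma smult_one_add_index:
  assumes "M \<in> carrier_mat r r" "a < r" "b < r"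
  shows "(c \<cdot>\<^sub>m 1\<^sub>m r + M) $$ (a, b) = (if a = b then c else 0) + (M $$ (a, b) :: 'a :: comm_ring_1)"
  using assms by auto

lemma coeff_mat_conn:
  assumes "i \<in> {1..n}" "j \<in> {1..d i}"
  shows "coeff_mat (conn B) i j = fls_nth (eta i) (- int j) \<cdot>\<^sub>m 1\<^sub>m 2 +
    Pm B i * toeplitz (d i) (fps_X ^ (j - 1)) * Qm B i"
proof (rule eq_matI)
  fix a b assume "a < dim_row (fls_nth (eta i) (- int j) \<cdot>\<^sub>m 1\<^sub>m 2 + Pm B i * toeplitz (d i) (fps_X ^ (j - 1)) * Qm B i)"
    "b < dim_col (fls_nth (eta i) (- int j) \<cdot>\<^sub>m 1\<^sub>m 2 + Pm B i * toeplitz (d i) (fps_X ^ (j - 1)) * Qm B i)"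
  then have ab: "a < 2" "b < 2"
    using path_matrix_carrier[OF assms(1), of B "fps_X ^ (j - 1)"] by auto
  then show "coeff_mat (conn B) i j $$ (a, b) = (fls_nth (eta i) (- int j) \<cdot>\<^sub>m 1\<^sub>m 2 +
    Pm B i * toeplitz (d i) (fps_X ^ (j - 1)) * Qm B i) $$ (a, b)"
    using path_matrix_index[OF assms(1) ab, of j B] assms
    unfolding smult_one_add_index[OF path_matrix_carrier[OF assms(1)] ab]
    by (simp add: coeff_mat_def conn_index)
qed (use path_matrix_carrier[OF assms(1), of B "fps_X ^ (j - 1)"] in \<open>auto simp: coeff_mat_def\<close>)

text \<open>The coefficients of \<open>conn B\<close> differ from the path matrices by scalars,
  which preserve every subspace.\<close>

lemma irreducible_conn_iff: "irreducible_system n d (conn B) \<longleftrightarrow> path_irreducible B"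
proof -
  have "(\<forall>i\<in>{1..n}. \<forall>j\<in>{1..d i}. \<forall>x\<in>S. coeff_mat (conn B) i j *\<^sub>v x \<in> S) \<longleftrightarrow>
     (\<forall>i\<in>{1..n}. \<forall>k<d i. \<forall>x\<in>S. (Pm B i * toeplitz (d i) (fps_X ^ k) * Qm B i) *\<^sub>v x \<in> S)" (is "?L \<longleftrightarrow> ?R")
    if S: "is_subspace 2 S" for S
  proof -
    have vec: "coeff_mat (conn B) i j *\<^sub>v x = fls_nth (eta i) (- int j) \<cdot>\<^sub>v x +
        (Pm B i * toeplitz (d i) (fps_X ^ (j - 1)) * Qm B i) *\<^sub>v x"
      if "i \<in> {1..n}" "j \<in> {1..d i}" "x \<in> S" for i j x
    proof -
      have x: "x \<in> carrier_vec 2" using is_subspaceD(1)[OF S that(3)] .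
      have "(fls_nth (eta i) (- int j) \<cdot>\<^sub>m 1\<^sub>m 2) *\<^sub>v x = fls_nth (eta i) (- int j) \<cdot>\<^sub>v x"
        using x by (intro eq_vecI) auto
      then show ?thesis
        unfolding coeff_mat_conn[OF that(1,2)]
        by (subst add_mult_distrib_mat_vec[OF _ path_matrix_carrier[OF that(1)] x]) auto
    qed
    have cancel: "c \<cdot>\<^sub>v x + y + (- c) \<cdot>\<^sub>v x = y" if "x \<in> carrier_vec 2" "y \<in> carrier_vec 2" for c :: complex and x y
      using that by (intro eq_vecI) auto
    show ?thesis
    proof
      assume L: ?L
      show ?R
      proof (intro ballI allI impI)
        fix i k x assume *: "i \<in> {1..n}" "k < d i" "x \<in> S"
        then have k: "Suc k \<in> {1..d i}" by auto
        let ?y = "(Pm B i * toeplitz (d i) (fps_X ^ k) * Qm B i) *\<^sub>v x"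
        have x: "x \<in> carrier_vec 2" using is_subspaceD(1)[OF S *(3)] .
        have y: "?y \<in> carrier_vec 2" by (rule mult_mat_vec_carrier[OF path_matrix_carrier[OF *(1)] x])
        have "coeff_mat (conn B) i (Suc k) *\<^sub>v x \<in> S" using L * k by blast
        then have "coeff_mat (conn B) i (Suc k) *\<^sub>v x + (- fls_nth (eta i) (- int (Suc k))) \<cdot>\<^sub>v x \<in> S"
          by (intro is_subspaceD(3)[OF S] is_subspaceD(4)[OF S] *)
        moreover have "coeff_mat (conn B) i (Suc k) *\<^sub>v x + (- fls_nth (eta i) (- int (Suc k))) \<cdot>\<^sub>v x = ?y"
          unfolding vec[OF *(1) k *(3)] diff_Suc_1 by (rule cancel[OF x y])
        ultimately show "?y \<in> S" by simp
      qed
    next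
      assume R: ?R
      show ?L
      proof (intro ballI)
        fix i j x assume *: "i \<in> {1..n}" "j \<in> {1..d i}" "x \<in> S"
        then have "j - 1 < d i" by auto
        then show "coeff_mat (conn B) i j *\<^sub>v x \<in> S"
          unfolding vec[OF *] using R * by (intro is_subspaceD(3)[OF S] is_subspaceD(4)[OF S]) auto
      qed
    qed
  qed
  then show ?thesis unfolding irreducible_system_def path_irreducible_def by blast
qed

text \<open>A description without the points \<open>t i\<close>, shown later to be the level set of
  both connection spaces: the orbit conditions become trace and determinant, the residue sums become
  sums of coefficients.\<close>

definition conn_level :: "(conn_index \<Rightarrow> complex) set" where
  "conn_level = {A \<in> extensional (conn_coords n d).
    (\<forall>i\<in>{1..n}. tcong (d i) (xser A i 0 0 + xser A i 1 1) (lser i) \<and>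
      tcong (d i) (xser A i 0 0 * xser A i 1 1) (xser A i 0 1 * xser A i 1 0)) \<and>
    irreducible_system n d A \<and> (\<forall>a<2. \<forall>b<2. (\<Sum>i=1..n. A (i, 1, a, b)) = 0)}"

text \<open>The hypothesis relating the residues of \<open>eta\<close> to that of
  \<open>lam 0\<close> enters here; it makes the moment equation at the centre the vanishing of the
  residue sum.\<close>

lemma sum_residues_conn:
  assumes "a < 2" "b < 2"
  shows "(\<Sum>i=1..n. conn B (i, 1, a, b)) = (if a = b then fls_residue (lam 0) else 0) +
    (\<Sum>i=1..n. fps_nth (pser d B i a * qser d B i b) (d i - 1))"
proof -
  have "(\<Sum>i=1..n. conn B (i, 1, a, b)) =
     (\<Sum>i=1..n. (if a = b then fls_residue (eta i) else 0) + fps_nth (pser d B i a * qser d B i b) (d i - 1))"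
  proof (rule sum.cong)
    fix i assume i: "i \<in> {1..n}"
    then show "conn B (i, 1, a, b) = (if a = b then fls_residue (eta i) else 0) + fps_nth (pser d B i a * qser d B i b) (d i - 1)"
      using conn_index[OF i, of 1 a b B] d_pos'[OF i] assms by simp
  qed simp
  then show ?thesis
    using residue_eta by (simp add: sum.distrib del: fls_residue_def split: if_splits)
qed

lemma conn_in_level:
  assumes B: "B \<in> quiver_level Q d v lam"
  shows "conn B \<in> conn_level"
proof -
  have ext: "conn B \<in> extensional (conn_coords n d)" by (simp add: conn_def)
  have irr: "irreducible_system n d (conn B)"
    using B stable_imp_path_irreducible by (simp add: irreducible_conn_iff quiver_level_iff)
  have "tcong (d i) (xser (conn B) i 0 0 + xser (conn B) i 1 1) (lser i)" if i: "i \<in> {1..n}" for i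
  proof -
    have "tcong (d i) (xser (conn B) i 0 0 + xser (conn B) i 1 1) (pairing (pser d B i) (qser d B i))"
      by (intro tcong_add xser_conn i) auto
    also have "pairing (pser d B i) (qser d B i) = pairing (qser d B i) (pser d B i)"
      by (simp add: mult.commute)
    also have "tcong (d i) \<dots> (lser i)" using B i by (simp add: quiver_level_iff)
    finally show ?thesis .
  qed
  moreover have "tcong (d i) (xser (conn B) i 0 0 * xser (conn B) i 1 1) (xser (conn B) i 0 1 * xser (conn B) i 1 0)" if i: "i \<in> {1..n}" for i
  proof -
    have "tcong (d i) (xser (conn B) i 0 0 * xser (conn B) i 1 1) ((pser d B i 0 * qser d B i 0) * (pser d B i 1 * qser d B i 1))"
      by (intro tcong_mult xser_conn i) auto
    also have "(pser d B i 0 * qser d B i 0) * (pser d B i 1 * qser d B i 1) = (pser d B i 0 * qser d B i 1) * (pser d B i 1 * qser d B i 0)"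
      by (simp add: algebra_simps)
    also have "tcong (d i) \<dots> (xser (conn B) i 0 1 * xser (conn B) i 1 0)"
      by (rule tcong_sym) (intro tcong_mult xser_conn i; simp)
    finally show ?thesis .
  qed
  moreover have "(\<Sum>i=1..n. conn B (i, 1, a, b)) = 0" if "a < 2" "b < 2" for a b
    unfolding sum_residues_conn[OF that] using B that by (simp add: quiver_level_iff del: fls_residue_def)
  ultimately show ?thesis using ext irr unfolding conn_level_def by blast
qed

subsection \<open>Orbit relations\<close>

definition quiver_equivalent :: "(nat quiver_index \<Rightarrow> complex) \<Rightarrow> (nat quiver_index \<Rightarrow> complex) \<Rightarrow> bool" where
  "quiver_equivalent B C \<longleftrightarrow> (\<exists>g. (\<forall>i\<in>verts Q. g i \<in> aut_group (d i) (v i)) \<and>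
    (\<forall>h\<in>double_arcs Q. arrow_map Q d v C h = g (tgt Q h) * arrow_map Q d v B h * mat_inv (g (src Q h))))"

definition conn_equivalent :: "(conn_index \<Rightarrow> complex) \<Rightarrow> (conn_index \<Rightarrow> complex) \<Rightarrow> bool" where
  "conn_equivalent A C \<longleftrightarrow> (\<exists>g\<in>general_linear 2. \<forall>i\<in>{1..n}. \<forall>j\<in>{1..d i}.
    coeff_mat C i j = g * coeff_mat A i j * mat_inv g)"

lemma general_linear_2E:
  assumes "g \<in> general_linear 2"
  obtains G H where "g = mat2 G" "mat_inv g = mat2 H" "mat2 G * mat2 H = 1\<^sub>m 2" "mat2 H * mat2 G = 1\<^sub>m 2"
proof -
  from assms obtain h where h: "g \<in> carrier_mat 2 2" "h \<in> carrier_mat 2 2" "g * h = 1\<^sub>m 2" "h * g = 1\<^sub>m 2" "mat_inv g = h"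
    by (rule general_linearE)
  show thesis
    by (rule that[of "\<lambda>a b. g $$ (a, b)" "\<lambda>a b. h $$ (a, b)"])
      (simp_all add: h flip: mat2_eta[OF h(1)] mat2_eta[OF h(2)])
qed

lemma general_linear_2I:
  assumes "mat2 G * mat2 H = 1\<^sub>m 2" "mat2 H * mat2 G = 1\<^sub>m 2"
  shows "mat2 G \<in> general_linear 2" "mat_inv (mat2 G) = mat2 H"
  by (rule general_linearI[OF _ _ assms] mat_inv_eqI[OF _ _ assms]; simp)+

lemma coeff_mat_eq_mat2: "coeff_mat A i j = mat2 (\<lambda>a b. A (i, j, a, b))"
  by (rule mat2_eqI) (auto simp: coeff_mat_def)

text \<open>Clearing the inverse leaves relations linear in each of the two systems, which can be
  compared coefficient by coefficient.\<close>

lemma conn_equivalent_iff: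
  "conn_equivalent A C \<longleftrightarrow> (\<exists>G H. mat2 G * mat2 H = 1\<^sub>m 2 \<and> mat2 H * mat2 G = 1\<^sub>m 2 \<and>
    (\<forall>i\<in>{1..n}. \<forall>j\<in>{1..d i}. coeff_mat C i j * mat2 G = mat2 G * coeff_mat A i j))"
proof -
  have eq: "coeff_mat C i j = mat2 G * coeff_mat A i j * mat2 H \<longleftrightarrow> coeff_mat C i j * mat2 G = mat2 G * coeff_mat A i j"
    if "mat2 G * mat2 H = 1\<^sub>m 2" "mat2 H * mat2 G = 1\<^sub>m 2" for G H i j
    by (rule eq_mult_inverse_iff) (auto simp: that coeff_mat_eq_mat2 intro: mult_carrier_mat)
  show ?thesis
  proof
    assume "conn_equivalent A C"
    then obtain g where g: "g \<in> general_linear 2" "\<forall>i\<in>{1..n}. \<forall>j\<in>{1..d i}. coeff_mat C i j = g * coeff_mat A i j * mat_inv g"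
      unfolding conn_equivalent_def by blast
    from g(1) obtain G H where GH: "g = mat2 G" "mat_inv g = mat2 H" "mat2 G * mat2 H = 1\<^sub>m 2" "mat2 H * mat2 G = 1\<^sub>m 2"
      by (rule general_linear_2E)
    with g(2) eq[OF GH(3,4)] show "\<exists>G H. mat2 G * mat2 H = 1\<^sub>m 2 \<and> mat2 H * mat2 G = 1\<^sub>m 2 \<and>
      (\<forall>i\<in>{1..n}. \<forall>j\<in>{1..d i}. coeff_mat C i j * mat2 G = mat2 G * coeff_mat A i j)"
      by (intro exI[of _ G] exI[of _ H]) (simp only: simp_thms)
  next
    assume "\<exists>G H. mat2 G * mat2 H = 1\<^sub>m 2 \<and> mat2 H * mat2 G = 1\<^sub>m 2 \<and>
      (\<forall>i\<in>{1..n}. \<forall>j\<in>{1..d i}. coeff_mat C i j * mat2 G = mat2 G * coeff_mat A i j)"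
    then obtain G H where GH: "mat2 G * mat2 H = 1\<^sub>m 2" "mat2 H * mat2 G = 1\<^sub>m 2"
      "\<forall>i\<in>{1..n}. \<forall>j\<in>{1..d i}. coeff_mat C i j * mat2 G = mat2 G * coeff_mat A i j" by blast
    then show "conn_equivalent A C"
      unfolding conn_equivalent_def using general_linear_2I[OF GH(1,2)] eq[OF GH(1,2)]
      by (intro bexI[of _ "mat2 G"]) simp_all
  qed
qed

text \<open>Scalars commute with \<open>G\<close>, so intertwining the coefficients of two systems
  amounts to intertwining them with \<open>eta i\<close> subtracted, and these are the matrices that
  factor.\<close>

lemma intertwines_iff:
  "(\<forall>j\<in>{1..d i}. coeff_mat C i j * mat2 G = mat2 G * coeff_mat A i j) \<longleftrightarrow>
    (\<forall>a<2. \<forall>b<2. tcong (d i) (ract (xser C i a) G b)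
      (fps_const (G a 0) * xser A i 0 b + fps_const (G a 1) * xser A i 1 b))" (is "?L \<longleftrightarrow> ?R")
proof -
  have "?L \<longleftrightarrow> (\<forall>a<2. \<forall>b<2. \<forall>j\<in>{1..d i}. C (i, j, a, 0) * G 0 b + C (i, j, a, 1) * G 1 b =
      G a 0 * A (i, j, 0, b) + G a 1 * A (i, j, 1, b))"
    unfolding coeff_mat_eq_mat2 mat2_mult mat2_eq_iff by blast
  also have "\<dots> \<longleftrightarrow> ?R"
  proof (intro iff_allI imp_cong refl)
    fix a b :: nat assume ab: "a < 2" "b < 2"
    have x: "fps_nth (ract (xser C i a) G b) m =
       fps_nth (fps_const (G a 0) * xser A i 0 b + fps_const (G a 1) * xser A i 1 b) m \<longleftrightarrow>
       C (i, d i - m, a, 0) * G 0 b + C (i, d i - m, a, 1) * G 1 b = G a 0 * A (i, d i - m, 0, b) + G a 1 * A (i, d i - m, 1, b)"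
      if "m < d i" for m
      using ab that by (auto simp: less_2_cases_iff xser_nth algebra_simps)
    have "(\<forall>j\<in>{1..d i}. P j) \<longleftrightarrow> (\<forall>m<d i. P (d i - m))" for P
    proof
      assume *: "\<forall>m<d i. P (d i - m)"
      show "\<forall>j\<in>{1..d i}. P j"
      proof
        fix j assume "j \<in> {1..d i}"
        then show "P j" using *[rule_format, of "d i - j"] by auto
      qed
    qed auto
    then show "(\<forall>j\<in>{1..d i}. C (i, j, a, 0) * G 0 b + C (i, j, a, 1) * G 1 b =
      G a 0 * A (i, j, 0, b) + G a 1 * A (i, j, 1, b)) \<longleftrightarrow>
      tcong (d i) (ract (xser C i a) G b)
      (fps_const (G a 0) * xser A i 0 b + fps_const (G a 1) * xser A i 1 b)"
      unfolding tcong_def using x by simp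
  qed
  finally show ?thesis .
qed

text \<open>With the inverses cleared, the two arrows of an arm transform by
  \<open>P' u = G P\<close> and \<open>Q' G = u Q\<close>; read as series, these are the
  congruences.\<close>

lemma quiver_arrows_iff:
  assumes i: "i \<in> {1..n}" and GH: "mat2 G * mat2 H = 1\<^sub>m 2" "mat2 H * mat2 G = 1\<^sub>m 2" and u: "fps_nth u 0 \<noteq> 0"
  shows "Pm C i = mat2 G * Pm B i * mat_inv (toeplitz (d i) u) \<longleftrightarrow>
      (\<forall>a<2. tcong (d i) (pser d C i a * u) (lact G (pser d B i) a))"
    and "Qm C i = toeplitz (d i) u * Qm B i * mat_inv (mat2 G) \<longleftrightarrow>
      (\<forall>b<2. tcong (d i) (ract (qser d C i) G b) (u * qser d B i b))"
proof -
  note T = toeplitz_inverse[OF u, of "d i"]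
  have invT: "mat_inv (toeplitz (d i) u) = toeplitz (d i) (inverse u)" by (rule mat_inv_eqI[OF _ _ T]) auto
  have cP: "mat2 G * Pm B i \<in> carrier_mat 2 (d i)" "Pm C i * toeplitz (d i) u \<in> carrier_mat 2 (d i)"
    using i by (auto intro!: mult_carrier_mat)
  have cQ: "toeplitz (d i) u * Qm B i \<in> carrier_mat (d i) 2" "Qm C i * mat2 G \<in> carrier_mat (d i) 2"
    using i by (auto intro!: mult_carrier_mat)
  have GP: "(mat2 G * Pm B i) $$ (a, k) = fps_nth (lact G (pser d B i) a) (d i - 1 - k)"
    if "a < 2" "k < d i" for a k
    using that by (subst mat_mult_index[of _ 2 2 _ "d i"]) (auto simp: sum_less_2 arrow_map_index[OF i] arrow_map_carrier[OF i] pser_def)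
  have QG: "(Qm C i * mat2 G) $$ (k, b) = fps_nth (ract (qser d C i) G b) k"
    if "b < 2" "k < d i" for b k
    using that by (subst mat_mult_index[of _ "d i" 2 _ 2]) (auto simp: sum_less_2 arrow_map_index[OF i] arrow_map_carrier[OF i] qser_def)
  have "Pm C i = mat2 G * Pm B i * mat_inv (toeplitz (d i) u) \<longleftrightarrow> Pm C i * toeplitz (d i) u = mat2 G * Pm B i"
    unfolding invT by (rule eq_mult_inverse_iff[OF _ cP(1) _ _ T]) (use i in auto)
  also have "\<dots> \<longleftrightarrow> (\<forall>a<2. \<forall>k<d i. fps_nth (pser d C i a * u) (d i - 1 - k) =
      fps_nth (lact G (pser d B i) a) (d i - 1 - k))"
    unfolding carrier_mat_eq_iff[OF cP(2,1)]
    by (intro iff_allI imp_cong refl) (simp only: GP pser_toeplitz[OF i])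
  also have "\<dots> \<longleftrightarrow> (\<forall>a<2. \<forall>m<d i. fps_nth (pser d C i a * u) m =
      fps_nth (lact G (pser d B i) a) m)"
  proof -
    have "(\<forall>k<d i. P (d i - 1 - k)) \<longleftrightarrow> (\<forall>m<d i. P m)" for P
    proof
      assume *: "\<forall>k<d i. P (d i - 1 - k)"
      show "\<forall>m<d i. P m"
      proof (intro allI impI)
        fix m assume "m < d i"
        then show "P m" using *[rule_format, of "d i - 1 - m"] by auto
      qed
    qed auto
    from this[of "\<lambda>k. fps_nth (pser d C i a * u) k =
      fps_nth (lact G (pser d B i) a) k" for a]
    show ?thesis by (simp only:)
  qed
  finally show "Pm C i = mat2 G * Pm B i * mat_inv (toeplitz (d i) u) \<longleftrightarrow>
      (\<forall>a<2. tcong (d i) (pser d C i a * u) (lact G (pser d B i) a))"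
    by (simp only: tcong_def)
  have "Qm C i = toeplitz (d i) u * Qm B i * mat_inv (mat2 G) \<longleftrightarrow> Qm C i * mat2 G = toeplitz (d i) u * Qm B i"
    unfolding general_linear_2I(2)[OF GH] by (rule eq_mult_inverse_iff[OF _ cQ(1) _ _ GH]) (use i in auto)
  also have "\<dots> \<longleftrightarrow> (\<forall>b<2. \<forall>k<d i. fps_nth (ract (qser d C i) G b) k = fps_nth (u * qser d B i b) k)"
    unfolding carrier_mat_eq_iff[OF cQ(2,1)]
  proof -
    have "(\<forall>k<d i. \<forall>b<2. (Qm C i * mat2 G) $$ (k, b) = (toeplitz (d i) u * Qm B i) $$ (k, b)) \<longleftrightarrow>
        (\<forall>k<d i. \<forall>b<2. fps_nth (ract (qser d C i) G b) k = fps_nth (u * qser d B i b) k)"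
      by (intro iff_allI imp_cong refl) (simp only: QG toeplitz_qser[OF i])
    then show "(\<forall>k<d i. \<forall>b<2. (Qm C i * mat2 G) $$ (k, b) = (toeplitz (d i) u * Qm B i) $$ (k, b)) \<longleftrightarrow>
        (\<forall>b<2. \<forall>k<d i. fps_nth (ract (qser d C i) G b) k = fps_nth (u * qser d B i b) k)"
      by blast
  qed
  finally show "Qm C i = toeplitz (d i) u * Qm B i * mat_inv (mat2 G) \<longleftrightarrow>
      (\<forall>b<2. tcong (d i) (ract (qser d C i) G b) (u * qser d B i b))"
    by (simp only: tcong_def)
qed

text \<open>With multiplicity one at the centre and rank one on the arms, the gauge group is
  \<open>GL(2)\<close> times the units of the rings \<open>R_d\<close>. Once \<open>G\<close> is
  fixed the arms decouple, so a unit may be sought for each arm separately.\<close>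

lemma quiver_equivalent_iff:
  "quiver_equivalent B C \<longleftrightarrow> (\<exists>G H. mat2 G * mat2 H = 1\<^sub>m 2 \<and> mat2 H * mat2 G = 1\<^sub>m 2 \<and>
    (\<forall>i\<in>{1..n}. \<exists>u. fps_nth u 0 \<noteq> 0 \<and>
      (\<forall>a<2. tcong (d i) (pser d C i a * u) (lact G (pser d B i) a)) \<and>
      (\<forall>b<2. tcong (d i) (ract (qser d C i) G b) (u * qser d B i b))))"
    (is "?L \<longleftrightarrow> (\<exists>G H. ?R G H)")
proof
  assume ?L
  then obtain g where g0: "\<forall>i\<in>verts Q. g i \<in> aut_group (d i) (v i)"
    and arr0: "\<forall>h\<in>double_arcs Q. arrow_map Q d v C h = g (tgt Q h) * arrow_map Q d v B h * mat_inv (g (src Q h))"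
    unfolding quiver_equivalent_def by blast
  have g: "g i \<in> aut_group (d i) (v i)" if "i \<in> {0..n}" for i using g0 that by simp
  note arr = bspec[OF arr0]
  have "g 0 \<in> general_linear 2" using g[of 0] by (simp add: d0 v0 aut_group_1[simplified])
  then obtain G H where GH: "g 0 = mat2 G" "mat2 G * mat2 H = 1\<^sub>m 2" "mat2 H * mat2 G = 1\<^sub>m 2"
    by (rule general_linear_2E)
  have "\<exists>u. fps_nth u 0 \<noteq> 0 \<and>
      (\<forall>a<2. tcong (d i) (pser d C i a * u) (lact G (pser d B i) a)) \<and>
      (\<forall>b<2. tcong (d i) (ract (qser d C i) G b) (u * qser d B i b))"
    if i: "i \<in> {1..n}" for i
  proof -
    have "g i \<in> aut_group (d i) 1" using g[of i] i v1[OF i] by simp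
    then obtain u where u: "g i = toeplitz (d i) u" "fps_nth u 0 \<noteq> 0"
      using aut_group_rank_one[OF d_pos'[OF i]] by auto
    show ?thesis
    proof (intro exI[of _ u] conjI u(2))
      have "Inl i \<in> double_arcs Q" "Inr i \<in> double_arcs Q" using i by auto
      from arr[OF this(1)] arr[OF this(2)]
      have "Pm C i = mat2 G * Pm B i * mat_inv (toeplitz (d i) u)" "Qm C i = toeplitz (d i) u * Qm B i * mat_inv (mat2 G)"
        by (simp_all only: star_simps GH(1) u(1))
      then show "\<forall>a<2. tcong (d i) (pser d C i a * u) (lact G (pser d B i) a)"
        "\<forall>b<2. tcong (d i) (ract (qser d C i) G b) (u * qser d B i b)"
        using quiver_arrows_iff[OF i GH(2,3) u(2)] by blast+
    qed
  qed
  with GH(2,3) show "\<exists>G H. ?R G H" by blast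
next
  assume "\<exists>G H. ?R G H"
  then obtain G H where GH: "mat2 G * mat2 H = 1\<^sub>m 2" "mat2 H * mat2 G = 1\<^sub>m 2"
    and ex: "\<forall>i\<in>{1..n}. \<exists>u. fps_nth u 0 \<noteq> 0 \<and>
      (\<forall>a<2. tcong (d i) (pser d C i a * u) (lact G (pser d B i) a)) \<and>
      (\<forall>b<2. tcong (d i) (ract (qser d C i) G b) (u * qser d B i b))" by blast
  from bchoice[OF ex] obtain u where u: "\<And>i. i \<in> {1..n} \<Longrightarrow> fps_nth (u i) 0 \<noteq> 0"
    and pq: "\<And>i. i \<in> {1..n} \<Longrightarrow> \<forall>a<2. tcong (d i) (pser d C i a * u i) (lact G (pser d B i) a)"
      "\<And>i. i \<in> {1..n} \<Longrightarrow> \<forall>b<2. tcong (d i) (ract (qser d C i) G b) (u i * qser d B i b)"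
    by blast
  define g where "g i = (if i = 0 then mat2 G else toeplitz (d i) (u i))" for i
  show ?L unfolding quiver_equivalent_def
  proof (intro exI[of _ g] conjI ballI)
    fix i assume "i \<in> verts Q"
    then show "g i \<in> aut_group (d i) (v i)"
      using general_linear_2I(1)[OF GH] v1[of i] u[of i] aut_group_rank_one[OF d_pos'[of i]]
      by (cases "i = 0") (auto simp: g_def d0 v0 aut_group_1[simplified])
  next
    fix h assume "h \<in> double_arcs Q"
    then obtain i where i: "i \<in> {1..n}" "h = Inl i \<or> h = Inr i" by auto
    then show "arrow_map Q d v C h = g (tgt Q h) * arrow_map Q d v B h * mat_inv (g (src Q h))"
      using quiver_arrows_iff[OF i(1) GH u[OF i(1)]] pq[OF i(1)] by (auto simp: g_def)
  qed
qed

text \<open>The same \<open>G\<close> serves on both sides, and the unit on an arm is eliminated: it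
  cancels in \<open>p q\<close>, and conversely \<open>rank_one_fibre\<close> recovers it from the
  intertwining relation.\<close>

lemma quiver_equivalent_iff_conn_equivalent:
  assumes B: "B \<in> quiver_level Q d v lam" and C: "C \<in> quiver_level Q d v lam"
  shows "quiver_equivalent B C \<longleftrightarrow> conn_equivalent (conn B) (conn C)"
proof -
  have lB: "tcong (d i) (pairing (qser d B i) (pser d B i)) (lser i)"
    and lC: "tcong (d i) (pairing (qser d C i) (pser d C i)) (lser i)" if "i \<in> {1..n}" for i
    using B C that by (auto simp: quiver_level_iff)
  have key: "(\<exists>u. fps_nth u 0 \<noteq> 0 \<and>
      (\<forall>a<2. tcong (d i) (pser d C i a * u) (lact G (pser d B i) a)) \<and>
      (\<forall>b<2. tcong (d i) (ract (qser d C i) G b) (u * qser d B i b))) \<longleftrightarrow>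
     (\<forall>j\<in>{1..d i}. coeff_mat (conn C) i j * mat2 G = mat2 G * coeff_mat (conn B) i j)" (is "?L \<longleftrightarrow> _")
    if i: "i \<in> {1..n}" and GH: "mat2 G * mat2 H = 1\<^sub>m 2" for i G H
  proof -
    have l: "tcong (d i) (ract (xser (conn C) i a) G b)
       (pser d C i a * ract (qser d C i) G b)"
      and r: "tcong (d i) (fps_const (G a 0) * xser (conn B) i 0 b + fps_const (G a 1) * xser (conn B) i 1 b)
       (lact G (pser d B i) a * qser d B i b)" if ab: "a < 2" "b < 2" for a b
    proof -
      have "tcong (d i) (ract (xser (conn C) i a) G b)
         ((pser d C i a * qser d C i 0) * fps_const (G 0 b) + (pser d C i a * qser d C i 1) * fps_const (G 1 b))"
        using ab by (intro tcong_add tcong_mult tcong_refl xser_conn i) auto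
      then show "tcong (d i) (ract (xser (conn C) i a) G b)
         (pser d C i a * ract (qser d C i) G b)"
        by (simp only: distrib_left mult.assoc)
      have "tcong (d i) (fps_const (G a 0) * xser (conn B) i 0 b + fps_const (G a 1) * xser (conn B) i 1 b)
         (fps_const (G a 0) * (pser d B i 0 * qser d B i b) + fps_const (G a 1) * (pser d B i 1 * qser d B i b))"
        using ab by (intro tcong_add tcong_mult tcong_refl xser_conn i) auto
      then show "tcong (d i) (fps_const (G a 0) * xser (conn B) i 0 b + fps_const (G a 1) * xser (conn B) i 1 b)
         (lact G (pser d B i) a * qser d B i b)"
        by (simp only: distrib_right mult.assoc)
    qed
    have mid: "(\<forall>j\<in>{1..d i}. coeff_mat (conn C) i j * mat2 G = mat2 G * coeff_mat (conn B) i j) \<longleftrightarrow>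
      (\<forall>a<2. \<forall>b<2. tcong (d i) (pser d C i a * ract (qser d C i) G b)
        (lact G (pser d B i) a * qser d B i b))" (is "_ \<longleftrightarrow> ?M")
      unfolding intertwines_iff using l r by (meson tcong_sym tcong_trans)
    have "?L \<longleftrightarrow> ?M"
    proof
      assume ?L
      then obtain u where u: "\<And>a. a < 2 \<Longrightarrow> tcong (d i) (pser d C i a * u) (lact G (pser d B i) a)"
        "\<And>b. b < 2 \<Longrightarrow> tcong (d i) (ract (qser d C i) G b) (u * qser d B i b)" by blast
      show ?M
      proof (intro allI impI)
        fix a b :: nat assume ab: "a < 2" "b < 2"
        have "tcong (d i) (pser d C i a * ract (qser d C i) G b)
          (pser d C i a * (u * qser d B i b))"
          by (intro tcong_mult tcong_refl u ab)
        also have "pser d C i a * (u * qser d B i b) = (pser d C i a * u) * qser d B i b" by (simp only: mult.assoc)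
        also have "tcong (d i) \<dots> (lact G (pser d B i) a * qser d B i b)"
          by (intro tcong_mult tcong_refl u ab)
        finally show "tcong (d i) (pser d C i a * ract (qser d C i) G b)
          (lact G (pser d B i) a * qser d B i b)" .
      qed
    next
      assume M: ?M
      show ?L
        by (rule rank_one_fibre[OF d_pos'[OF i] lser_0[OF i] lB[OF i] lC[OF i] GH M[rule_format]]) blast+
    qed
    with mid show ?thesis by (simp only:)
  qed
  show ?thesis
    unfolding quiver_equivalent_iff conn_equivalent_iff
    by (intro ex_cong1 conj_cong refl ball_cong) (erule (1) key)
qed

subsection \<open>Local sections\<close>

text \<open>\<open>c i\<close> records which diagonal entry is inverted on arm \<open>i\<close>, and
  the index \<open>d i - 1 - q\<close> undoes the reversal in \<open>pser\<close>. Where that entry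
  is not a unit the formula is only a default value.\<close>

definition section_of :: "(nat \<Rightarrow> nat) \<Rightarrow> (conn_index \<Rightarrow> complex) \<Rightarrow> nat quiver_index \<Rightarrow> complex" where
  "section_of c A = restrict (\<lambda>(h, p, q). case h of
      Inl i \<Rightarrow> fps_nth (xser A i p (c i)) (d i - 1 - q)
    | Inr i \<Rightarrow> fps_nth (xser A i (c i) q * inverse (xser A i (c i) (c i))) p) (quiver_coords Q d v)"

lemma pser_section_of:
  assumes "i \<in> {1..n}" "a < 2"
  shows "tcong (d i) (pser d (section_of c A) i a) (xser A i a (c i))"
  unfolding tcong_def
proof (intro allI impI)
  fix m assume m: "m < d i"
  then have "d i - 1 - m < d i" "d i - 1 - (d i - 1 - m) = m" by auto
  with m assms show "fps_nth (pser d (section_of c A) i a) m = fps_nth (xser A i a (c i)) m"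
    by (simp add: pser_def section_of_def quiver_coords_star)
qed

lemma qser_section_of:
  assumes "i \<in> {1..n}" "b < 2"
  shows "tcong (d i) (qser d (section_of c A) i b) (xser A i (c i) b * inverse (xser A i (c i) (c i)))"
  using assms by (auto simp: tcong_def qser_def section_of_def quiver_coords_star)

text \<open>The rank-one factorization gives back \<open>A\<close>. Its trace and residue conditions
  become the moment equations on the arms and at the centre, and irreducibility gives stability
  because \<open>q p\<close> is a unit.\<close>

lemma section_of_in_level:
  assumes A: "A \<in> conn_level"
    and c: "\<And>i. i \<in> {1..n} \<Longrightarrow> c i < 2" "\<And>i. i \<in> {1..n} \<Longrightarrow> fps_nth (xser A i (c i) (c i)) 0 \<noteq> 0"
  shows "section_of c A \<in> quiver_level Q d v lam" and "conn (section_of c A) = A"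
proof -
  let ?B = "section_of c A"
  have ext: "?B \<in> extensional (quiver_coords Q d v)" by (simp add: section_of_def)
  have Aext: "A \<in> extensional (conn_coords n d)" using A by (simp add: conn_level_def)
  have pq: "tcong (d i) (xser A i a b) (pser d ?B i a * qser d ?B i b)" if i: "i \<in> {1..n}" and ab: "a < 2" "b < 2" for i a b
  proof -
    have "tcong (d i) (xser A i a b) (xser A i a (c i) * (xser A i (c i) b * inverse (xser A i (c i) (c i))))"
      using A i by (intro rank_one_factorization[where X = "xser A i", OF c(1)[OF i] c(2)[OF i] _ ab]) (simp add: conn_level_def)
    also have "tcong (d i) \<dots> (pser d ?B i a * qser d ?B i b)"
      by (intro tcong_mult tcong_sym[OF pser_section_of] tcong_sym[OF qser_section_of] i ab)
    finally show ?thesis .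
  qed
  then show F: "conn ?B = A" unfolding conn_eq_iff[OF Aext] by blast
  have qp: "tcong (d i) (pairing (qser d ?B i) (pser d ?B i)) (lser i)" if i: "i \<in> {1..n}" for i
  proof -
    have "pairing (qser d ?B i) (pser d ?B i) = pairing (pser d ?B i) (qser d ?B i)"
      by (simp add: mult.commute)
    also have "tcong (d i) \<dots> (xser A i 0 0 + xser A i 1 1)"
      by (intro tcong_add tcong_sym[OF pq] i) auto
    also have "tcong (d i) \<dots> (lser i)" using A i by (simp add: conn_level_def)
    finally show ?thesis .
  qed
  have "path_irreducible ?B"
    using A unfolding irreducible_conn_iff[symmetric] F by (simp add: conn_level_def)
  then have "stable Q d v ?B"
    by (rule path_irreducible_imp_stable) (metis tcong_nth_0 qp d_pos' lser_0)
  moreover have "(\<Sum>i=1..n. fps_nth (pser d ?B i a * qser d ?B i b) (d i - 1)) = (if a = b then - fls_residue (lam 0) else 0)"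
    if ab: "a < 2" "b < 2" for a b
  proof -
    have "(\<Sum>i=1..n. A (i, 1, a, b)) = 0" using A ab unfolding conn_level_def by blast
    then show ?thesis
      using sum_residues_conn[OF ab, of ?B] unfolding F by (simp add: add_eq_0_iff2 del: fls_residue_def split: if_splits)
  qed
  ultimately show "?B \<in> quiver_level Q d v lam"
    unfolding quiver_level_iff using ext qp by blast
qed

lemma exists_unit_diagonal:
  assumes A: "A \<in> conn_level" and i: "i \<in> {1..n}"
  shows "\<exists>c<2. fps_nth (xser A i c c) 0 \<noteq> 0"
proof (rule ccontr)
  assume "\<not> ?thesis"
  then have "fps_nth (xser A i 0 0 + xser A i 1 1) 0 = 0" by simp
  moreover have "tcong (d i) (xser A i 0 0 + xser A i 1 1) (lser i)" using A i by (simp add: conn_level_def)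
  ultimately show False using lser_0[OF i] tcong_nth_0[OF _ d_pos'[OF i]] by metis
qed

lemma complex_differentiable_at_xser:
  assumes x: "x \<in> extensional (conn_coords n d)" and "i \<in> {1..n}" "a < 2" "b < 2"
  shows "complex_differentiable_at (conn_coords n d) (\<lambda>A. fps_nth (xser A i a b) m) x"
proof (cases "m < d i")
  case True
  then have "(i, d i - m, a, b) \<in> conn_coords n d" using assms by (auto simp: conn_coords_iff)
  then show ?thesis
    unfolding xser_nth[OF True]
    by (intro complex_differentiable_at_diff complex_differentiable_at_coordinate complex_differentiable_at_const finite_conn_coords x)
next
  case False
  then have "(\<lambda>A. fps_nth (xser A i a b) m) = (\<lambda>A. 0)" by (auto simp: xser_def conn_ser_def tail_ser_def)
  then show ?thesis by (simp add: complex_differentiable_at_const)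
qed

lemma complex_differentiable_at_section_of:
  assumes x: "x \<in> extensional (conn_coords n d)" and k: "k \<in> quiver_coords Q d v"
    and c: "\<And>i. i \<in> {1..n} \<Longrightarrow> c i < 2" "\<And>i. i \<in> {1..n} \<Longrightarrow> fps_nth (xser x i (c i) (c i)) 0 \<noteq> 0"
  shows "complex_differentiable_at (conn_coords n d) (\<lambda>A. section_of c A k) x"
proof -
  obtain h p q where hpq: "k = (h, p, q)" by (cases k)
  show ?thesis
  proof (cases h)
    case (Inl i)
    then have i: "i \<in> {1..n}" "p < 2" "q < d i" using k hpq by (auto simp: quiver_coords_star)
    have "complex_differentiable_at (conn_coords n d) (\<lambda>A. fps_nth (xser A i p (c i)) (d i - 1 - q)) x"
      by (intro complex_differentiable_at_xser x i c)
    then show ?thesis using k by (simp add: section_of_def hpq Inl)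
  next
    case (Inr i)
    then have i: "i \<in> {1..n}" "p < d i" "q < 2" using k hpq by (auto simp: quiver_coords_star)
    have "complex_differentiable_at (conn_coords n d) (\<lambda>A. fps_nth (xser A i (c i) q * inverse (xser A i (c i) (c i))) p) x"
      by (intro complex_differentiable_at_fps_mult complex_differentiable_at_fps_inverse complex_differentiable_at_xser
          finite_conn_coords x i c)
    then show ?thesis using k by (simp add: section_of_def hpq Inr)
  qed
qed

lemma complex_differentiable_at_conn:
  assumes x: "x \<in> extensional (quiver_coords Q d v)" and k: "k \<in> conn_coords n d"
  shows "complex_differentiable_at (quiver_coords Q d v) (\<lambda>B. conn B k) x"
proof -
  obtain i j a b where ijab: "k = (i, j, a, b)" "i \<in> {1..n}" "j \<in> {1..d i}" "a < 2" "b < 2"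
    using k by (auto simp: conn_coords_def)
  have p: "complex_differentiable_at (quiver_coords Q d v) (\<lambda>B. fps_nth (pser d B i a) m) x" for m
  proof (cases "m < d i")
    case True
    then have "(Inl i, a, d i - 1 - m) \<in> quiver_coords Q d v" using ijab by (auto simp: quiver_coords_star)
    with True show ?thesis
      by (simp add: pser_def complex_differentiable_at_coordinate finite_quiver_coords)
  qed (simp add: pser_def complex_differentiable_at_const)
  have q: "complex_differentiable_at (quiver_coords Q d v) (\<lambda>B. fps_nth (qser d B i b) m) x" for m
  proof (cases "m < d i")
    case True
    then have "(Inr i, m, b) \<in> quiver_coords Q d v" using ijab by (auto simp: quiver_coords_star)
    with True show ?thesis
      by (simp add: qser_def complex_differentiable_at_coordinate finite_quiver_coords)
  qed (simp add: qser_def complex_differentiable_at_const)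
  show ?thesis
    unfolding ijab(1) conn_index[OF ijab(2-5)]
    by (intro complex_differentiable_at_add complex_differentiable_at_fps_mult complex_differentiable_at_const
        finite_quiver_coords x p q)
qed

abbreviation unit_domain :: "(nat \<Rightarrow> nat) \<Rightarrow> (conn_index \<Rightarrow> complex) set" where
  "unit_domain c \<equiv> {A \<in> extensional (conn_coords n d). \<forall>i\<in>{1..n}. fps_nth (xser A i (c i) (c i)) 0 \<noteq> 0}"

lemma openin_unit_diagonal:
  assumes c: "\<And>i. i \<in> {1..n} \<Longrightarrow> c i < 2"
  shows "openin (affine_top (conn_coords n d))
    (unit_domain c)"
proof -
  have "openin (affine_top (conn_coords n d)) {A \<in> topspace (affine_top (conn_coords n d)). fps_nth (xser A i (c i) (c i)) 0 \<in> - {0}}"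
    if i: "i \<in> {1..n}" for i
  proof (rule openin_continuous_map_preimage[of _ euclidean])
    have "(i, d i, c i, c i) \<in> conn_coords n d" using i c[OF i] d_pos'[OF i] by (simp add: conn_coords_iff Suc_le_eq)
    then have "continuous_map (affine_top (conn_coords n d)) euclidean (\<lambda>A. A (i, d i, c i, c i))"
      unfolding affine_top_def by (rule continuous_map_product_projection)
    then have "continuous_map (affine_top (conn_coords n d)) euclidean (\<lambda>A. A (i, d i, c i, c i) - fls_nth (eta i) (- int (d i)))"
      by (intro continuous_map_diff) auto
    then show "continuous_map (affine_top (conn_coords n d)) euclidean (\<lambda>A. fps_nth (xser A i (c i) (c i)) 0)"
      using d_pos'[OF i] by (simp add: xser_nth)
  qed auto
  then have "openin (affine_top (conn_coords n d)) ((\<Inter>i\<in>{1..n}. {A \<in> topspace (affine_top (conn_coords n d)). fps_nth (xser A i (c i) (c i)) 0 \<in> - {0}}) \<inter> topspace (affine_top (conn_coords n d)))"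
    by (intro openin_INT) auto
  also have "(\<Inter>i\<in>{1..n}. {A \<in> topspace (affine_top (conn_coords n d)). fps_nth (xser A i (c i) (c i)) 0 \<in> - {0}}) \<inter> topspace (affine_top (conn_coords n d)) =
     (unit_domain c)"
    by auto
  finally show ?thesis .
qed

section \<open>Orbit relations as equivalences, and the quotient morphism\<close>

lemma conn_equivalent_refl: "conn_equivalent A A"
  unfolding conn_equivalent_iff
  by (intro exI[of _ "\<lambda>a b. if a = b then 1 else 0"])
    (simp add: coeff_mat_eq_mat2 right_mult_one_mat[OF mat2_carrier] left_mult_one_mat[OF mat2_carrier] flip: mat2_one)

lemma conn_equivalent_sym: "conn_equivalent A C \<Longrightarrow> conn_equivalent C A"
proof -
  assume "conn_equivalent A C"
  then obtain G H where GH: "mat2 G * mat2 H = 1\<^sub>m 2" "mat2 H * mat2 G = 1\<^sub>m 2"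
    "\<And>i j. i \<in> {1..n} \<Longrightarrow> j \<in> {1..d i} \<Longrightarrow> coeff_mat C i j * mat2 G = mat2 G * coeff_mat A i j"
    unfolding conn_equivalent_iff by blast
  have "coeff_mat A i j * mat2 H = mat2 H * coeff_mat C i j" if "i \<in> {1..n}" "j \<in> {1..d i}" for i j
  proof -
    define a c where "a = coeff_mat A i j" and "c = coeff_mat C i j"
    have [simp]: "a \<in> carrier_mat 2 2" "c \<in> carrier_mat 2 2" by (simp_all add: a_def c_def coeff_mat_eq_mat2)
    have "a * mat2 H = (mat2 H * mat2 G) * (a * mat2 H)" unfolding GH by (simp add: left_mult_one_mat[of _ 2 2] mult_carrier_mat[of _ 2 2 _ 2])
    also have "\<dots> = mat2 H * ((mat2 G * a) * mat2 H)"
      by (simp add: assoc_mult_mat[of _ 2 2 _ 2 _ 2] mult_carrier_mat[of _ 2 2 _ 2])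
    also have "mat2 G * a = c * mat2 G" using GH(3)[OF that] by (simp add: a_def c_def)
    also have "mat2 H * ((c * mat2 G) * mat2 H) = mat2 H * (c * (mat2 G * mat2 H))"
      by (simp add: assoc_mult_mat[of _ 2 2 _ 2 _ 2] mult_carrier_mat[of _ 2 2 _ 2])
    finally show ?thesis unfolding GH by (simp add: right_mult_one_mat[of _ 2 2] a_def c_def coeff_mat_eq_mat2)
  qed
  with GH(1,2) show "conn_equivalent C A" unfolding conn_equivalent_iff by blast
qed

lemma conn_equivalent_trans:
  assumes "conn_equivalent A C" "conn_equivalent C D"
  shows "conn_equivalent A D"
proof -
  obtain G H where GH: "mat2 G * mat2 H = 1\<^sub>m 2" "mat2 H * mat2 G = 1\<^sub>m 2"
    "\<And>i j. i \<in> {1..n} \<Longrightarrow> j \<in> {1..d i} \<Longrightarrow> coeff_mat C i j * mat2 G = mat2 G * coeff_mat A i j"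
    using assms(1) unfolding conn_equivalent_iff by blast
  obtain G' H' where GH': "mat2 G' * mat2 H' = 1\<^sub>m 2" "mat2 H' * mat2 G' = 1\<^sub>m 2"
    "\<And>i j. i \<in> {1..n} \<Longrightarrow> j \<in> {1..d i} \<Longrightarrow> coeff_mat D i j * mat2 G' = mat2 G' * coeff_mat C i j"
    using assms(2) unfolding conn_equivalent_iff by blast
  note assoc = assoc_mult_mat[of _ 2 2 _ 2 _ 2] mult_carrier_mat[of _ 2 2 _ 2]
  define K where "K a b = G' a 0 * G 0 b + G' a 1 * G 1 b" for a b
  define L where "L a b = H a 0 * H' 0 b + H a 1 * H' 1 b" for a b
  have K: "mat2 K = mat2 G' * mat2 G" and L: "mat2 L = mat2 H * mat2 H'"
    unfolding K_def[abs_def] L_def[abs_def] mat2_mult by simp_all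
  have "mat2 K * mat2 L = mat2 G' * ((mat2 G * mat2 H) * mat2 H')" unfolding K L by (simp add: assoc)
  then have KL: "mat2 K * mat2 L = 1\<^sub>m 2" unfolding GH by (simp add: left_mult_one_mat[of _ 2 2] GH')
  have "mat2 L * mat2 K = mat2 H * ((mat2 H' * mat2 G') * mat2 G)" unfolding K L by (simp add: assoc)
  then have LK: "mat2 L * mat2 K = 1\<^sub>m 2" unfolding GH' by (simp add: left_mult_one_mat[of _ 2 2] GH)
  have "coeff_mat D i j * mat2 K = mat2 K * coeff_mat A i j" if "i \<in> {1..n}" "j \<in> {1..d i}" for i j
  proof -
    define a c e where "a = coeff_mat A i j" and "c = coeff_mat C i j" and "e = coeff_mat D i j"
    have [simp]: "a \<in> carrier_mat 2 2" "c \<in> carrier_mat 2 2" "e \<in> carrier_mat 2 2" by (simp_all add: a_def c_def e_def coeff_mat_eq_mat2)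
    have "e * mat2 K = (e * mat2 G') * mat2 G" unfolding K by (simp add: assoc)
    also have "e * mat2 G' = mat2 G' * c" using GH'(3)[OF that] by (simp add: e_def c_def)
    also have "mat2 G' * c * mat2 G = mat2 G' * (c * mat2 G)" by (simp add: assoc)
    also have "c * mat2 G = mat2 G * a" using GH(3)[OF that] by (simp add: a_def c_def)
    also have "mat2 G' * (mat2 G * a) = mat2 K * a" unfolding K by (simp add: assoc)
    finally show ?thesis by (simp add: a_def e_def)
  qed
  with KL LK show ?thesis unfolding conn_equivalent_iff by blast
qed

definition "quiver_quot = quiver_variety Q d lam v"
definition "conn_quot = connection_quotient n d conn_level"

lemma quiver_quot_simps: "coords quiver_quot = quiver_coords Q d v" "level quiver_quot = quiver_level Q d v lam"
  "(B, C) \<in> orbit_rel quiver_quot \<longleftrightarrow> B \<in> quiver_level Q d v lam \<and> C \<in> quiver_level Q d v lam \<and> quiver_equivalent B C"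
  "two_form quiver_quot = (\<lambda>B. quiver_form Q d v)"
  by (simp_all add: quiver_quot_def quiver_variety_def quiver_equivalent_def)

lemma conn_quot_simps: "coords conn_quot = conn_coords n d" "level conn_quot = conn_level"
  "(A, C) \<in> orbit_rel conn_quot \<longleftrightarrow> A \<in> conn_level \<and> C \<in> conn_level \<and> conn_equivalent A C"
  "two_form conn_quot = (\<lambda>A u w. \<Sum>i = 1..n. kks_form 2 (local_part d A i) (local_part d u i) (local_part d w i))"
  by (simp_all add: conn_quot_def connection_quotient_def conn_equivalent_def)

lemma quotient_morphism_conn: "quotient_morphism quiver_quot conn_quot conn"
proof
  show "finite (coords quiver_quot)" "finite (coords conn_quot)"
    by (simp_all add: quiver_quot_simps conn_quot_simps finite_quiver_coords finite_conn_coords)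
  show "level quiver_quot \<subseteq> extensional (coords quiver_quot)" "level conn_quot \<subseteq> extensional (coords conn_quot)"
    by (auto simp: quiver_quot_simps conn_quot_simps quiver_level_iff conn_level_def)
  \<comment> \<open>Reflexivity, symmetry and transitivity are transported from systems, through the
    equivalence of the two relations on the level set.\<close>
  show "equiv (level quiver_quot) (orbit_rel quiver_quot)"
    unfolding equiv_def refl_on_def sym_def trans_def
    by (auto simp: quiver_quot_simps quiver_equivalent_iff_conn_equivalent
        intro: conn_equivalent_refl conn_equivalent_sym conn_equivalent_trans)
  show "equiv (level conn_quot) (orbit_rel conn_quot)"
    unfolding equiv_def refl_on_def sym_def trans_def
    by (auto simp: conn_quot_simps intro: conn_equivalent_refl conn_equivalent_sym conn_equivalent_trans)
  show "conn x \<in> extensional (coords conn_quot)" for x by (simp add: conn_quot_simps conn_def)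
  show "conn x \<in> level conn_quot" if "x \<in> level quiver_quot" for x using that conn_in_level by (simp add: quiver_quot_simps conn_quot_simps)
  show "complex_differentiable_at (coords quiver_quot) (\<lambda>x. conn x k) x" if "k \<in> coords conn_quot" "x \<in> extensional (coords quiver_quot)" for k x
    using that complex_differentiable_at_conn by (simp add: quiver_quot_simps conn_quot_simps)
  show "(x, x') \<in> orbit_rel quiver_quot \<longleftrightarrow> (conn x, conn x') \<in> orbit_rel conn_quot" if "x \<in> level quiver_quot" "x' \<in> level quiver_quot" for x x'
    using that by (simp add: quiver_quot_simps conn_quot_simps quiver_equivalent_iff_conn_equivalent conn_in_level)
  fix y assume "y \<in> level conn_quot"
  then have y: "y \<in> conn_level" "y \<in> extensional (conn_coords n d)" by (auto simp: conn_quot_simps conn_level_def)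
  \<comment> \<open>Diagonal entries that are units at \<open>y\<close> remain units on the open set
    \<open>unit_domain c\<close>, so one section serves there.\<close>
  have "\<forall>i\<in>{1..n}. \<exists>c. c < 2 \<and> fps_nth (xser y i c c) 0 \<noteq> 0" using exists_unit_diagonal[OF y(1)] by blast
  from bchoice[OF this] obtain c where c: "\<And>i. i \<in> {1..n} \<Longrightarrow> c i < 2" "\<And>i. i \<in> {1..n} \<Longrightarrow> fps_nth (xser y i (c i) (c i)) 0 \<noteq> 0"
    by blast
  show "\<exists>W G. openin (affine_top (coords conn_quot)) W \<and> y \<in> W \<and> (\<forall>z. G z \<in> extensional (coords quiver_quot)) \<and>
      (\<forall>j\<in>coords quiver_quot. \<forall>z\<in>W. complex_differentiable_at (coords conn_quot) (\<lambda>z. G z j) z) \<and>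
      (\<forall>z\<in>W \<inter> level conn_quot. G z \<in> level quiver_quot \<and> conn (G z) = z)"
    unfolding quiver_quot_simps conn_quot_simps
  proof (intro exI[of _ "unit_domain c"]
      exI[of _ "section_of c"] conjI ballI allI)
    show "openin (affine_top (conn_coords n d)) (unit_domain c)"
      by (rule openin_unit_diagonal[OF c(1)])
    show "y \<in> (unit_domain c)"
      using y c by simp
    show "section_of c z \<in> extensional (quiver_coords Q d v)" for z by (simp add: section_of_def)
    show "complex_differentiable_at (conn_coords n d) (\<lambda>z. section_of c z j) z"
      if "j \<in> quiver_coords Q d v" "z \<in> (unit_domain c)" for j z
      using that by (intro complex_differentiable_at_section_of c(1)) auto
    show "section_of c z \<in> quiver_level Q d v lam" "conn (section_of c z) = z"
      if "z \<in> (unit_domain c) \<inter> conn_level" for z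
      using that by (intro section_of_in_level c(1); auto)+
  qed
qed

end

section \<open>Poles of the systems\<close>

lemma residue_sum:
  assumes "finite I" "open s" "z \<in> s" "\<And>i. i \<in> I \<Longrightarrow> f i holomorphic_on s - {z}"
  shows "residue (\<lambda>w. \<Sum>i\<in>I. f i w) z = (\<Sum>i\<in>I. residue (f i) z)"
  using assms(1,4)
proof (induction I rule: finite_induct)
  case empty
  then show ?case using residue_holo[OF assms(2,3), of "\<lambda>_. 0"] by simp
next
  case (insert i I)
  have "residue (\<lambda>w. f i w + (\<Sum>i\<in>I. f i w)) z = residue (f i) z + residue (\<lambda>w. \<Sum>i\<in>I. f i w) z"
    by (rule residue_add[OF assms(2,3)]) (auto intro!: holomorphic_on_sum insert)
  then show ?case using insert by simp
qed

context star_connection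
begin

lemma system_entry_eq:
  assumes "a < 2" "b < 2"
  shows "system_entry n d t A a b z = (\<Sum>(k, j)\<in>Sigma {1..n} (\<lambda>k. {1..d k}). A (k, j, a, b) / (z - t k) ^ j)"
  using assms unfolding system_entry_def by (subst sum.Sigma[symmetric]) (auto simp: coeff_mat_eq_mat2)

lemma sum_delta_index:
  assumes "i \<in> {1..n}" "j0 \<in> {1..d i}"
  shows "(\<Sum>(k, j)\<in>Sigma {1..n} (\<lambda>k. {1..d k}). if k = i \<and> j = j0 then F k j else 0) = F i j0"
proof -
  have "(\<Sum>(k, j)\<in>Sigma {1..n} (\<lambda>k. {1..d k}). if k = i \<and> j = j0 then F k j else 0) =
      (\<Sum>p\<in>Sigma {1..n} (\<lambda>k. {1..d k}). if p = (i, j0) then F i j0 else 0)"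
    by (rule sum.cong) (auto split: if_splits)
  also have "\<dots> = F i j0" using assms by (subst sum.delta) auto
  finally show ?thesis .
qed

lemma residue_system_entry:
  assumes i: "i \<in> {1..n}" and ab: "a < 2" "b < 2"
  shows "residue (system_entry n d t A a b) (t i) = A (i, 1, a, b)"
proof -
  \<comment> \<open>The complement of the other poles, on which every summand is holomorphic away
    from \<open>t i\<close>; distinctness of the points puts \<open>t i\<close> inside.\<close>
  define s where "s = UNIV - t ` ({1..n} - {i})"
  have s: "open s" "t i \<in> s"
  proof -
    show "open s" unfolding s_def by (rule open_Diff[OF open_UNIV finite_imp_closed]) simp
    show "t i \<in> s" using inj_on_image_mem_iff[OF t_inj i, of "{1..n} - {i}"] by (auto simp: s_def)
  qed
  have res: "residue (\<lambda>z. A (k, j, a, b) / (z - t k) ^ j) (t i) = (if k = i \<and> j = 1 then A (k, j, a, b) else 0)"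
    if kj: "k \<in> {1..n}" "j \<in> {1..d k}" for k j
  proof (cases "k = i")
    case True
    obtain m where m: "j = Suc m" using kj by (cases j) auto
    \<comment> \<open>The residue at a pole of order \<open>m + 1\<close> is an \<open>m\<close>-th
      derivative of the numerator, here constant, so only \<open>m = 0\<close> contributes.\<close>
    have "residue (\<lambda>z. (\<lambda>_. A (k, j, a, b)) z / (z - t i) ^ Suc m) (t i) = (deriv ^^ m) (\<lambda>_. A (k, j, a, b)) (t i) / fact m"
      by (rule residue_holomorphic_over_power[of UNIV]) auto
    also have "(deriv ^^ m) (\<lambda>_. A (k, j, a, b)) = (\<lambda>_. if m = 0 then A (k, j, a, b) else 0)"
      by (induction m) (auto simp: fun_eq_iff)
    finally show ?thesis using True m by auto
  next
    case False
    then have "(\<lambda>z. A (k, j, a, b) / (z - t k) ^ j) holomorphic_on s"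
      using that by (auto simp: s_def intro!: holomorphic_intros)
    then show ?thesis using residue_holo[OF s] False by simp
  qed
  have "residue (system_entry n d t A a b) (t i) =
      residue (\<lambda>z. \<Sum>p\<in>Sigma {1..n} (\<lambda>k. {1..d k}). case p of (k, j) \<Rightarrow> A (k, j, a, b) / (z - t k) ^ j) (t i)"
    by (rule arg_cong2[where f = residue]) (auto simp: fun_eq_iff system_entry_eq[OF ab])
  also have "\<dots> = (\<Sum>p\<in>Sigma {1..n} (\<lambda>k. {1..d k}). residue (\<lambda>z. case p of (k, j) \<Rightarrow> A (k, j, a, b) / (z - t k) ^ j) (t i))"
    by (rule residue_sum[OF _ s]) (auto simp: s_def intro!: holomorphic_intros)
  also have "\<dots> = (\<Sum>(k, j)\<in>Sigma {1..n} (\<lambda>k. {1..d k}). if k = i \<and> j = 1 then A (k, j, a, b) else 0)"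
    by (rule sum.cong) (auto simp: res)
  also have "\<dots> = A (i, 1, a, b)"
    using i d_pos'[OF i] by (intro sum_delta_index) auto
  finally show ?thesis .
qed

lemma system_entry_leading_limit:
  assumes i: "i \<in> {1..n}" and ab: "a < 2" "b < 2"
  shows "((\<lambda>z. (z - t i) ^ d i * system_entry n d t A a b z) \<longlongrightarrow> A (i, d i, a, b)) (at (t i))"
proof -
  have "((\<lambda>z. (z - t i) ^ d i * (A (k, j, a, b) / (z - t k) ^ j)) \<longlongrightarrow> (if k = i \<and> j = d i then A (k, j, a, b) else 0)) (at (t i))"
    if kj: "k \<in> {1..n}" "j \<in> {1..d k}" for k j
  proof (cases "k = i")
    case True
    have lim: "((\<lambda>z. (z - t i) ^ (d i - j) * A (k, j, a, b)) \<longlongrightarrow> (t i - t i) ^ (d i - j) * A (k, j, a, b)) (at (t i))"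
      by (intro tendsto_intros)
    have val: "(t i - t i) ^ (d i - j) * A (k, j, a, b) = (if k = i \<and> j = d i then A (k, j, a, b) else 0)"
      using kj True by (auto simp: power_0_left)
    have ev: "\<forall>\<^sub>F z in at (t i). (z - t i) ^ (d i - j) * A (k, j, a, b) = (z - t i) ^ d i * (A (k, j, a, b) / (z - t k) ^ j)"
      unfolding eventually_at_filter using kj True by (auto intro!: always_eventually simp: power_diff)
    show ?thesis using Lim_transform_eventually[OF lim ev] unfolding val .
  next
    case False
    then have "t i \<noteq> t k" using inj_onD[OF t_inj _ i kj(1)] by metis
    then have "((\<lambda>z. (z - t i) ^ d i * (A (k, j, a, b) / (z - t k) ^ j)) \<longlongrightarrow> (t i - t i) ^ d i * (A (k, j, a, b) / (t i - t k) ^ j)) (at (t i))"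
      by (intro tendsto_intros) auto
    then show ?thesis using False d_pos'[OF i] by (simp add: zero_power)
  qed
  then have "((\<lambda>z. \<Sum>p\<in>Sigma {1..n} (\<lambda>k. {1..d k}). case p of (k, j) \<Rightarrow> (z - t i) ^ d i * (A (k, j, a, b) / (z - t k) ^ j))
     \<longlongrightarrow> (\<Sum>p\<in>Sigma {1..n} (\<lambda>k. {1..d k}). case p of (k, j) \<Rightarrow> if k = i \<and> j = d i then A (k, j, a, b) else 0)) (at (t i))"
  proof (intro tendsto_sum, clarify)
    fix k j assume "k \<in> {1..n}" "j \<in> {1..d k}"
      "\<And>k j. k \<in> {1..n} \<Longrightarrow> j \<in> {1..d k} \<Longrightarrow>
        ((\<lambda>z. (z - t i) ^ d i * (A (k, j, a, b) / (z - t k) ^ j)) \<longlongrightarrow> (if k = i \<and> j = d i then A (k, j, a, b) else 0)) (at (t i))"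
    then show "((\<lambda>z. (z - t i) ^ d i * (A (k, j, a, b) / (z - t k) ^ j)) \<longlongrightarrow> (if k = i \<and> j = d i then A (k, j, a, b) else 0)) (at (t i))"
      by blast
  qed
  moreover have "(\<Sum>(k, j)\<in>Sigma {1..n} (\<lambda>k. {1..d k}). if k = i \<and> j = d i then A (k, j, a, b) else 0) = A (i, d i, a, b)"
    using i d_pos'[OF i] by (intro sum_delta_index) auto
  ultimately show ?thesis
    by (simp add: system_entry_eq[OF ab] sum_distrib_left case_prod_beta)
qed

text \<open>Near \<open>w = 0\<close>, \<open>A(1/w) = w h(w)\<close> with \<open>h\<close> analytic, so \<open>A(1/w) / w\<^sup>2\<close> is bounded iff \<open>h(0) = 0\<close>.\<close>

lemma system_entry_infinity:
  assumes ab: "a < 2" "b < 2"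
  shows "(\<exists>l. ((\<lambda>w. - system_entry n d t A a b (1 / w) / w\<^sup>2) \<longlongrightarrow> l) (at 0)) \<longleftrightarrow> (\<Sum>i=1..n. A (i, 1, a, b)) = 0"
proof -
  define I where "I = Sigma {1..n} (\<lambda>k. {1..d k})"
  \<comment> \<open>From \<open>1 / (1/w - t)^j = w^j / (1 - t w)^j\<close> with one factor
    \<open>w\<close> taken out; at \<open>w = 0\<close> only the terms with \<open>j = 1\<close>
    remain.\<close>
  define h where "h w = (\<Sum>p\<in>I. case p of (k, j) \<Rightarrow> A (k, j, a, b) * w ^ (j - 1) / (1 - t k * w) ^ j)" for w
  have "h field_differentiable at 0"
    unfolding h_def[abs_def] by (intro derivative_intros) (auto intro!: derivative_intros split: prod.split)
  then obtain D where D: "(h has_field_derivative D) (at 0)" by (auto simp: field_differentiable_def)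
  have h0: "h 0 = (\<Sum>i=1..n. A (i, 1, a, b))"
  proof -
    have "h 0 = (\<Sum>k=1..n. \<Sum>j=1..d k. if j = 1 then A (k, 1, a, b) else 0)"
      unfolding h_def I_def by (subst sum.Sigma) (auto intro!: sum.cong simp: power_0_left)
    also have "\<dots> = (\<Sum>i=1..n. A (i, 1, a, b))"
      by (rule sum.cong) (use d_pos' in \<open>auto simp: Suc_le_eq\<close>)
    finally show ?thesis .
  qed
  have ev: "\<forall>\<^sub>F w in at 0. w \<noteq> 0 \<and> system_entry n d t A a b (1 / w) = w * h w"
  proof -
    have "\<forall>\<^sub>F w in at 0. w \<noteq> 0 \<and> (\<forall>k\<in>{1..n}. 1 - t k * w \<noteq> 0)"
    proof (intro eventually_conj eventually_ball_finite ballI)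
      show "\<forall>\<^sub>F w in at (0 :: complex). w \<noteq> 0" by (simp add: eventually_at_filter)
      fix k
      have "((\<lambda>w. 1 - t k * w) \<longlongrightarrow> 1 - t k * 0) (at 0)" by (intro tendsto_intros)
      then show "\<forall>\<^sub>F w in at 0. 1 - t k * w \<noteq> 0" by (rule tendsto_imp_eventually_ne) simp
    qed simp
    then show ?thesis
    proof (rule eventually_mono, intro conjI)
      fix w assume w: "w \<noteq> 0 \<and> (\<forall>k\<in>{1..n}. 1 - t k * w \<noteq> 0)"
      have "A (k, j, a, b) / (1 / w - t k) ^ j = w * (A (k, j, a, b) * w ^ (j - 1) / (1 - t k * w) ^ j)"
        if kj: "k \<in> {1..n}" "j \<in> {1..d k}" for k j
      proof -
        have "1 / w - t k = (1 - t k * w) / w" using w by (simp add: field_simps)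
        moreover obtain m where "j = Suc m" using kj by (cases j) auto
        ultimately show ?thesis by (simp add: power_divide)
      qed
      then show "system_entry n d t A a b (1 / w) = w * h w"
        unfolding system_entry_eq[OF ab] h_def sum_distrib_left I_def by (intro sum.cong) auto
    qed auto
  qed
  show ?thesis
  proof
    assume "\<exists>l. ((\<lambda>w. - system_entry n d t A a b (1 / w) / w\<^sup>2) \<longlongrightarrow> l) (at 0)"
    then obtain l where l: "((\<lambda>w. - system_entry n d t A a b (1 / w) / w\<^sup>2) \<longlongrightarrow> l) (at 0)" by blast
    have "((\<lambda>w. - w * (- system_entry n d t A a b (1 / w) / w\<^sup>2)) \<longlongrightarrow> - 0 * l) (at 0)"
      by (intro tendsto_intros l)
    moreover have "\<forall>\<^sub>F w in at 0. - w * (- system_entry n d t A a b (1 / w) / w\<^sup>2) = h w"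
      using ev by (rule eventually_mono) (auto simp: power2_eq_square field_simps)
    ultimately have "(h \<longlongrightarrow> - 0 * l) (at 0)" by (rule Lim_transform_eventually)
    then have "(h \<longlongrightarrow> 0) (at 0)" by simp
    moreover have "(h \<longlongrightarrow> h 0) (at 0)" using DERIV_isCont[OF D] by (simp add: isCont_def)
    ultimately have "h 0 = 0" using LIM_unique by blast
    then show "(\<Sum>i=1..n. A (i, 1, a, b)) = 0" using h0 by simp
  next
    assume "(\<Sum>i=1..n. A (i, 1, a, b)) = 0"
    then have "h 0 = 0" using h0 by simp
    then have "((\<lambda>w. - (h w / w)) \<longlongrightarrow> - D) (at 0)" using D by (intro tendsto_minus) (simp add: has_field_derivative_iff)
    moreover have "\<forall>\<^sub>F w in at 0. - (h w / w) = - system_entry n d t A a b (1 / w) / w\<^sup>2"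
      using ev by (rule eventually_mono) (auto simp: power2_eq_square field_simps)
    ultimately have "((\<lambda>w. - system_entry n d t A a b (1 / w) / w\<^sup>2) \<longlongrightarrow> - D) (at 0)"
      by (rule Lim_transform_eventually)
    then show "\<exists>l. ((\<lambda>w. - system_entry n d t A a b (1 / w) / w\<^sup>2) \<longlongrightarrow> l) (at 0)" ..
  qed
qed

lemma irr_level_eq: "irr_level n d t (\<lambda>i. diag2 (xi i) (eta i)) = conn_level"
proof -
  have "(\<Sum>i = 1..n. residue (system_entry n d t A a b) (t i)) = (\<Sum>i=1..n. A (i, 1, a, b))" if "a < 2" "b < 2" for A a b
    using that by (intro sum.cong residue_system_entry) auto
  then show ?thesis
    unfolding irr_level_def conn_level_def by (auto simp: local_part_in_orbit_iff)
qed

text \<open>The pole orders are automatic: if the leading coefficient matrix at \<open>t i\<close>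
  vanished, the determinant condition would kill the top coefficient of \<open>eta i\<close>, and
  then the trace condition that of \<open>lam i\<close>. Absence of a pole at infinity is the
  vanishing of the residue sum.\<close>

lemma stable_connections_eq: "stable_connections n d t (\<lambda>i. diag2 (xi i) (eta i)) = conn_level"
proof -
  have "has_pole_order n d t A i (d i)" if A: "A \<in> conn_level" and i: "i \<in> {1..n}" for A i
    unfolding has_pole_order_def
  proof (intro exI[of _ "\<lambda>a b. A (i, d i, a, b)"] conjI allI impI)
    show "((\<lambda>z. (z - t i) ^ d i * system_entry n d t A a b z) \<longlongrightarrow> A (i, d i, a, b)) (at (t i))" if "a < 2" "b < 2" for a b
      by (rule system_entry_leading_limit[OF i that])
    show "\<exists>a<2. \<exists>b<2. A (i, d i, a, b) \<noteq> 0"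
    proof (rule ccontr)
      assume "\<not> ?thesis"
      then have "A (i, d i, 0, 0) = 0" "A (i, d i, 0, 1) = 0" "A (i, d i, 1, 1) = 0" by simp_all
      moreover have "tcong (d i) (xser A i 0 0 + xser A i 1 1) (lser i)"
        "tcong (d i) (xser A i 0 0 * xser A i 1 1) (xser A i 0 1 * xser A i 1 0)"
        using A i by (simp_all add: conn_level_def)
      note tcong_nth_0[OF this(1) d_pos'[OF i]] tcong_nth_0[OF this(2) d_pos'[OF i]]
      ultimately show False using d_pos'[OF i] lser_0[OF i] by (simp add: xser_nth)
    qed
  qed
  note pole = this
  have inf: "no_pole_at_infinity n d t A \<longleftrightarrow> (\<forall>a<2. \<forall>b<2. (\<Sum>i=1..n. A (i, 1, a, b)) = 0)" for A
    unfolding no_pole_at_infinity_def by (intro iff_allI imp_cong refl system_entry_infinity)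
  have loc: "(\<forall>i\<in>{1..n}. local_part d A i \<in> coadjoint_orbit 2 (diag2 (xi i) (eta i))) \<longleftrightarrow>
      (\<forall>i\<in>{1..n}. tcong (d i) (xser A i 0 0 + xser A i 1 1) (lser i) \<and>
      tcong (d i) (xser A i 0 0 * xser A i 1 1) (xser A i 0 1 * xser A i 1 0))" for A
    by (intro ball_cong refl local_part_in_orbit_iff)
  show ?thesis
    unfolding stable_connections_def inf loc using pole unfolding conn_level_def topspace_affine_top by blast
qed

end

section \<open>Derivatives of families of power series\<close>

definition has_coeff_deriv :: "(complex \<Rightarrow> complex fps) \<Rightarrow> complex fps \<Rightarrow> bool" where
  "has_coeff_deriv F F' \<longleftrightarrow> (\<forall>m. ((\<lambda>s. fps_nth (F s) m) has_field_derivative fps_nth F' m) (at 0))"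

lemma has_coeff_deriv_add:
  "has_coeff_deriv F F' \<Longrightarrow> has_coeff_deriv G G' \<Longrightarrow> has_coeff_deriv (\<lambda>s. F s + G s) (F' + G')"
  by (simp add: has_coeff_deriv_def DERIV_add)

lemma has_coeff_deriv_mult:
  assumes "has_coeff_deriv F F'" "has_coeff_deriv G G'"
  shows "has_coeff_deriv (\<lambda>s. F s * G s) (F' * G 0 + F 0 * G')"
  unfolding has_coeff_deriv_def
proof
  fix m
  have "((\<lambda>s. \<Sum>i=0..m. fps_nth (F s) i * fps_nth (G s) (m - i)) has_field_derivative
      (\<Sum>i=0..m. fps_nth (F 0) i * fps_nth G' (m - i) + fps_nth F' i * fps_nth (G 0) (m - i))) (at 0)"
    using assms by (intro DERIV_sum DERIV_mult') (auto simp: has_coeff_deriv_def)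
  then show "((\<lambda>s. fps_nth (F s * G s) m) has_field_derivative fps_nth (F' * G 0 + F 0 * G') m) (at 0)"
    by (simp add: fps_mult_nth sum.distrib add.commute)
qed

lemma has_coeff_deriv_fps_const:
  assumes "(f has_field_derivative f') (at 0)"
  shows "has_coeff_deriv (\<lambda>s. fps_const (f s)) (fps_const f')"
  using assms by (auto simp: has_coeff_deriv_def)

lemma has_coeff_deriv_const: "has_coeff_deriv (\<lambda>s. F) 0"
  by (simp add: has_coeff_deriv_def)

lemma has_coeff_deriv_tcong:
  assumes "has_coeff_deriv F F'" "has_coeff_deriv G G'" "\<forall>\<^sub>F s in nhds 0. tcong d (F s) (G s)"
  shows "tcong d F' G'"
  unfolding tcong_def
proof (intro allI impI)
  fix m assume m: "m < d"
  have "\<forall>\<^sub>F s in nhds 0. fps_nth (F s) m = fps_nth (G s) m"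
    using assms(3) by (rule eventually_mono) (use m in \<open>simp add: tcong_def\<close>)
  then have "((\<lambda>s. fps_nth (F s) m) has_field_derivative x) (at 0) \<longleftrightarrow> ((\<lambda>s. fps_nth (G s) m) has_field_derivative x) (at 0)" for x
    by (intro DERIV_cong_ev) auto
  with assms(1,2) show "fps_nth F' m = fps_nth G' m"
    unfolding has_coeff_deriv_def by (blast intro: DERIV_unique)
qed

section \<open>Invariance of the symplectic form under a moving gauge\<close>

text \<open>
  With \<open>M\<^sub>j = L K\<^sub>j'\<close> for \<open>L = K\<^sup>-\<^sup>1\<close>, the velocities of \<open>K\<^sub>j p\<close> and \<open>q K\<^sub>j\<^sup>-\<^sup>1\<close> are \<open>K (p\<^sub>j' + M\<^sub>j p)\<close> and
  \<open>(q\<^sub>j' - q M\<^sub>j) L\<close>; the terms linear in \<open>M\<^sub>j\<close> cancel because the moment map at the centre is constant, and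
  the quadratic one because its value is scalar.
\<close>

lemma moving_gauge_invariance:
  fixes p q p1 q1 p2 q2 :: "'i \<Rightarrow> nat \<Rightarrow> complex fps" and M1 M2 :: "nat \<Rightarrow> nat \<Rightarrow> complex" and e :: "'i \<Rightarrow> nat"
  assumes T: "\<And>a b. a < 2 \<Longrightarrow> b < 2 \<Longrightarrow> (\<Sum>i\<in>I. fps_nth (p i a * q i b) (e i)) = (if a = b then c else 0)"
    and D1: "\<And>a b. a < 2 \<Longrightarrow> b < 2 \<Longrightarrow> (\<Sum>i\<in>I. fps_nth (p1 i a * q i b + p i a * q1 i b) (e i)) = 0"
    and D2: "\<And>a b. a < 2 \<Longrightarrow> b < 2 \<Longrightarrow> (\<Sum>i\<in>I. fps_nth (p2 i a * q i b + p i a * q2 i b) (e i)) = 0"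
  defines "P \<equiv> \<lambda>p' M i a. p' i a + lact M (p i) a"
    and "R \<equiv> \<lambda>q' M i a. q' i a - ract (q i) M a"
  shows "(\<Sum>i\<in>I. fps_nth (pairing (R q2 M2 i) (P p1 M1 i)
       - pairing (R q1 M1 i) (P p2 M2 i)) (e i)) =
    (\<Sum>i\<in>I. fps_nth (pairing (q2 i) (p1 i) - pairing (q1 i) (p2 i)) (e i))"
proof -
  \<comment> \<open>The sum of residues as a bilinear form on families of series; constant matrix
    entries pull out of it, so the gauge terms are handled by linearity.\<close>
  define B where "B x y = (\<Sum>i\<in>I. fps_nth (x i * y i) (e i))" for x y :: "'i \<Rightarrow> complex fps"
  have addl: "B (\<lambda>i. x i + y i) z = B x z + B y z" and addr: "B z (\<lambda>i. x i + y i) = B z x + B z y"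
    and subl: "B (\<lambda>i. x i - y i) z = B x z - B y z" for x y z
    by (simp_all add: B_def distrib_left distrib_right left_diff_distrib sum.distrib sum_subtractf)
  have sl: "B (\<lambda>i. x i * fps_const k) z = k * B x z" and sr: "B z (\<lambda>i. fps_const k * x i) = k * B z x" for x z k
    by (simp_all add: B_def sum_distrib_left mult_ac)
  have main: "B (R' q2 M2 0) (P' p1 M1 0) + B (R' q2 M2 1) (P' p1 M1 1) - (B (R' q1 M1 0) (P' p2 M2 0) + B (R' q1 M1 1) (P' p2 M2 1)) =
      B (\<lambda>i. q2 i 0) (\<lambda>i. p1 i 0) + B (\<lambda>i. q2 i 1) (\<lambda>i. p1 i 1) - (B (\<lambda>i. q1 i 0) (\<lambda>i. p2 i 0) + B (\<lambda>i. q1 i 1) (\<lambda>i. p2 i 1))"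
    if P': "\<And>p' M a. P' p' M a = (\<lambda>i. P p' M i a)" and R': "\<And>q' M a. R' q' M a = (\<lambda>i. R q' M i a)" for P' R'
  proof -
    \<comment> \<open>In terms of \<open>B\<close>, the centre equation says that the matrix of
      pairings of \<open>q\<close> with \<open>p\<close> is \<open>c\<close> times the identity; its
      derivative trades a varied \<open>q\<close> for a varied \<open>p\<close> with a sign.\<close>
    have t: "B (\<lambda>i. q i b) (\<lambda>i. p i a) = (if a = b then c else 0)" if "a < 2" "b < 2" for a b
      using T[OF that] by (simp add: B_def mult.commute)
    have d1: "B (\<lambda>i. q1 i b) (\<lambda>i. p i a) = - B (\<lambda>i. q i b) (\<lambda>i. p1 i a)" if "a < 2" "b < 2" for a b
      using D1[OF that] by (simp add: B_def mult.commute sum.distrib add_eq_0_iff)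
    have d2: "B (\<lambda>i. q2 i b) (\<lambda>i. p i a) = - B (\<lambda>i. q i b) (\<lambda>i. p2 i a)" if "a < 2" "b < 2" for a b
      using D2[OF that] by (simp add: B_def mult.commute sum.distrib add_eq_0_iff)
    show ?thesis
      unfolding P' R' P_def R_def addl addr subl sl sr
      by (simp add: t d1 d2 t[of 1 1, simplified] t[of 0 1, simplified] t[of 1 0, simplified]
          d1[of 1 1, simplified] d1[of 0 1, simplified] d1[of 1 0, simplified]
          d2[of 1 1, simplified] d2[of 0 1, simplified] d2[of 1 0, simplified] algebra_simps)
  qed
  show ?thesis
    using main[OF refl refl] by (simp add: B_def sum.distrib sum_subtractf)
qed

section \<open>Normalising gauge\<close>

text \<open>
  The first column of \<open>gauge_frame\<close> spans the image of the leading coefficient of \<open>A\<^sub>1 - \<eta>\<^sub>1\<close>, the second is its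
  image under \<open>A\<^sub>i\<^sub>j\<close>. Both are natural under conjugation up to one common scalar, so comparing the frames of two
  equivalent systems gives a conjugating matrix which depends holomorphically on them.
\<close>

context star_connection
begin

definition gauge_frame :: "nat \<times> nat \<Rightarrow> nat \<Rightarrow> (conn_index \<Rightarrow> complex) \<Rightarrow> nat \<Rightarrow> nat \<Rightarrow> complex" where
  "gauge_frame ij e A a b = (let x = (\<lambda>a. A (1, d 1, a, e) - (if a = e then fls_nth (eta 1) (- int (d 1)) else 0)) in
    if b = 0 then x a else A (fst ij, snd ij, a, 0) * x 0 + A (fst ij, snd ij, a, 1) * x 1)"

definition frame_det :: "nat \<times> nat \<Rightarrow> nat \<Rightarrow> (conn_index \<Rightarrow> complex) \<Rightarrow> complex" where
  "frame_det ij e A = gauge_frame ij e A 0 0 * gauge_frame ij e A 1 1 - gauge_frame ij e A 0 1 * gauge_frame ij e A 1 0"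

definition frame_inv :: "nat \<times> nat \<Rightarrow> nat \<Rightarrow> (conn_index \<Rightarrow> complex) \<Rightarrow> nat \<Rightarrow> nat \<Rightarrow> complex" where
  "frame_inv ij e A a b = (if a = b then gauge_frame ij e A (1 - a) (1 - a) else - gauge_frame ij e A a b) / frame_det ij e A"

text \<open>The columns \<open>e\<close> and \<open>e'\<close> may differ, because the two systems
  may have their unit diagonal entry in different places; the pair \<open>ij\<close> must be common
  for the frames to correspond.\<close>

definition gauge :: "nat \<times> nat \<Rightarrow> nat \<Rightarrow> (conn_index \<Rightarrow> complex) \<Rightarrow> nat \<Rightarrow> (conn_index \<Rightarrow> complex) \<Rightarrow> nat \<Rightarrow> nat \<Rightarrow> complex" where
  "gauge ij e A e' C a b = gauge_frame ij e' C a 0 * frame_inv ij e A 0 b + gauge_frame ij e' C a 1 * frame_inv ij e A 1 b"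

lemma frame_inv:
  assumes "frame_det ij e A \<noteq> 0"
  shows "mat2 (gauge_frame ij e A) * mat2 (frame_inv ij e A) = 1\<^sub>m 2"
    and "mat2 (frame_inv ij e A) * mat2 (gauge_frame ij e A) = 1\<^sub>m 2"
proof -
  define x y z w where "x = gauge_frame ij e A 0 0" and "y = gauge_frame ij e A 0 1"
    and "z = gauge_frame ij e A 1 0" and "w = gauge_frame ij e A 1 1"
  define r where "r = inverse (frame_det ij e A)"
  have "(x * w - y * z) * r = 1" using assms by (simp add: r_def frame_det_def x_def y_def z_def w_def)
  then have *: "x * w * r - y * z * r = 1" by (simp add: left_diff_distrib)
  have inv: "frame_inv ij e A 0 0 = w * r" "frame_inv ij e A 0 1 = - y * r" "frame_inv ij e A 1 0 = - z * r" "frame_inv ij e A 1 1 = x * r"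
    by (simp_all add: frame_inv_def x_def y_def z_def w_def r_def divide_inverse)
  show "mat2 (gauge_frame ij e A) * mat2 (frame_inv ij e A) = 1\<^sub>m 2"
    "mat2 (frame_inv ij e A) * mat2 (gauge_frame ij e A) = 1\<^sub>m 2"
    unfolding mat2_mult mat2_one mat2_eq_iff all_less_2 inv x_def[symmetric] y_def[symmetric] z_def[symmetric] w_def[symmetric]
    using * by (simp_all add: mult_ac)
qed

lemma gauge_eq: "mat2 (gauge ij e A e' C) = mat2 (gauge_frame ij e' C) * mat2 (frame_inv ij e A)"
  by (simp add: mat2_mult gauge_def[abs_def])

lemmas assoc2 = assoc_mult_mat[of _ 2 2 _ 2 _ 2] mult_carrier_mat[of _ 2 2 _ 2]

lemma gauge_inverse:
  assumes "frame_det ij e A \<noteq> 0" "frame_det ij e' C \<noteq> 0"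
  shows "mat2 (gauge ij e A e' C) * mat2 (gauge ij e' C e A) = 1\<^sub>m 2"
proof -
  have "mat2 (gauge ij e A e' C) * mat2 (gauge ij e' C e A) =
    mat2 (gauge_frame ij e' C) * ((mat2 (frame_inv ij e A) * mat2 (gauge_frame ij e A)) * mat2 (frame_inv ij e' C))"
    unfolding gauge_eq by (simp add: assoc2)
  then show ?thesis
    unfolding frame_inv(2)[OF assms(1)] by (simp add: left_mult_one_mat[of _ 2 2] frame_inv(1)[OF assms(2)])
qed

text \<open>The first frame column is non-zero. If no coefficient of the system moved it out of its
  line, that line would be invariant, against irreducibility.\<close>

lemma exists_frame:
  assumes A: "A \<in> conn_level"
  obtains e i j where "e < 2" "i \<in> {1..n}" "j \<in> {1..d i}" "frame_det (i, j) e A \<noteq> 0"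
proof -
  have one: "1 \<in> {1..n}" using n_pos by simp
  obtain e where e: "e < 2" "fps_nth (xser A 1 e e) 0 \<noteq> 0"
    using exists_unit_diagonal[OF A one] by blast
  define x where "x a = A (1, d 1, a, e) - (if a = e then fls_nth (eta 1) (- int (d 1)) else 0)" for a
  have xe: "x e \<noteq> 0" using e(2) d_pos'[OF one] by (simp add: x_def xser_nth)
  have "\<exists>i\<in>{1..n}. \<exists>j\<in>{1..d i}. frame_det (i, j) e A \<noteq> 0"
  proof (rule ccontr)
    assume "\<not> ?thesis"
    then have det: "frame_det (i, j) e A = 0" if "i \<in> {1..n}" "j \<in> {1..d i}" for i j using that by blast
    define w where "w = Matrix.vec 2 x"
    have w: "w \<in> carrier_vec 2" "w $ a = x a" if "a < 2" for a using that by (auto simp: w_def)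
    define S where "S = range (\<lambda>c. c \<cdot>\<^sub>v w)"
    have sub: "is_subspace 2 S"
      unfolding is_subspace_def S_def
    proof (intro conjI ballI allI)
      show "range (\<lambda>c. c \<cdot>\<^sub>v w) \<subseteq> carrier_vec 2" by (auto simp: w_def)
      show "0\<^sub>v 2 \<in> range (\<lambda>c. c \<cdot>\<^sub>v w)" by (rule range_eqI[of _ _ 0]) (auto simp: w_def)
      fix u u' assume "u \<in> range (\<lambda>c. c \<cdot>\<^sub>v w)" "u' \<in> range (\<lambda>c. c \<cdot>\<^sub>v w)"
      then obtain c c' where "u = c \<cdot>\<^sub>v w" "u' = c' \<cdot>\<^sub>v w" by blast
      then show "u + u' \<in> range (\<lambda>c. c \<cdot>\<^sub>v w)" by (intro range_eqI[of _ _ "c + c'"]) (auto simp: add_smult_distrib_vec)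
    next
      fix c u assume "u \<in> range (\<lambda>c. c \<cdot>\<^sub>v w)"
      then obtain c' where "u = c' \<cdot>\<^sub>v w" by blast
      then show "c \<cdot>\<^sub>v u \<in> range (\<lambda>c. c \<cdot>\<^sub>v w)" by (intro range_eqI[of _ _ "c * c'"]) (auto simp: smult_smult_assoc)
    qed
    have "w \<in> S" unfolding S_def by (rule range_eqI[of _ _ 1]) auto
    moreover have "w \<noteq> 0\<^sub>v 2" using w(2)[OF e(1)] xe e(1) by auto
    ultimately have ne1: "S \<noteq> {0\<^sub>v 2}" by blast
    have ne2: "S \<noteq> carrier_vec 2"
    proof
      assume "S = carrier_vec 2"
      then have "unit_vec 2 (1 - e) \<in> S" by auto
      then obtain c where c: "unit_vec 2 (1 - e) = c \<cdot>\<^sub>v w" by (auto simp: S_def)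
      have "c * x e = 0" using arg_cong[OF c, of "\<lambda>u :: complex vec. u $ e"] e(1) w(1)[OF e(1)] w(2)[OF e(1)] by (auto simp: less_2_cases_iff)
      then have "unit_vec 2 (1 - e) $ (1 - e) = (0 :: complex)" using xe w(1)[OF e(1)] e(1) unfolding c by auto
      then show False using e(1) by auto
    qed
    have inv: "coeff_mat A i j *\<^sub>v u \<in> S" if ij: "i \<in> {1..n}" "j \<in> {1..d i}" and u: "u \<in> S" for i j u
    proof -
      obtain c where c: "u = c \<cdot>\<^sub>v w" using u by (auto simp: S_def)
      define y where "y a = A (i, j, a, 0) * x 0 + A (i, j, a, 1) * x 1" for a
      \<comment> \<open>The vanishing determinant says that \<open>y\<close>, the image of
        \<open>x\<close>, is parallel to \<open>x\<close>; the factor is read off at the entry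
        \<open>e\<close>, where \<open>x\<close> is non-zero.\<close>
      have "x 0 * y 1 = y 0 * x 1"
        using det[OF ij] by (simp add: frame_det_def gauge_frame_def x_def y_def)
      then have yx: "y a * x e = x a * y e" if "a < 2" for a
        using that e(1) by (auto simp: less_2_cases_iff mult.commute)
      have "(coeff_mat A i j *\<^sub>v u) $ a = ((c * y e / x e) \<cdot>\<^sub>v w) $ a" if a: "a < 2" for a
      proof -
        have "(coeff_mat A i j *\<^sub>v u) $ a = c * y a"
          unfolding c y_def using a w(1)[OF a] w(2)[of 0] w(2)[of 1]
          by (subst mult_mat_vec_index[of _ 2 2]) (auto simp: coeff_mat_eq_mat2 sum_less_2 algebra_simps)
        also have "\<dots> = c * y e / x e * x a" using yx[OF a] xe by (simp add: field_simps)
        finally show ?thesis using w[OF a] by (simp add: carrier_vecD[OF w(1)[OF a]] a)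
      qed
      then have "coeff_mat A i j *\<^sub>v u = (c * y e / x e) \<cdot>\<^sub>v w"
        by (intro eq_vecI) (auto simp: w_def coeff_mat_eq_mat2)
      then show ?thesis by (simp add: S_def)
    qed
    show False using A sub ne1 ne2 inv unfolding conn_level_def irreducible_system_def by blast
  qed
  with e(1) show thesis using that by blast
qed

text \<open>Let \<open>G\<close> be any conjugating matrix. The first columns of the frames span the
  images of rank-one matrices that \<open>G\<close> intertwines, so \<open>G\<close> maps one to a
  multiple \<open>c\<close> of the other, and the second columns follow with the same
  \<open>c\<close>. Hence the quotient of the frames is \<open>G / c\<close>, which intertwines as
  well.\<close>

lemma gauge_intertwines:
  assumes eq: "conn_equivalent A C" and C: "C \<in> conn_level" and e': "e' < 2" and e: "e < 2"
    and Ce: "gauge_frame (i0, j0) e' C e' 0 \<noteq> 0" and A: "frame_det (i0, j0) e A \<noteq> 0"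
    and i0: "i0 \<in> {1..n}" "j0 \<in> {1..d i0}"
  shows "frame_det (i0, j0) e' C \<noteq> 0"
    and "i \<in> {1..n} \<Longrightarrow> j \<in> {1..d i} \<Longrightarrow>
      coeff_mat C i j * mat2 (gauge (i0, j0) e A e' C) = mat2 (gauge (i0, j0) e A e' C) * coeff_mat A i j"
proof -
  obtain G H where GH: "mat2 G * mat2 H = 1\<^sub>m 2" "mat2 H * mat2 G = 1\<^sub>m 2"
    and int: "\<And>i j. i \<in> {1..n} \<Longrightarrow> j \<in> {1..d i} \<Longrightarrow> coeff_mat C i j * mat2 G = mat2 G * coeff_mat A i j"
    using eq unfolding conn_equivalent_iff by blast
  have int': "C (i, j, a, 0) * G 0 b + C (i, j, a, 1) * G 1 b = G a 0 * A (i, j, 0, b) + G a 1 * A (i, j, 1, b)"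
    if "i \<in> {1..n}" "j \<in> {1..d i}" "a < 2" "b < 2" for i j a b
    using int[OF that(1,2)] that(3,4) unfolding coeff_mat_eq_mat2 mat2_mult mat2_eq_iff by blast
  have one: "1 \<in> {1..n}" "d 1 \<in> {1..d 1}" using n_pos d_pos'[of 1] by auto
  define UA UC where "UA = gauge_frame (i0, j0) e A" and "UC = gauge_frame (i0, j0) e' C"
  define xC where "xC a b = C (1, d 1, a, b) - (if a = b then fls_nth (eta 1) (- int (d 1)) else 0)" for a b
  have "tcong (d 1) (xser C 1 0 0 * xser C 1 1 1) (xser C 1 0 1 * xser C 1 1 0)" using C one by (simp add: conn_level_def)
  from tcong_nth_0[OF this] have rank: "xC 0 0 * xC 1 1 = xC 0 1 * xC 1 0"
    using d_pos'[OF one(1)] by (simp add: xser_nth xC_def)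
  have rank': "xC a b * xC e' e' = xC a e' * xC e' b" if "a < 2" "b < 2" for a b
    using that e' rank by (auto simp: less_2_cases_iff mult.commute)
  have UC0: "UC a 0 = xC a e'" for a by (simp add: UC_def gauge_frame_def xC_def)
  \<comment> \<open>\<open>c\<close> expresses column \<open>e\<close> of \<open>xC G\<close> as a
    multiple of column \<open>e'\<close> of \<open>xC\<close>; as \<open>xC\<close> has rank one,
    the entry in row \<open>e'\<close> determines it.\<close>
  define c where "c = (xC e' 0 * G 0 e + xC e' 1 * G 1 e) / xC e' e'"
  have ee: "xC e' e' \<noteq> 0" using Ce UC0[of e'] by (simp add: UC_def)
  have GUA0: "G a 0 * UA 0 0 + G a 1 * UA 1 0 = c * UC a 0" if a: "a < 2" for a
  proof -
    have "G a 0 * UA 0 0 + G a 1 * UA 1 0 = xC a 0 * G 0 e + xC a 1 * G 1 e"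
      using int'[OF one a e] a e by (auto simp: UA_def gauge_frame_def xC_def less_2_cases_iff algebra_simps)
    also have "\<dots> * xC e' e' = UC a 0 * (xC e' 0 * G 0 e + xC e' 1 * G 1 e)"
      using rank'[OF a, of 0] rank'[OF a, of 1] unfolding UC0 by (simp add: algebra_simps)
    finally show ?thesis using ee by (simp add: c_def field_simps)
  qed
  have UA1: "UA a (Suc 0) = A (i0, j0, a, 0) * UA 0 0 + A (i0, j0, a, 1) * UA 1 0" for a by (simp add: UA_def gauge_frame_def Let_def)
  have UC1: "UC a (Suc 0) = C (i0, j0, a, 0) * UC 0 0 + C (i0, j0, a, 1) * UC 1 0" for a by (simp add: UC_def gauge_frame_def Let_def)
  have GUA1: "G a 0 * UA 0 1 + G a 1 * UA 1 1 = c * UC a 1" if a: "a < 2" for a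
  proof -
    have "G a 0 * UA 0 1 + G a 1 * UA 1 1 =
       (G a 0 * A (i0, j0, 0, 0) + G a 1 * A (i0, j0, 1, 0)) * UA 0 0 + (G a 0 * A (i0, j0, 0, 1) + G a 1 * A (i0, j0, 1, 1)) * UA 1 0"
      by (simp add: UA1 algebra_simps)
    also have "\<dots> = (C (i0, j0, a, 0) * G 0 0 + C (i0, j0, a, 1) * G 1 0) * UA 0 0 + (C (i0, j0, a, 0) * G 0 1 + C (i0, j0, a, 1) * G 1 1) * UA 1 0"
      using int'[OF i0 a, of 0] int'[OF i0 a, of 1] by simp
    also have "\<dots> = C (i0, j0, a, 0) * (G 0 0 * UA 0 0 + G 0 1 * UA 1 0) + C (i0, j0, a, 1) * (G 1 0 * UA 0 0 + G 1 1 * UA 1 0)"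
      by (simp add: algebra_simps)
    also have "\<dots> = c * UC a 1"
      using GUA0[of 0] GUA0[of 1] by (simp add: UC1 algebra_simps)
    finally show ?thesis .
  qed
  have GU: "mat2 G * mat2 UA = mat2 (\<lambda>a b. c * UC a b)"
    unfolding mat2_mult mat2_eq_iff using GUA0 GUA1 by (simp add: all_less_2)
  \<comment> \<open>Both sides are the determinant of \<open>G\<close> times the frame of
    \<open>A\<close>; once they are known to be non-zero, so are \<open>c\<close> and the frame
    determinant of \<open>C\<close>.\<close>
  have dets: "(G 0 0 * G 1 1 - G 0 1 * G 1 0) * frame_det (i0, j0) e A = c * c * frame_det (i0, j0) e' C"
  proof -
    have g: "G 0 0 * UA 0 0 + G 0 1 * UA 1 0 = c * UC 0 0" "G 1 0 * UA 0 0 + G 1 1 * UA 1 0 = c * UC 1 0"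
      "G 0 0 * UA 0 1 + G 0 1 * UA 1 1 = c * UC 0 1" "G 1 0 * UA 0 1 + G 1 1 * UA 1 1 = c * UC 1 1"
      using GUA0[of 0] GUA0[of 1] GUA1[of 0] GUA1[of 1] by simp_all
    have "(G 0 0 * G 1 1 - G 0 1 * G 1 0) * (UA 0 0 * UA 1 1 - UA 0 1 * UA 1 0) =
      (G 0 0 * UA 0 0 + G 0 1 * UA 1 0) * (G 1 0 * UA 0 1 + G 1 1 * UA 1 1) -
      (G 0 0 * UA 0 1 + G 0 1 * UA 1 1) * (G 1 0 * UA 0 0 + G 1 1 * UA 1 0)"
      by (simp add: algebra_simps)
    then show ?thesis unfolding g by (simp add: frame_det_def UA_def UC_def algebra_simps)
  qed
  have "G 0 0 * G 1 1 - G 0 1 * G 1 0 \<noteq> 0"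
  proof
    assume z: "G 0 0 * G 1 1 - G 0 1 * G 1 0 = 0"
    have gh: "G 0 0 * H 0 0 + G 0 1 * H 1 0 = 1" "G 0 0 * H 0 1 + G 0 1 * H 1 1 = 0"
      "G 1 0 * H 0 0 + G 1 1 * H 1 0 = 0" "G 1 0 * H 0 1 + G 1 1 * H 1 1 = 1"
      using GH(1) unfolding mat2_mult mat2_one mat2_eq_iff all_less_2 by auto
    have "(G 0 0 * H 0 0 + G 0 1 * H 1 0) * (G 1 0 * H 0 1 + G 1 1 * H 1 1) -
      (G 0 0 * H 0 1 + G 0 1 * H 1 1) * (G 1 0 * H 0 0 + G 1 1 * H 1 0) =
      (G 0 0 * G 1 1 - G 0 1 * G 1 0) * (H 0 0 * H 1 1 - H 0 1 * H 1 0)" by (simp add: algebra_simps)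
    then show False unfolding gh z by simp
  qed
  then have nz: "c * c * frame_det (i0, j0) e' C \<noteq> 0" using dets A by auto
  then show "frame_det (i0, j0) e' C \<noteq> 0" by auto
  have "c \<noteq> 0" using nz by auto
  define K where "K = gauge (i0, j0) e A e' C"
  have "mat2 G = mat2 (\<lambda>a b. c * K a b)"
  proof -
    have "mat2 G = (mat2 G * mat2 UA) * mat2 (frame_inv (i0, j0) e A)"
      using frame_inv(1)[OF A] by (simp add: assoc2 UA_def right_mult_one_mat[of _ 2 2])
    also have "\<dots> = mat2 (\<lambda>a b. c * K a b)"
      unfolding GU unfolding mat2_mult mat2_eq_iff by (auto simp: K_def gauge_def UC_def algebra_simps)
    finally show ?thesis .
  qed
  then have GK: "G a b = c * K a b" if "a < 2" "b < 2" for a b using that unfolding mat2_eq_iff by blast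
  show "coeff_mat C i j * mat2 (gauge (i0, j0) e A e' C) = mat2 (gauge (i0, j0) e A e' C) * coeff_mat A i j"
    if ij: "i \<in> {1..n}" "j \<in> {1..d i}"
    unfolding coeff_mat_eq_mat2 mat2_mult mat2_eq_iff K_def[symmetric]
  proof (intro allI impI)
    fix a b :: nat assume ab: "a < 2" "b < 2"
    have "c * (C (i, j, a, 0) * K 0 b + C (i, j, a, 1) * K 1 b) = c * (K a 0 * A (i, j, 0, b) + K a 1 * A (i, j, 1, b))"
      using int'[OF ij ab] GK[of 0 b] GK[of 1 b] GK[of a 0] GK[of a 1] ab by (simp add: algebra_simps)
    then show "C (i, j, a, 0) * K 0 b + C (i, j, a, 1) * K 1 b = K a 0 * A (i, j, 0, b) + K a 1 * A (i, j, 1, b)"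
      using \<open>c \<noteq> 0\<close> by simp
  qed
qed

section \<open>Comparison of the symplectic forms\<close>

lemma mat_trace_Pm_Qm:
  assumes i: "i \<in> {1..n}"
  shows "mat_trace (Pm B i * Qm C i) = fps_nth (pairing (qser d C i) (pser d B i)) (d i - 1)"
    and "mat_trace (Qm C i * Pm B i) = fps_nth (pairing (qser d C i) (pser d B i)) (d i - 1)"
proof -
  have di: "1 \<le> d i" using d_pos'[OF i] by simp
  have q: "fps_nth (qser d C i a * pser d B i a) (d i - 1) = (\<Sum>m<d i. C (Inr i, m, a) * B (Inl i, a, m))" for a
    using qser_pser_nth[OF order_refl di, where a = a and b = a] by simp
  have "mat_trace (Pm B i * Qm C i) = (\<Sum>a<2. (Pm B i * Qm C i) $$ (a, a))"
    using arrow_map_carrier[OF i] by (simp add: mat_trace_def carrier_matD[OF arrow_map_carrier(1)[OF i]])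
  also have "\<dots> = (\<Sum>a<2. \<Sum>m<d i. C (Inr i, m, a) * B (Inl i, a, m))"
    by (intro sum.cong refl, subst mat_mult_index[OF arrow_map_carrier[OF i]])
      (auto simp: arrow_map_index[OF i] mult.commute)
  finally show 1: "mat_trace (Pm B i * Qm C i) = fps_nth (pairing (qser d C i) (pser d B i)) (d i - 1)"
    by (simp only: fps_add_nth q sum_less_2)
  have "mat_trace (Qm C i * Pm B i) = (\<Sum>m<d i. (Qm C i * Pm B i) $$ (m, m))"
    by (simp add: mat_trace_def carrier_matD[OF arrow_map_carrier(2)[OF i]])
  also have "\<dots> = (\<Sum>m<d i. \<Sum>a<2. C (Inr i, m, a) * B (Inl i, a, m))"
    by (intro sum.cong refl, subst mat_mult_index[OF arrow_map_carrier(2,1)[OF i]])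
      (auto simp: arrow_map_index[OF i])
  also have "\<dots> = (\<Sum>a<2. \<Sum>m<d i. C (Inr i, m, a) * B (Inl i, a, m))" by (rule sum.swap)
  finally show "mat_trace (Qm C i * Pm B i) = fps_nth (pairing (qser d C i) (pser d B i)) (d i - 1)"
    by (simp only: fps_add_nth q sum_less_2)
qed

text \<open>By cyclicity of the trace an arrow and its reverse contribute equally, which cancels the
  factor \<open>1 / 2\<close>.\<close>

lemma quiver_form_eq:
  "quiver_form Q d v u w = (\<Sum>i=1..n. fps_nth (pairing (qser d w i) (pser d u i) -
    (pairing (qser d u i) (pser d w i))) (d i - 1))"
proof -
  have "quiver_form Q d v u w = 1 / 2 * ((\<Sum>i=1..n. mat_trace (Pm u i * Qm w i) - mat_trace (Pm w i * Qm u i)) +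
      (\<Sum>i=1..n. - (mat_trace (Qm u i * Pm w i) - mat_trace (Qm w i * Pm u i))))"
    unfolding quiver_form_def sum_double_arcs_star by simp
  also have "\<dots> = 1 / 2 * (\<Sum>i=1..n. (mat_trace (Pm u i * Qm w i) - mat_trace (Pm w i * Qm u i)) +
      - (mat_trace (Qm u i * Pm w i) - mat_trace (Qm w i * Pm u i)))"
    by (simp only: sum.distrib)
  also have "\<dots> = (\<Sum>i=1..n. 1 / 2 * ((mat_trace (Pm u i * Qm w i) - mat_trace (Pm w i * Qm u i)) +
      - (mat_trace (Qm u i * Pm w i) - mat_trace (Qm w i * Pm u i))))"
    by (rule sum_distrib_left)
  also have "\<dots> = (\<Sum>i=1..n. fps_nth (pairing (qser d w i) (pser d u i) -
    (pairing (qser d u i) (pser d w i))) (d i - 1))"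
    by (rule sum.cong[OF refl]) (simp add: mat_trace_Pm_Qm)
  finally show ?thesis .
qed

section \<open>Derivatives along curves in the level sets\<close>

lemma holomorphic_curve_deriv:
  assumes "holomorphic_curve X r \<gamma>" "r > 0" "j \<in> coords X"
  shows "((\<lambda>s. \<gamma> s j) has_field_derivative velocity X \<gamma> j) (at 0)"
  using assms holomorphic_derivI[of "\<lambda>s. \<gamma> s j" "ball 0 r" 0] by (simp add: holomorphic_curve_def velocity_def)

lemma has_coeff_deriv_curve:
  assumes "holomorphic_curve quiver_quot r \<gamma>" "r > 0" "i \<in> {1..n}" "a < 2"
  shows "has_coeff_deriv (\<lambda>s. pser d (\<gamma> s) i a) (pser d (velocity quiver_quot \<gamma>) i a)"
    and "has_coeff_deriv (\<lambda>s. qser d (\<gamma> s) i a) (qser d (velocity quiver_quot \<gamma>) i a)"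
  using holomorphic_curve_deriv[OF assms(1,2)] assms(3,4)
  by (auto simp: has_coeff_deriv_def pser_def qser_def quiver_quot_simps quiver_coords_star)

text \<open>The shift by \<open>eta i\<close> is constant along the curve, so it drops out of the
  derivative.\<close>

lemma has_coeff_deriv_conn_curve:
  assumes "holomorphic_curve conn_quot r \<delta>" "r > 0" "i \<in> {1..n}" "a < 2" "b < 2"
  shows "has_coeff_deriv (\<lambda>s. xser (\<delta> s) i a b) (conn_ser d (velocity conn_quot \<delta>) i a b)"
  unfolding has_coeff_deriv_def
proof
  fix m
  show "((\<lambda>s. fps_nth (xser (\<delta> s) i a b) m) has_field_derivative fps_nth (conn_ser d (velocity conn_quot \<delta>) i a b) m) (at 0)"
  proof (cases "m < d i")
    case True
    then have "(i, d i - m, a, b) \<in> coords conn_quot" using assms by (auto simp: conn_quot_simps conn_coords_iff)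
    from DERIV_diff[OF holomorphic_curve_deriv[OF assms(1,2) this] DERIV_const]
    show ?thesis using True by (simp add: xser_nth conn_ser_def)
  qed (simp add: xser_def conn_ser_def tail_ser_def)
qed

lemma field_differentiable_conn_curve:
  assumes \<gamma>: "holomorphic_curve quiver_quot r \<gamma>" "r > 0" and k: "i \<in> {1..n}" "j \<in> {1..d i}" "a < 2" "b < 2"
  shows "(\<lambda>s. conn (\<gamma> s) (i, j, a, b)) field_differentiable at 0"
proof -
  have "has_coeff_deriv (\<lambda>s. pser d (\<gamma> s) i a * qser d (\<gamma> s) i b)
      (pser d (velocity quiver_quot \<gamma>) i a * qser d (\<gamma> 0) i b + pser d (\<gamma> 0) i a * qser d (velocity quiver_quot \<gamma>) i b)"
    by (intro has_coeff_deriv_mult has_coeff_deriv_curve[OF \<gamma>] k)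
  then have "(\<lambda>s. fps_nth (pser d (\<gamma> s) i a * qser d (\<gamma> s) i b) (d i - j)) field_differentiable at 0"
    unfolding has_coeff_deriv_def field_differentiable_def by blast
  then show ?thesis
    unfolding conn_index[OF k] by (intro field_differentiable_add field_differentiable_const)
qed

lemma field_differentiable_frame:
  assumes A: "\<And>i j a b. i \<in> {1..n} \<Longrightarrow> j \<in> {1..d i} \<Longrightarrow> a < 2 \<Longrightarrow> b < 2 \<Longrightarrow> (\<lambda>s. A s (i, j, a, b)) field_differentiable at 0"
    and "i0 \<in> {1..n}" "j0 \<in> {1..d i0}" "e < 2" "a < 2" "b < 2"
  shows "(\<lambda>s. gauge_frame (i0, j0) e (A s) a b) field_differentiable at 0"
proof -
  have one: "1 \<in> {1..n}" "d 1 \<in> {1..d 1}" using n_pos d_pos'[of 1] by auto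
  have x: "(\<lambda>s. A s (1, d 1, a, e) - (if a = e then fls_nth (eta 1) (- int (d 1)) else 0)) field_differentiable at 0" if "a < 2" for a
    by (intro field_differentiable_diff field_differentiable_const A one that assms)
  show ?thesis
  proof (cases "b = 0")
    case True
    then show ?thesis using x[OF \<open>a < 2\<close>] by (simp add: gauge_frame_def)
  next
    case False
    have "(\<lambda>s. A s (i0, j0, a, 0) * (A s (1, d 1, 0, e) - (if 0 = e then fls_nth (eta 1) (- int (d 1)) else 0)) +
      A s (i0, j0, a, 1) * (A s (1, d 1, 1, e) - (if 1 = e then fls_nth (eta 1) (- int (d 1)) else 0))) field_differentiable at 0"
      by (intro field_differentiable_add field_differentiable_mult x A assms) auto
    then show ?thesis using False by (simp add: gauge_frame_def Let_def)
  qed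
qed

lemma field_differentiable_frame_det:
  assumes A: "\<And>i j a b. i \<in> {1..n} \<Longrightarrow> j \<in> {1..d i} \<Longrightarrow> a < 2 \<Longrightarrow> b < 2 \<Longrightarrow> (\<lambda>s. A s (i, j, a, b)) field_differentiable at 0"
    and "i0 \<in> {1..n}" "j0 \<in> {1..d i0}" "e < 2"
  shows "(\<lambda>s. frame_det (i0, j0) e (A s)) field_differentiable at 0"
  unfolding frame_det_def
  by (intro field_differentiable_diff field_differentiable_mult field_differentiable_frame[where A = A] assms) auto

lemma field_differentiable_gauge:
  assumes A: "\<And>i j a b. i \<in> {1..n} \<Longrightarrow> j \<in> {1..d i} \<Longrightarrow> a < 2 \<Longrightarrow> b < 2 \<Longrightarrow> (\<lambda>s. A s (i, j, a, b)) field_differentiable at 0"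
    and C: "\<And>i j a b. i \<in> {1..n} \<Longrightarrow> j \<in> {1..d i} \<Longrightarrow> a < 2 \<Longrightarrow> b < 2 \<Longrightarrow> (\<lambda>s. C s (i, j, a, b)) field_differentiable at 0"
    and ij: "i0 \<in> {1..n}" "j0 \<in> {1..d i0}" and e: "e < 2" "e' < 2" and det: "frame_det (i0, j0) e (A 0) \<noteq> 0"
    and ab: "a < 2" "b < 2"
  shows "(\<lambda>s. gauge (i0, j0) e (A s) e' (C s) a b) field_differentiable at 0"
proof -
  have inv: "(\<lambda>s. frame_inv (i0, j0) e (A s) c b) field_differentiable at 0" if c: "c < 2" for c
  proof (cases "c = b")
    case True
    then show ?thesis unfolding frame_inv_def using c
      by (auto intro!: field_differentiable_divide field_differentiable_frame[where A = A] field_differentiable_frame_det[where A = A] A ij e det)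
  next
    case False
    have "(\<lambda>s. - gauge_frame (i0, j0) e (A s) c b / frame_det (i0, j0) e (A s)) field_differentiable at 0"
      by (intro field_differentiable_divide field_differentiable_minus field_differentiable_frame[where A = A] field_differentiable_frame_det[where A = A] A ij e det c ab)
    then show ?thesis using False by (simp add: frame_inv_def)
  qed
  show ?thesis
    unfolding gauge_def
    by (intro field_differentiable_add field_differentiable_mult inv field_differentiable_frame[where A = C] C ij e ab) auto
qed

text \<open>Here \<open>M = L K'\<close>, as in \<open>moving_gauge_invariance\<close>.\<close>

lemma lifted_curve:
  assumes r: "r > 0" and \<gamma>: "holomorphic_curve quiver_quot r \<gamma>" and \<delta>: "holomorphic_curve conn_quot r \<delta>"
    and eq: "\<And>s. s \<in> ball 0 r \<Longrightarrow> conn_equivalent (conn (\<gamma> s)) (\<delta> s)"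
    and ij: "i0 \<in> {1..n}" "j0 \<in> {1..d i0}" and e: "e < 2" "e' < 2"
    and det: "frame_det (i0, j0) e (conn (\<gamma> 0)) \<noteq> 0" and ne: "gauge_frame (i0, j0) e' (\<delta> 0) e' 0 \<noteq> 0"
  defines "K \<equiv> gauge (i0, j0) e (conn (\<gamma> 0)) e' (\<delta> 0)" and "L \<equiv> gauge (i0, j0) e' (\<delta> 0) e (conn (\<gamma> 0))"
  obtains M :: "nat \<Rightarrow> nat \<Rightarrow> complex" where
    "\<And>i a b. i \<in> {1..n} \<Longrightarrow> a < 2 \<Longrightarrow> b < 2 \<Longrightarrow> tcong (d i) (conn_ser d (velocity conn_quot \<delta>) i a b)
      (lact K (\<lambda>c. pser d (velocity quiver_quot \<gamma>) i c + lact M (pser d (\<gamma> 0) i) c) a * ract (qser d (\<gamma> 0) i) L b +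
       lact K (pser d (\<gamma> 0) i) a * ract (\<lambda>c. qser d (velocity quiver_quot \<gamma>) i c - ract (qser d (\<gamma> 0) i) M c) L b)"
    "\<And>i a b. i \<in> {1..n} \<Longrightarrow> a < 2 \<Longrightarrow> b < 2 \<Longrightarrow> tcong (d i) (xser (\<delta> 0) i a b)
      ((lact K (pser d (\<gamma> 0) i) a) *
       (ract (qser d (\<gamma> 0) i) L b))"
    "mat2 K * mat2 L = 1\<^sub>m 2" "mat2 L * mat2 K = 1\<^sub>m 2"
proof -
  have in0: "s \<in> ball 0 r \<Longrightarrow> \<gamma> s \<in> quiver_level Q d v lam" "s \<in> ball 0 r \<Longrightarrow> \<delta> s \<in> conn_level" for s
    using \<gamma> \<delta> by (auto simp: holomorphic_curve_def quiver_quot_simps conn_quot_simps)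
  have cA: "(\<lambda>s. conn (\<gamma> s) (i, j, a, b)) field_differentiable at 0" if "i \<in> {1..n}" "j \<in> {1..d i}" "a < 2" "b < 2" for i j a b
    by (rule field_differentiable_conn_curve[OF \<gamma> r that])
  have cC: "(\<lambda>s. \<delta> s (i, j, a, b)) field_differentiable at 0" if "i \<in> {1..n}" "j \<in> {1..d i}" "a < 2" "b < 2" for i j a b
    using holomorphic_curve_deriv[OF \<delta> r, of "(i, j, a, b)"] that
    by (auto simp: field_differentiable_def conn_quot_simps conn_coords_iff)
  have ev_ball: "\<forall>\<^sub>F s in nhds 0. s \<in> ball 0 r" using r by (intro eventually_nhds_in_open) auto
  \<comment> \<open>Both frame conditions are open, so they persist for small
    \<open>s\<close>.\<close>
  have ev_det: "\<forall>\<^sub>F s in nhds 0. frame_det (i0, j0) e (conn (\<gamma> s)) \<noteq> 0"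
    using field_differentiable_frame_det[of "\<lambda>s. conn (\<gamma> s)", OF cA ij e(1)] det
    by (auto dest!: field_differentiable_imp_continuous_at tendsto_imp_eventually_ne simp: continuous_at eventually_at_filter elim!: eventually_mono)
  have ev_ne: "\<forall>\<^sub>F s in nhds 0. gauge_frame (i0, j0) e' (\<delta> s) e' 0 \<noteq> 0"
    using field_differentiable_frame[of \<delta>, OF cC ij e(2) e(2), of 0] ne
    by (auto dest!: field_differentiable_imp_continuous_at tendsto_imp_eventually_ne simp: continuous_at eventually_at_filter elim!: eventually_mono)
  define k l where "k s = gauge (i0, j0) e (conn (\<gamma> s)) e' (\<delta> s)" and "l s = gauge (i0, j0) e' (\<delta> s) e (conn (\<gamma> s))" for s
  have good: "mat2 (k s) * mat2 (l s) = 1\<^sub>m 2 \<and> mat2 (l s) * mat2 (k s) = 1\<^sub>m 2 \<and>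
      (\<forall>i\<in>{1..n}. \<forall>j\<in>{1..d i}. coeff_mat (\<delta> s) i j * mat2 (k s) = mat2 (k s) * coeff_mat (conn (\<gamma> s)) i j)"
    if s: "s \<in> ball 0 r" "frame_det (i0, j0) e (conn (\<gamma> s)) \<noteq> 0" "gauge_frame (i0, j0) e' (\<delta> s) e' 0 \<noteq> 0" for s
  proof -
    note g = gauge_intertwines[OF eq[OF s(1)] in0(2)[OF s(1)] e(2,1) s(3,2) ij]
    show ?thesis
      using gauge_inverse[OF s(2) g(1)] gauge_inverse[OF g(1) s(2)] g(2) unfolding k_def l_def by blast
  qed
  have fin: "tcong (d i) (xser (\<delta> s) i a b)
      ((lact (k s) (pser d (\<gamma> s) i) a) *
       (ract (qser d (\<gamma> s) i) (l s) b))"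
    if s: "s \<in> ball 0 r" "frame_det (i0, j0) e (conn (\<gamma> s)) \<noteq> 0" "gauge_frame (i0, j0) e' (\<delta> s) e' 0 \<noteq> 0"
      and i: "i \<in> {1..n}" and ab: "a < 2" "b < 2" for s i a b
  proof -
    note g = good[OF s]
    define x where "x = xser (\<delta> s) i"
    define y where "y = xser (conn (\<gamma> s)) i"
    \<comment> \<open>This is \<open>x k = k y\<close> with \<open>y\<close> congruent to
      \<open>p q\<close>; multiplying by \<open>l\<close>, the inverse of \<open>k\<close>, gives
      \<open>x = (k p) (q l)\<close>.\<close>
    have tw: "tcong (d i) (ract (x a) (k s) b)
       (fps_const (k s a 0) * y 0 b + fps_const (k s a 1) * y 1 b)" if "b < 2" for b
      using g i intertwines_iff[of i "\<delta> s" "k s" "conn (\<gamma> s)"] ab that unfolding x_def y_def by blast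
    have kl: "k s 0 0 * l s 0 b + k s 0 1 * l s 1 b = (if b = 0 then 1 else 0)"
      "k s 1 0 * l s 0 b + k s 1 1 * l s 1 b = (if b = 1 then 1 else 0)"
      using conjunct1[OF g] ab unfolding mat2_mult mat2_one mat2_eq_iff by auto
    have kl': "fps_const (k s 0 0) * fps_const (l s 0 b) + fps_const (k s 0 1) * fps_const (l s 1 b) = (if b = 0 then 1 else 0)"
      "fps_const (k s 1 0) * fps_const (l s 0 b) + fps_const (k s 1 1) * fps_const (l s 1 b) = (if b = 1 then 1 else 0)"
      using kl by (auto split: if_splits)
    have "x a b = x a 0 * (fps_const (k s 0 0) * fps_const (l s 0 b) + fps_const (k s 0 1) * fps_const (l s 1 b)) +
       x a 1 * (fps_const (k s 1 0) * fps_const (l s 0 b) + fps_const (k s 1 1) * fps_const (l s 1 b))"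
      unfolding kl' using ab by (auto simp: less_2_cases_iff)
    also have "\<dots> = (x a 0 * fps_const (k s 0 0) + x a 1 * fps_const (k s 1 0)) * fps_const (l s 0 b) +
       (x a 0 * fps_const (k s 0 1) + x a 1 * fps_const (k s 1 1)) * fps_const (l s 1 b)"
      by (simp only: distrib_left distrib_right mult.assoc add_ac)
    also have "tcong (d i) \<dots> ((fps_const (k s a 0) * y 0 0 + fps_const (k s a 1) * y 1 0) * fps_const (l s 0 b) +
       (fps_const (k s a 0) * y 0 1 + fps_const (k s a 1) * y 1 1) * fps_const (l s 1 b))"
      by (intro tcong_add[OF tcong_mult tcong_mult] tw tcong_refl) auto
    also have "tcong (d i) \<dots> ((fps_const (k s a 0) * (pser d (\<gamma> s) i 0 * qser d (\<gamma> s) i 0) + fps_const (k s a 1) * (pser d (\<gamma> s) i 1 * qser d (\<gamma> s) i 0)) * fps_const (l s 0 b) +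
       (fps_const (k s a 0) * (pser d (\<gamma> s) i 0 * qser d (\<gamma> s) i 1) + fps_const (k s a 1) * (pser d (\<gamma> s) i 1 * qser d (\<gamma> s) i 1)) * fps_const (l s 1 b))"
      unfolding y_def by (intro tcong_add tcong_mult tcong_refl xser_conn i) auto
    also have "(fps_const (k s a 0) * (pser d (\<gamma> s) i 0 * qser d (\<gamma> s) i 0) + fps_const (k s a 1) * (pser d (\<gamma> s) i 1 * qser d (\<gamma> s) i 0)) * fps_const (l s 0 b) +
       (fps_const (k s a 0) * (pser d (\<gamma> s) i 0 * qser d (\<gamma> s) i 1) + fps_const (k s a 1) * (pser d (\<gamma> s) i 1 * qser d (\<gamma> s) i 1)) * fps_const (l s 1 b) =
       (lact (k s) (pser d (\<gamma> s) i) a) *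
       (ract (qser d (\<gamma> s) i) (l s) b)"
      by (simp only: distrib_left distrib_right mult.assoc add_ac mult.left_commute)
    finally show ?thesis unfolding x_def .
  qed
  have r0: "0 \<in> ball 0 r" using r by simp
  have zero: "k 0 = K" "l 0 = L" by (simp_all add: k_def l_def K_def L_def)
  note good0 = good[OF r0 det ne, unfolded zero]
  have "(\<lambda>s. k s a b) field_differentiable at 0" if "a < 2" "b < 2" for a b
    unfolding k_def by (rule field_differentiable_gauge[where A = "\<lambda>s. conn (\<gamma> s)" and C = \<delta>, OF cA cC ij e det that])
  then have "\<forall>a b. \<exists>D. a < 2 \<longrightarrow> b < 2 \<longrightarrow> ((\<lambda>s. k s a b) has_field_derivative D) (at 0)"
    unfolding field_differentiable_def by blast
  then obtain k' where k': "\<And>a b. a < 2 \<Longrightarrow> b < 2 \<Longrightarrow> ((\<lambda>s. k s a b) has_field_derivative k' a b) (at 0)" by metis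
  have det': "frame_det (i0, j0) e' (\<delta> 0) \<noteq> 0"
    by (rule gauge_intertwines(1)[OF eq[OF r0] in0(2)[OF r0] e(2,1) ne det ij])
  have "(\<lambda>s. l s a b) field_differentiable at 0" if "a < 2" "b < 2" for a b
    unfolding l_def by (rule field_differentiable_gauge[where A = \<delta> and C = "\<lambda>s. conn (\<gamma> s)", OF cC cA ij e(2,1) det' that])
  then have "\<forall>a b. \<exists>D. a < 2 \<longrightarrow> b < 2 \<longrightarrow> ((\<lambda>s. l s a b) has_field_derivative D) (at 0)"
    unfolding field_differentiable_def by blast
  then obtain l' where l': "\<And>a b. a < 2 \<Longrightarrow> b < 2 \<Longrightarrow> ((\<lambda>s. l s a b) has_field_derivative l' a b) (at 0)" by metis
  have ev: "\<forall>\<^sub>F s in nhds 0. s \<in> ball 0 r \<and> frame_det (i0, j0) e (conn (\<gamma> s)) \<noteq> 0 \<and> gauge_frame (i0, j0) e' (\<delta> s) e' 0 \<noteq> 0"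
    using ev_ball ev_det ev_ne by eventually_elim blast
  have lk': "l' a 0 * K 0 b + L a 0 * k' 0 b + (l' a 1 * K 1 b + L a 1 * k' 1 b) = 0" if ab: "a < 2" "b < 2" for a b
  proof -
    have "\<forall>\<^sub>F s in nhds 0. l s a 0 * k s 0 b + l s a 1 * k s 1 b = (if a = b then 1 else 0)"
      using ev
    proof eventually_elim
      case (elim s)
      then have "mat2 (l s) * mat2 (k s) = 1\<^sub>m 2" using good by blast
      then show ?case using ab unfolding mat2_mult mat2_one mat2_eq_iff by blast
    qed
    then have "((\<lambda>s. l s a 0 * k s 0 b + l s a 1 * k s 1 b) has_field_derivative D) (at 0) \<longleftrightarrow>
        ((\<lambda>s. if a = b then 1 else 0) has_field_derivative D) (at 0)" for D
      by (intro DERIV_cong_ev) auto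
    moreover have "((\<lambda>s. l s a 0 * k s 0 b + l s a 1 * k s 1 b) has_field_derivative
        l 0 a 0 * k' 0 b + l' a 0 * k 0 0 b + (l 0 a 1 * k' 1 b + l' a 1 * k 0 1 b)) (at 0)"
      by (intro DERIV_add DERIV_mult' k' l' ab) auto
    ultimately have "l 0 a 0 * k' 0 b + l' a 0 * k 0 0 b + (l 0 a 1 * k' 1 b + l' a 1 * k 0 1 b) = 0"
      using DERIV_unique DERIV_const by blast
    then show ?thesis by (simp add: zero algebra_simps)
  qed
  \<comment> \<open>The logarithmic derivative of the gauge: \<open>K' = K M\<close>, and
    differentiating \<open>l k = 1\<close> gives \<open>L' = - M L\<close>.\<close>
  define M where "M a b = L a 0 * k' 0 b + L a 1 * k' 1 b" for a b
  have KL: "K 0 0 * L 0 0 + K 0 1 * L 1 0 = 1" "K 0 0 * L 0 1 + K 0 1 * L 1 1 = 0"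
    "K 1 0 * L 0 0 + K 1 1 * L 1 0 = 0" "K 1 0 * L 0 1 + K 1 1 * L 1 1 = 1"
    using conjunct1[OF good0] unfolding mat2_mult mat2_one mat2_eq_iff all_less_2 by auto
  have kM: "k' a b = K a 0 * M 0 b + K a 1 * M 1 b" if "a < 2" for a b
  proof -
    have "K a 0 * M 0 b + K a 1 * M 1 b = (K a 0 * L 0 0 + K a 1 * L 1 0) * k' 0 b + (K a 0 * L 0 1 + K a 1 * L 1 1) * k' 1 b"
      by (simp add: M_def algebra_simps)
    then show ?thesis using that KL by (auto simp: less_2_cases_iff)
  qed
  have lM: "l' a b = - (M a 0 * L 0 b + M a 1 * L 1 b)" if "a < 2" "b < 2" for a b
  proof -
    have m: "l' a 0 * K 0 b + l' a 1 * K 1 b = - M a b" if "b < 2" for b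
      using lk'[OF \<open>a < 2\<close> that] unfolding eq_neg_iff_add_eq_0 by (simp add: M_def algebra_simps)
    have "(l' a 0 * K 0 0 + l' a 1 * K 1 0) * L 0 b + (l' a 0 * K 0 1 + l' a 1 * K 1 1) * L 1 b =
        l' a 0 * (K 0 0 * L 0 b + K 0 1 * L 1 b) + l' a 1 * (K 1 0 * L 0 b + K 1 1 * L 1 b)"
      by (simp add: algebra_simps)
    also have "\<dots> = l' a b" using that(2) KL by (auto simp: less_2_cases_iff)
    finally show ?thesis using m[of 0] m[of 1] by simp
  qed
  show thesis
  proof (rule that[of M])
    show "mat2 K * mat2 L = 1\<^sub>m 2" "mat2 L * mat2 K = 1\<^sub>m 2" using good0 by blast+
    show "tcong (d i) (xser (\<delta> 0) i a b)
      ((lact K (pser d (\<gamma> 0) i) a) *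
       (ract (qser d (\<gamma> 0) i) L b))"
      if "i \<in> {1..n}" "a < 2" "b < 2" for i a b
      using fin[OF r0 det ne that] unfolding zero .
    fix i a b :: nat assume i: "i \<in> {1..n}" and ab: "a < 2" "b < 2"
    let ?p = "\<lambda>a. pser d (\<gamma> 0) i a" and ?q = "\<lambda>a. qser d (\<gamma> 0) i a"
    let ?p' = "\<lambda>a. pser d (velocity quiver_quot \<gamma>) i a" and ?q' = "\<lambda>a. qser d (velocity quiver_quot \<gamma>) i a"
    note dp = has_coeff_deriv_curve(1)[OF \<gamma> r i] and dq = has_coeff_deriv_curve(2)[OF \<gamma> r i]
    have hp: "has_coeff_deriv (\<lambda>s. lact (k s) (pser d (\<gamma> s) i) a)
        (fps_const (k' a 0) * ?p 0 + fps_const (k 0 a 0) * ?p' 0 + (fps_const (k' a 1) * ?p 1 + fps_const (k 0 a 1) * ?p' 1))"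
      by (intro has_coeff_deriv_add has_coeff_deriv_mult has_coeff_deriv_fps_const k' dp ab) auto
    have hq: "has_coeff_deriv (\<lambda>s. ract (qser d (\<gamma> s) i) (l s) b)
        (?q' 0 * fps_const (l 0 0 b) + ?q 0 * fps_const (l' 0 b) + (?q' 1 * fps_const (l 0 1 b) + ?q 1 * fps_const (l' 1 b)))"
      by (intro has_coeff_deriv_add has_coeff_deriv_mult has_coeff_deriv_fps_const l' dq ab) auto
    have evt: "\<forall>\<^sub>F s in nhds 0. tcong (d i) (xser (\<delta> s) i a b)
      ((lact (k s) (pser d (\<gamma> s) i) a) *
       (ract (qser d (\<gamma> s) i) (l s) b))"
      using ev by eventually_elim (use fin i ab in blast)
    show "tcong (d i) (conn_ser d (velocity conn_quot \<delta>) i a b)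
      (lact K (\<lambda>c. ?p' c + lact M ?p c) a * ract ?q L b + lact K ?p a * ract (\<lambda>c. ?q' c - ract ?q M c) L b)"
      (is "tcong _ _ (?hp * _ + _ * ?hq)")
    proof -
      have 1: "fps_const (k' a 0) * ?p 0 + fps_const (k 0 a 0) * ?p' 0 + (fps_const (k' a 1) * ?p 1 + fps_const (k 0 a 1) * ?p' 1) = ?hp"
        unfolding zero kM[OF ab(1)] fps_const_add[symmetric] fps_const_mult[symmetric] by (simp only: algebra_simps)
      have one_less_numeral: "1 < (2 :: nat)" by simp
      have 2: "?q' 0 * fps_const (l 0 0 b) + ?q 0 * fps_const (l' 0 b) + (?q' 1 * fps_const (l 0 1 b) + ?q 1 * fps_const (l' 1 b)) = ?hq"
      proof -
        have "fps_const (l' c b) = - (fps_const (M c 0) * fps_const (L 0 b) + fps_const (M c 1) * fps_const (L 1 b))" if "c < 2" for c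
          by (simp add: lM[OF that ab(2)])
        note c0 = this[OF pos2] and c1 = this[OF one_less_numeral]
        show ?thesis
          unfolding c0 c1 zero by (simp add: zero algebra_simps del: fps_const_add fps_const_mult fps_const_neg fps_const_sub)
      qed
      show "?thesis"
        using has_coeff_deriv_tcong[OF has_coeff_deriv_conn_curve[OF \<delta> r i ab] has_coeff_deriv_mult[OF hp hq] evt]
        unfolding 1[unfolded zero] 2[unfolded zero] zero .
    qed
  qed
qed

lemma contract_inverse:
  assumes "mat2 L * mat2 K = 1\<^sub>m 2"
  shows "pairing (ract x L) (lact K y) = pairing x y"
proof -
  have "L 0 0 * K 0 0 + L 0 1 * K 1 0 = 1" "L 0 0 * K 0 1 + L 0 1 * K 1 1 = 0"
    "L 1 0 * K 0 0 + L 1 1 * K 1 0 = 0" "L 1 0 * K 0 1 + L 1 1 * K 1 1 = 1"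
    using assms unfolding mat2_mult mat2_one mat2_eq_iff all_less_2 by auto
  then have c: "fps_const (L 0 0) * fps_const (K 0 0) + fps_const (L 0 1) * fps_const (K 1 0) = 1"
    "fps_const (L 0 0) * fps_const (K 0 1) + fps_const (L 0 1) * fps_const (K 1 1) = 0"
    "fps_const (L 1 0) * fps_const (K 0 0) + fps_const (L 1 1) * fps_const (K 1 0) = 0"
    "fps_const (L 1 0) * fps_const (K 0 1) + fps_const (L 1 1) * fps_const (K 1 1) = 1"
    by simp_all
  have "pairing (ract x L) (lact K y) =
    x 0 * y 0 * (fps_const (L 0 0) * fps_const (K 0 0) + fps_const (L 0 1) * fps_const (K 1 0)) +
    x 0 * y 1 * (fps_const (L 0 0) * fps_const (K 0 1) + fps_const (L 0 1) * fps_const (K 1 1)) +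
    x 1 * y 0 * (fps_const (L 1 0) * fps_const (K 0 0) + fps_const (L 1 1) * fps_const (K 1 0)) +
    x 1 * y 1 * (fps_const (L 1 0) * fps_const (K 0 1) + fps_const (L 1 1) * fps_const (K 1 1))"
    by (simp add: algebra_simps del: fps_const_mult fps_const_add)
  then show ?thesis unfolding c by simp
qed

text \<open>The moment equations, with constant right-hand sides, are differentiated along a curve
  in the level set: on each arm modulo \<open>z^d\<close>, at the centre in the residue
  only.\<close>

lemma curve_moment_derivatives:
  assumes r: "r > 0" and \<gamma>: "holomorphic_curve quiver_quot r \<gamma>"
  defines "p \<equiv> pser d (\<gamma> 0)" and "q \<equiv> qser d (\<gamma> 0)" and "p' \<equiv> pser d (velocity quiver_quot \<gamma>)" and "q' \<equiv> qser d (velocity quiver_quot \<gamma>)"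
  shows "i \<in> {1..n} \<Longrightarrow> tcong (d i) (pairing (q i) (p' i) + (pairing (q' i) (p i))) 0"
    and "a < 2 \<Longrightarrow> b < 2 \<Longrightarrow> (\<Sum>i=1..n. fps_nth (p' i a * q i b + p i a * q' i b) (d i - 1)) = 0"
proof -
  have lev: "\<gamma> s \<in> quiver_level Q d v lam" if "s \<in> ball 0 r" for s
    using \<gamma> that by (auto simp: holomorphic_curve_def quiver_quot_simps)
  have ev: "\<forall>\<^sub>F s in nhds 0. s \<in> ball 0 r" using r by (intro eventually_nhds_in_open) auto
  note dp = has_coeff_deriv_curve(1)[OF \<gamma> r] and dq = has_coeff_deriv_curve(2)[OF \<gamma> r]
  show "tcong (d i) (pairing (q i) (p' i) + (pairing (q' i) (p i))) 0" if i: "i \<in> {1..n}"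
  proof -
    have D: "has_coeff_deriv (\<lambda>s. pairing (qser d (\<gamma> s) i) (pser d (\<gamma> s) i))
       (q' i 0 * p i 0 + q i 0 * p' i 0 + (q' i 1 * p i 1 + q i 1 * p' i 1))"
      unfolding p_def q_def p'_def q'_def
      by (intro has_coeff_deriv_add has_coeff_deriv_mult dp dq i) auto
    have "\<forall>\<^sub>F s in nhds 0. tcong (d i) (pairing (qser d (\<gamma> s) i) (pser d (\<gamma> s) i)) (lser i)"
      using ev by eventually_elim (use lev i quiver_level_iff in blast)
    from has_coeff_deriv_tcong[OF D has_coeff_deriv_const this]
    have "tcong (d i) (q' i 0 * p i 0 + q i 0 * p' i 0 + (q' i 1 * p i 1 + q i 1 * p' i 1)) 0" .
    then show ?thesis by (simp add: add_ac)
  qed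
  show "(\<Sum>i=1..n. fps_nth (p' i a * q i b + p i a * q' i b) (d i - 1)) = 0" if ab: "a < 2" "b < 2"
  proof -
    have D: "((\<lambda>s. \<Sum>i=1..n. fps_nth (pser d (\<gamma> s) i a * qser d (\<gamma> s) i b) (d i - 1)) has_field_derivative
       (\<Sum>i=1..n. fps_nth (p' i a * q i b + p i a * q' i b) (d i - 1))) (at 0)"
    proof (rule DERIV_sum)
      fix i assume i: "i \<in> {1..n}"
      have "has_coeff_deriv (\<lambda>s. pser d (\<gamma> s) i a * qser d (\<gamma> s) i b) (p' i a * q i b + p i a * q' i b)"
        unfolding p_def q_def p'_def q'_def by (intro has_coeff_deriv_mult dp dq i ab)
      then show "((\<lambda>s. fps_nth (pser d (\<gamma> s) i a * qser d (\<gamma> s) i b) (d i - 1)) has_field_derivative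
         fps_nth (p' i a * q i b + p i a * q' i b) (d i - 1)) (at 0)"
        by (simp add: has_coeff_deriv_def)
    qed
    have "\<forall>\<^sub>F s in nhds 0. (\<Sum>i=1..n. fps_nth (pser d (\<gamma> s) i a * qser d (\<gamma> s) i b) (d i - 1)) = (if a = b then - fls_residue (lam 0) else 0)"
      using ev by eventually_elim (use lev ab quiver_level_iff in blast)
    then have "((\<lambda>s. \<Sum>i=1..n. fps_nth (pser d (\<gamma> s) i a * qser d (\<gamma> s) i b) (d i - 1)) has_field_derivative D') (at 0) \<longleftrightarrow>
       ((\<lambda>s. if a = b then - fls_residue (lam 0) else 0) has_field_derivative D') (at 0)" for D'
      by (intro DERIV_cong_ev) auto
    with D show ?thesis using DERIV_unique DERIV_const by blast
  qed
qed

lemma local_part_velocity: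
  "local_part d u i = shifted_tail (d i) 0 (conn_ser d u i)"
  unfolding local_part_eq_conn_ser shifted_tail_def by simp

text \<open>The two target curves start at the same system, so the gauge matrices \<open>K\<close>
  and \<open>L\<close> at 0 are common and only the infinitesimal gauges \<open>M1\<close> and
  \<open>M2\<close> differ. \<open>K\<close> and \<open>L\<close> cancel in the rank-one formula for
  the Kirillov-Kostant-Souriau form; \<open>M1\<close> and \<open>M2\<close> cancel only after
  summing over the arms, by the equation at the centre.\<close>

lemma preserves_form_conn: "preserves_form quiver_quot conn_quot (quotient_morphism.induced conn_quot conn)"
proof -
  interpret qm: quotient_morphism quiver_quot conn_quot conn by (rule quotient_morphism_conn)
  show ?thesis
    unfolding preserves_form_def
  proof (intro allI impI, elim conjE)
    fix r :: real and \<gamma>1 \<gamma>2 \<delta>1 \<delta>2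
    assume r: "r > 0" and \<gamma>1: "holomorphic_curve quiver_quot r \<gamma>1" and \<gamma>2: "holomorphic_curve quiver_quot r \<gamma>2" and \<gamma>: "\<gamma>1 0 = \<gamma>2 0"
      and \<delta>1: "holomorphic_curve conn_quot r \<delta>1" and \<delta>2: "holomorphic_curve conn_quot r \<delta>2" and \<delta>: "\<delta>1 0 = \<delta>2 0"
      and lift: "\<forall>s\<in>ball 0 r. qm.induced (orbit quiver_quot (\<gamma>1 s)) = orbit conn_quot (\<delta>1 s) \<and> qm.induced (orbit quiver_quot (\<gamma>2 s)) = orbit conn_quot (\<delta>2 s)"
    \<comment> \<open>Equality of classes is all that relates the curves; pointwise it means
      conjugacy.\<close>
    have equiv: "conn_equivalent (conn x) y"
      if "qm.induced (orbit quiver_quot x) = orbit conn_quot y" "x \<in> level quiver_quot" "y \<in> level conn_quot" for x y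
    proof -
      have "orbit conn_quot (conn x) = orbit conn_quot y" using that qm.induced_orbit by simp
      then have "(conn x, y) \<in> orbit_rel conn_quot" using qm.orbit_eq_iff_Y qm.F_level that by blast
      then show ?thesis by (simp add: conn_quot_simps)
    qed
    have eq1: "conn_equivalent (conn (\<gamma>1 s)) (\<delta>1 s)" and eq2: "conn_equivalent (conn (\<gamma>2 s)) (\<delta>2 s)" if "s \<in> ball 0 r" for s
      using lift that \<gamma>1 \<gamma>2 \<delta>1 \<delta>2 by (auto intro!: equiv simp: holomorphic_curve_def)
    have r0: "0 \<in> ball 0 r" using r by simp
    have lev: "\<gamma>1 0 \<in> quiver_level Q d v lam" "\<delta>1 0 \<in> conn_level"
      using \<gamma>1 \<delta>1 r0 by (auto simp: holomorphic_curve_def quiver_quot_simps conn_quot_simps)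
    obtain e i0 j0 where e: "e < 2" and ij: "i0 \<in> {1..n}" "j0 \<in> {1..d i0}" and det: "frame_det (i0, j0) e (conn (\<gamma>1 0)) \<noteq> 0"
      by (rule exists_frame[OF conn_in_level[OF lev(1)]])
    have one: "1 \<in> {1..n}" using n_pos by simp
    obtain e' where e': "e' < 2" "fps_nth (xser (\<delta>1 0) 1 e' e') 0 \<noteq> 0"
      using exists_unit_diagonal[OF lev(2) one] by blast
    then have ne: "gauge_frame (i0, j0) e' (\<delta>1 0) e' 0 \<noteq> 0"
      using d_pos'[OF one] by (simp add: gauge_frame_def xser_nth)
    define K L where "K = gauge (i0, j0) e (conn (\<gamma>1 0)) e' (\<delta>1 0)" and "L = gauge (i0, j0) e' (\<delta>1 0) e (conn (\<gamma>1 0))"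
    define p q where "p = pser d (\<gamma>1 0)" and "q = qser d (\<gamma>1 0)"
    define p1 q1 p2 q2 where "p1 = pser d (velocity quiver_quot \<gamma>1)" and "q1 = qser d (velocity quiver_quot \<gamma>1)"
      and "p2 = pser d (velocity quiver_quot \<gamma>2)" and "q2 = qser d (velocity quiver_quot \<gamma>2)"
    define Ph where "Ph p' i a = lact K (p' i) a" for p' :: "nat \<Rightarrow> nat \<Rightarrow> complex fps" and i a
    define Qh where "Qh q' i b = ract (q' i) L b" for q' :: "nat \<Rightarrow> nat \<Rightarrow> complex fps" and i b
    define P where "P p' M i a = p' i a + lact M (p i) a" for p' :: "nat \<Rightarrow> nat \<Rightarrow> complex fps" and M i a
    define R where "R q' M i a = q' i a - ract (q i) M a" for q' :: "nat \<Rightarrow> nat \<Rightarrow> complex fps" and M i a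
    obtain M1 where M1: "\<And>i a b. i \<in> {1..n} \<Longrightarrow> a < 2 \<Longrightarrow> b < 2 \<Longrightarrow>
        tcong (d i) (conn_ser d (velocity conn_quot \<delta>1) i a b) (Ph (P p1 M1) i a * Qh q i b + Ph p i a * Qh (R q1 M1) i b)"
      and x: "\<And>i a b. i \<in> {1..n} \<Longrightarrow> a < 2 \<Longrightarrow> b < 2 \<Longrightarrow> tcong (d i) (xser (\<delta>1 0) i a b) (Ph p i a * Qh q i b)"
      and LK: "mat2 L * mat2 K = 1\<^sub>m 2"
      apply (rule lifted_curve[OF r \<gamma>1 \<delta>1 eq1 ij e e'(1) det ne], assumption)
      subgoal premises prems for M
        by (rule that[of M]; unfold Ph_def Qh_def P_def R_def K_def L_def p_def q_def p1_def q1_def; rule prems; assumption)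
      done
    obtain M2 where M2: "\<And>i a b. i \<in> {1..n} \<Longrightarrow> a < 2 \<Longrightarrow> b < 2 \<Longrightarrow>
        tcong (d i) (conn_ser d (velocity conn_quot \<delta>2) i a b) (Ph (P p2 M2) i a * Qh q i b + Ph p i a * Qh (R q2 M2) i b)"
      apply (rule lifted_curve[OF r \<gamma>2 \<delta>2 eq2 ij e e'(1) det[unfolded \<gamma>] ne[unfolded \<delta>]], assumption)
      subgoal premises prems for M
        by (rule that[of M]; unfold Ph_def Qh_def P_def R_def K_def L_def p_def q_def p2_def q2_def \<gamma> \<delta>; rule prems; assumption)
      done
    have contract: "pairing (Qh x i) (Ph y i) = pairing (x i) (y i)" for x y i
      unfolding Qh_def Ph_def by (rule contract_inverse[OF LK])
    have der1: "tcong (d i) (pairing (q i) (p1 i) + (pairing (q1 i) (p i))) 0" if "i \<in> {1..n}" for i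
      using curve_moment_derivatives(1)[OF r \<gamma>1 that] by (simp only: p_def q_def p1_def q1_def)
    have der2: "tcong (d i) (pairing (q i) (p2 i) + (pairing (q2 i) (p i))) 0" if "i \<in> {1..n}" for i
      using curve_moment_derivatives(1)[OF r \<gamma>2 that] by (simp only: p_def q_def p2_def q2_def \<gamma>)
    \<comment> \<open>An infinitesimal gauge changes \<open>q p'\<close> and \<open>q' p\<close> by
      opposite amounts, so the gauged tangent vectors remain traceless.\<close>
    have PR: "pairing (q i) (P p' M i) + (pairing (R q' M i) (p i)) =
        pairing (q i) (p' i) + (pairing (q' i) (p i))" for p' q' M i
      by (simp add: P_def R_def algebra_simps)
    have kks: "kks_form 2 (local_part d (\<delta>1 0) i) (local_part d (velocity conn_quot \<delta>1) i) (local_part d (velocity conn_quot \<delta>2) i) =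
       fps_nth (pairing (R q2 M2 i) (P p1 M1 i) - pairing (R q1 M1 i) (P p2 M2 i)) (d i - 1)"
      if i: "i \<in> {1..n}" for i
    proof -
      have l1: "local_part d (\<delta>1 0) i = shifted_tail (d i) (eta i) (\<lambda>a b. Ph p i a * Qh q i b)"
        unfolding local_part_eq_shifted_tail[OF i] shifted_tail_eq_iff using x[OF i] by blast
      have l2: "local_part d (velocity conn_quot \<delta>1) i = shifted_tail (d i) 0 (\<lambda>a b. Ph (P p1 M1) i a * Qh q i b + Ph p i a * Qh (R q1 M1) i b)"
        unfolding local_part_velocity shifted_tail_eq_iff using M1[OF i] by blast
      have l3: "local_part d (velocity conn_quot \<delta>2) i = shifted_tail (d i) 0 (\<lambda>a b. Ph (P p2 M2) i a * Qh q i b + Ph p i a * Qh (R q2 M2) i b)"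
        unfolding local_part_velocity shifted_tail_eq_iff using M2[OF i] by blast
      have "tcong (d i) (pairing (q i) (p i)) (lser i)"
        using lev(1) i unfolding p_def q_def quiver_level_iff by blast
      from tcong_nth_0[OF this d_pos'[OF i]] have unit: "fps_nth (pairing (q i) (p i)) 0 \<noteq> 0"
        using lser_0[OF i] by (simp only: not_False_eq_True)
      show ?thesis
        unfolding l1 l2 l3
        by (subst kks_form_rank_one[OF d_pos'[OF i]]) (simp_all only: contract PR unit der1[OF i] der2[OF i] not_False_eq_True)
    qed
    have "two_form conn_quot (\<delta>1 0) (velocity conn_quot \<delta>1) (velocity conn_quot \<delta>2) =
       (\<Sum>i=1..n. fps_nth (pairing (R q2 M2 i) (P p1 M1 i) - pairing (R q1 M1 i) (P p2 M2 i)) (d i - 1))"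
      unfolding conn_quot_simps(4) by (rule sum.cong[OF refl kks])
    also have "\<dots> = (\<Sum>i=1..n. fps_nth (pairing (q2 i) (p1 i) - pairing (q1 i) (p2 i)) (d i - 1))"
      unfolding P_def R_def
    proof (rule moving_gauge_invariance[where c = "- fls_residue (lam 0)"])
      fix a b :: nat assume ab: "a < 2" "b < 2"
      show "(\<Sum>i=1..n. fps_nth (p i a * q i b) (d i - 1)) = (if a = b then - fls_residue (lam 0) else 0)"
        using lev(1) ab unfolding p_def q_def quiver_level_iff by blast
      show "(\<Sum>i=1..n. fps_nth (p1 i a * q i b + p i a * q1 i b) (d i - 1)) = 0"
        using curve_moment_derivatives(2)[OF r \<gamma>1 ab] by (simp only: p_def q_def p1_def q1_def)
      show "(\<Sum>i=1..n. fps_nth (p2 i a * q i b + p i a * q2 i b) (d i - 1)) = 0"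
        using curve_moment_derivatives(2)[OF r \<gamma>2 ab] by (simp only: p_def q_def p2_def q2_def \<gamma>)
    qed
    also have "\<dots> = two_form quiver_quot (\<gamma>1 0) (velocity quiver_quot \<gamma>1) (velocity quiver_quot \<gamma>2)"
      unfolding quiver_quot_simps(4) quiver_form_eq p1_def q1_def p2_def q2_def ..
    finally show "two_form conn_quot (\<delta>1 0) (velocity conn_quot \<delta>1) (velocity conn_quot \<delta>2) = two_form quiver_quot (\<gamma>1 0) (velocity quiver_quot \<gamma>1) (velocity quiver_quot \<gamma>2)" .
  qed
qed

lemma symplectically_isomorphic_quiver_connections: "symplectically_isomorphic quiver_quot conn_quot"
  unfolding symplectically_isomorphic_def
  using quotient_morphism.biholomorphic_induced[OF quotient_morphism_conn] preserves_form_conn by blast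

end

theorem proposition1p1:
  fixes n :: nat and d v :: "nat \<Rightarrow> nat"
    and lam xi eta :: "nat \<Rightarrow> complex fls" and t :: "nat \<Rightarrow> complex"
  assumes "n \<ge> 1"
    and "\<forall>i\<in>{0..n}. d i > 0" and "d 0 = 1"
    and "v 0 = 2" and "\<forall>i\<in>{1..n}. v i = 1"
    and "\<forall>i\<in>{0..n}. lam i \<in> laurent_tails (d i)"
    and "\<forall>i\<in>{1..n}. fls_nth (lam i) (- int (d i)) \<noteq> 0"
    and "inj_on t {1..n}"
    and "\<forall>i\<in>{1..n}. xi i \<in> laurent_tails (d i)"
    and "\<forall>i\<in>{1..n}. eta i \<in> laurent_tails (d i)"
    and "\<forall>i\<in>{1..n}. xi i - eta i = lam i"
    and "(\<Sum>i = 1..n. fls_residue (eta i)) = fls_residue (lam 0)"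
  shows "symplectically_isomorphic
           (quiver_variety (star_quiver n) d lam v)
           (connection_moduli n d t (\<lambda>i. diag2 (xi i) (eta i))) \<and>
         connection_moduli n d t (\<lambda>i. diag2 (xi i) (eta i)) =
           M_irr n d t (\<lambda>i. diag2 (xi i) (eta i))"
proof -
  interpret star_connection n d v lam xi eta t
    by unfold_locales (use assms in auto)
  \<comment> \<open>Both connection spaces have the level set \<open>conn_level\<close>, so they
    coincide as quotients and one isomorphism serves for both.\<close>
  show ?thesis
    using symplectically_isomorphic_quiver_connections
    unfolding connection_moduli_def M_irr_def irr_level_eq stable_connections_eq quiver_quot_def conn_quot_def by blast
qed

end
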